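(* Suppose that $\lambda$ is an infinite regular cardinal. Then there exist two maps $c:[\lambda^+]^2\rightarrow\lambda^+\times\lambda^+$ and $e:[\lambda^+]^2\rightarrow\lambda$ such that: \begin{itemize} \item $e$ is subadditive; \item for every $A\in[\lambda^+]^{\lambda^+}$, there exists a club $D\subseteq\lambda^+$ such that for every $\delta\in D$, for every $\beta\in\lambda^+\setminus\delta$, for every $(\xi_0,\xi_1)\in\delta\times\delta$, for every $i<\lambda$, there are cofinally many $\alpha<\delta$ such that $\alpha\in A$, $c(\alpha,\beta)=(\xi_0,\xi_1)$ and $e(\alpha,\beta)>i$. \end{itemize}
   Context: The ambient theory is ZFC. Cardinals are von Neumann ordinals. $[\lambda^+]^{\lambda^+}$ is the set of subsets of $\lambda^+$ of cardinality $\lambda^+$, and $[\lambda^+]^2$ is the set of two-element subsets of $\lambda^+$. For a map $f$ on $[\lambda^+]^2$ and $\alpha<\beta<\lambda^+$, $f(\alpha,\beta)$ denotes $f(\{\alpha,\beta\})$. A club in $\lambda^+$ is a closed unbounded subset of $\lambda^+$. A coloring $e:[\kappa]^2\rightarrow\theta$ is subadditive if for all $\alpha<\beta<\gamma<\kappa$: (1) $e(\alpha,\gamma)\le\max\{e(\alpha,\beta),e(\beta,\gamma)\}$, and (2) $e(\alpha,\beta)\le\max\{e(\alpha,\gamma),e(\beta,\gamma)\}$. *)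

theory Defs
  imports "HOL-Library.Ramsey" "HOL-Library.FuncSet"
begin

unbundle cardinal_syntax

text \<open>
  An ordinal is presented as a (reflexive) well-order r on a type: its elements are
  the members of \<^term>\<open>Field r\<close>, and an element a, viewed as the ordinal
  {x. x < a}, is \<^term>\<open>underS r a\<close>. An infinite cardinal is an r with
  \<^term>\<open>Card_order r\<close> and \<^term>\<open>infinite (Field r)\<close>, and its successor cardinal is
  \<^term>\<open>cardSuc r\<close>. Colorings of pairs take the two-element set itself as argument.
\<close>

definition subadditive :: "'k rel \<Rightarrow> 't rel \<Rightarrow> ('k set \<Rightarrow> 't) \<Rightarrow> bool" where
  "subadditive \<kappa> \<theta> e \<longleftrightarrow>
     (\<forall>\<gamma>\<in>Field \<kappa>. \<forall>\<beta>\<in>underS \<kappa> \<gamma>. \<forall>\<alpha>\<in>underS \<kappa> \<beta>.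
        (e {\<alpha>, \<gamma>}, wo_rel.max2 \<theta> (e {\<alpha>, \<beta>}) (e {\<beta>, \<gamma>})) \<in> \<theta> \<and>
        (e {\<alpha>, \<beta>}, wo_rel.max2 \<theta> (e {\<alpha>, \<gamma>}) (e {\<beta>, \<gamma>})) \<in> \<theta>)"

text \<open>
  Closedness: if \<delta> is nonzero and \<open>D \<inter> \<delta>\<close> has elements strictly above every \<alpha> below \<delta>
  (which forces \<delta> to be a limit), then \<delta> belongs to D.
\<close>

definition club_in :: "'k rel \<Rightarrow> 'k set \<Rightarrow> bool" where
  "club_in \<kappa> D \<longleftrightarrow>
     D \<subseteq> Field \<kappa> \<and>
     (\<forall>\<alpha>\<in>Field \<kappa>. \<exists>\<delta>\<in>D. (\<alpha>, \<delta>) \<in> \<kappa>) \<and>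
     (\<forall>\<delta>\<in>Field \<kappa>. underS \<kappa> \<delta> \<noteq> {} \<and>
        (\<forall>\<alpha>\<in>underS \<kappa> \<delta>. \<exists>\<beta>\<in>D \<inter> underS \<kappa> \<delta>. \<alpha> \<in> underS \<kappa> \<beta>) \<longrightarrow> \<delta> \<in> D)"

definition cofinally_many_below :: "'k rel \<Rightarrow> 'k \<Rightarrow> ('k \<Rightarrow> bool) \<Rightarrow> bool" where
  "cofinally_many_below \<kappa> \<delta> P \<longleftrightarrow>
     (\<forall>\<gamma>\<in>underS \<kappa> \<delta>. \<exists>\<alpha>\<in>underS \<kappa> \<delta>. (\<gamma>, \<alpha>) \<in> \<kappa> \<and> P \<alpha>)"

end

theory Submission
  imports Defs
begin

text \<open>
  Fix a ladder (a cofinal subset all of whose proper initial segments have size less than \<open>\<lambda>\<close>) in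
  every ordinal below \<open>\<lambda>\<^sup>+\<close>. Along the ladders one builds a subadditive \<open>rho\<close> such that
  \<open>{\<alpha> < \<beta>. rho(\<alpha>, \<beta>) \<le> i}\<close> always has size less than \<open>\<lambda>\<close>. By subadditivity, \<open>rho(\<sqdot>, \<beta>)\<close> and
  \<open>rho(\<sqdot>, \<gamma>)\<close> agree on \<open>\<beta>\<close> up to fewer than \<open>\<lambda>\<close> arguments.

  The colouring \<open>c\<close> is an oscillation in the style of Moore. Walk from \<open>\<beta>\<close> down to \<open>\<alpha>\<close> along the
  ladders, and at each step compare \<open>rho(\<xi>, \<alpha>)\<close> with \<open>rho(\<xi>, \<beta>)\<close> at the associated point \<open>\<xi>\<close> of the lower
  trace. If there are \<open>n\<close> steps at which the answer changes from \<open>\<le>\<close> to \<open>>\<close>, the 2-adic valuation of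
  \<open>n\<close> selects one of them, and \<open>c(\<alpha>, \<beta>)\<close> is the colour of that step in a partition of the points of
  cofinality \<open>\<lambda>\<close> into stationary sets indexed by \<open>\<lambda>\<^sup>+ \<times> \<lambda>\<^sup>+\<close>. For all unbounded \<open>A\<close> and \<open>B\<close> one finds
  \<open>\<alpha> \<in> A\<close> and arbitrarily many \<open>\<beta> \<in> B\<close> whose values of \<open>n\<close> are consecutive, so that \<open>c\<close> attains
  every colour on \<open>A \<times> B\<close>. Thinning out \<open>A\<close> then upgrades this to all \<open>\<beta>\<close> beyond some \<open>\<delta>\<close>.
\<close>

text \<open>Coherence, ladders and walks leave exceptional sets of size less than \<lambda>, in
  general not finite ones. The argument therefore lives at points of cofinality \<lambda>, below
  which such sets are bounded: there walks split, and \<open>rho\<close> to two different targets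
  agrees near the top. A rise needs a bit False followed by a bit True. False comes for free from
  coherence. True needs an \<alpha> with large values of \<open>rho\<close> on a prescribed finite
  set; such \<alpha> exist by local smallness. The colour is read at the walk point where the rise
  occurs, and this point can be drawn from any prescribed stationary set. The rises below the point
  where control ends depend on \<alpha>, while the \<beta> are chosen earlier. Hence the selecting
  function has to reach a fixed index r within a gap that does not depend on the offset. The demand
  that e exceed i costs little: at cofinality \<lambda> the \<alpha> violating it are bounded, and
  the remaining points of the club are reached by closing off.\<close>

text \<open>What matters is that M does not depend on T. The numbers of 2-adic valuation exactly r
  are those congruent to \<open>2 ^ r\<close> modulo \<open>2 ^ Suc r\<close>, so every value recurs
  with bounded gaps.\<close>

lemma valuation_syndetic:
  "\<exists>h :: nat \<Rightarrow> nat. \<forall>r. \<exists>M. \<forall>T. \<exists>j. 1 \<le> j \<and> j \<le> M \<and> h (T + j) = r"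
proof (intro exI allI)
  fix r T :: nat
  define q :: nat where "q = 2 ^ Suc r"
  \<comment> \<open>The next number above T congruent to \<open>2 ^ r\<close> modulo q: in the block
    of T if the residue is still below \<open>2 ^ r\<close>, in the following block
    otherwise.\<close>
  define N where "N = T div q * q + (if T mod q < 2 ^ r then 2 ^ r else q + 2 ^ r)"
  have q: "q > 0" "(2::nat) ^ r < q" by (simp_all add: q_def)
  have T: "T = T div q * q + T mod q" by simp
  have "T mod q < q" using q by simp
  then have "T < N" "N \<le> T + 2 * q"
    unfolding N_def using T q by (cases "T mod q < 2 ^ r"; simp only: if_True if_False; linarith)+
  moreover have "(LEAST k. \<not> 2 ^ Suc k dvd N) = r"
  proof (rule Least_equality)
    have "N mod q = 2 ^ r" unfolding N_def using q by (auto simp: mod_add_left_eq[symmetric])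
    then show "\<not> 2 ^ Suc r dvd N" using q by (auto simp: q_def dvd_eq_mod_eq_0)
    have "(2::nat) ^ r dvd N" unfolding N_def q_def by simp
    then show "r \<le> k" if "\<not> 2 ^ Suc k dvd N" for k
      using that by (meson dvd_trans le_imp_power_dvd not_less_eq_eq)
  qed
  \<comment> \<open>The witnesses left open by \<open>exI\<close> are fixed here: the 2-adic
    valuation for h, \<open>2 * 2 ^ Suc r\<close> for M and \<open>N - T\<close> for j.\<close>
  ultimately show "1 \<le> N - T \<and> N - T \<le> 2 * 2 ^ Suc r \<and> (LEAST k. \<not> 2 ^ Suc k dvd (T + (N - T))) = r"
    by (auto simp: q_def)
qed

definition valuation :: "nat \<Rightarrow> nat" where
  "valuation = (SOME h. \<forall>r. \<exists>M. \<forall>T. \<exists>j. 1 \<le> j \<and> j \<le> M \<and> h (T + j) = r)"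

lemma valuation: "\<exists>M. \<forall>T. \<exists>j. 1 \<le> j \<and> j \<le> M \<and> valuation (T + j) = r"
  using someI_ex[OF valuation_syndetic, folded valuation_def] by blast

text \<open>The sets \<open>\<Lambda>\<close> and \<open>K\<close> play the roles of \<open>\<lambda>\<close> and \<open>\<lambda>\<^sup>+\<close>, as initial segments of well-ordered types.\<close>

locale succ_regular =
  fixes K :: "'k::wellorder set" and \<Lambda> :: "'l::wellorder set"
  assumes infinite_\<Lambda>: "infinite \<Lambda>"
    and \<Lambda>_down: "\<nu> \<in> \<Lambda> \<Longrightarrow> \<mu> \<le> \<nu> \<Longrightarrow> \<mu> \<in> \<Lambda>"
    and \<Lambda>_segment: "\<nu> \<in> \<Lambda> \<Longrightarrow> |{..<\<nu>}| <o |\<Lambda>|"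
    and \<Lambda>_bounded: "Y \<subseteq> \<Lambda> \<Longrightarrow> |Y| <o |\<Lambda>| \<Longrightarrow> \<exists>\<nu>\<in>\<Lambda>. \<forall>y\<in>Y. y < \<nu>"
    and K_down: "\<beta> \<in> K \<Longrightarrow> \<alpha> \<le> \<beta> \<Longrightarrow> \<alpha> \<in> K"
    and K_segment: "\<beta> \<in> K \<Longrightarrow> |{..<\<beta>}| \<le>o |\<Lambda>|"
    and K_bounded: "X \<subseteq> K \<Longrightarrow> |X| \<le>o |\<Lambda>| \<Longrightarrow> \<exists>\<beta>\<in>K. \<forall>x\<in>X. x < \<beta>"
    and K_least: "X \<subseteq> K \<Longrightarrow> \<not> |X| \<le>o |\<Lambda>| \<Longrightarrow> |K| \<le>o |X|"
begin

section \<open>Sets of size less than \<lambda> and of size at most \<lambda>\<close>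

abbreviation small :: "'c set \<Rightarrow> bool" where
  "small X \<equiv> |X| <o |\<Lambda>|"

abbreviation medium :: "'c set \<Rightarrow> bool" where
  "medium X \<equiv> |X| \<le>o |\<Lambda>|"

lemma small_iff_not: "small X \<longleftrightarrow> \<not> |\<Lambda>| \<le>o |X|"
  using not_ordLeq_iff_ordLess[OF card_of_Well_order card_of_Well_order, of \<Lambda> X] by simp

lemma small_mono: "small Y \<Longrightarrow> X \<subseteq> Y \<Longrightarrow> small X"
  by (rule ordLeq_ordLess_trans[OF card_of_mono1])

lemma small_image: "small X \<Longrightarrow> small (f ` X)"
  by (rule ordLeq_ordLess_trans[OF card_of_image])

lemma small_inj: "small (f ` X) \<Longrightarrow> inj_on f X \<Longrightarrow> small X"
  by (rule ordIso_ordLess_trans[OF card_of_ordIsoI[OF inj_on_imp_bij_betw]])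

lemma small_finite: "finite X \<Longrightarrow> small X"
  unfolding small_iff_not using card_of_ordLeq_finite[of \<Lambda> X] infinite_\<Lambda> by auto

text \<open>Regularity: under a surjection from the union onto \<Lambda> each piece would have a
  bounded image, and the fewer than \<lambda> bounds would be bounded in turn.\<close>

lemma small_UN:
  assumes "small I" "\<And>i. i \<in> I \<Longrightarrow> small (X i)"
  shows "small (\<Union>i\<in>I. X i)"
proof (rule ccontr)
  assume "\<not> ?thesis"
  then have "|\<Lambda>| \<le>o |\<Union>i\<in>I. X i|" using small_iff_not by blast
  moreover have "\<Lambda> \<noteq> {}" using infinite_\<Lambda> by auto
  ultimately obtain f where f: "f ` (\<Union>i\<in>I. X i) = \<Lambda>"
    using card_of_ordLeq2[of \<Lambda> "\<Union>i\<in>I. X i"] by blast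
  have "\<exists>\<nu>\<in>\<Lambda>. \<forall>x \<in> f ` X i \<inter> \<Lambda>. x < \<nu>" if "i \<in> I" for i
    by (rule \<Lambda>_bounded[OF Int_lower2 small_mono[OF small_image[OF assms(2)[OF that]] Int_lower1]])
  then obtain h where h: "\<And>i. i \<in> I \<Longrightarrow> h i \<in> \<Lambda> \<and> (\<forall>x \<in> f ` X i \<inter> \<Lambda>. x < h i)" by metis
  then obtain \<nu> where "\<nu> \<in> \<Lambda>" "\<forall>x \<in> h ` I. x < \<nu>"
    using \<Lambda>_bounded[of "h ` I"] small_image[OF assms(1)] by blast
  moreover obtain i where "i \<in> I" "\<nu> \<in> f ` X i" using f \<open>\<nu> \<in> \<Lambda>\<close> by blast
  ultimately show False using h[of i] by (meson IntI imageI order_less_asym)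
qed

lemma small_Un: "small X \<Longrightarrow> small Y \<Longrightarrow> small (X \<union> Y)"
  using small_UN[of "{X, Y}" "\<lambda>X. X", OF small_finite] by auto

lemma small_atMost: "\<nu> \<in> \<Lambda> \<Longrightarrow> small {..\<nu>}"
  using small_Un[OF small_finite[of "{\<nu>}"] \<Lambda>_segment[of \<nu>]] by (rule small_mono) auto

lemma medium_mono: "medium Y \<Longrightarrow> X \<subseteq> Y \<Longrightarrow> medium X"
  by (rule ordLeq_transitive[OF card_of_mono1])

lemma medium_image: "medium X \<Longrightarrow> medium (f ` X)"
  by (rule ordLeq_transitive[OF card_of_image])

lemma medium_finite: "finite X \<Longrightarrow> medium X"
  by (rule ordLess_imp_ordLeq[OF small_finite])

lemma medium_UN: "medium I \<Longrightarrow> (\<And>i. i \<in> I \<Longrightarrow> medium (X i)) \<Longrightarrow> medium (\<Union>i\<in>I. X i)"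
  using card_of_UNION_ordLeq_infinite[OF infinite_\<Lambda>] by blast

lemma medium_Un: "medium X \<Longrightarrow> medium Y \<Longrightarrow> medium (X \<union> Y)"
  using medium_UN[of "{X, Y}" "\<lambda>X. X", OF medium_finite] by auto

lemma medium_Times: "medium X \<Longrightarrow> medium Y \<Longrightarrow> medium (X \<times> Y)"
  by (rule card_of_Sigma_ordLeq_infinite[OF infinite_\<Lambda>]) auto

lemma medium_\<Lambda>: "medium \<Lambda>"
  by (rule ordLeq_reflexive[OF card_of_Well_order])

lemma medium_nat: "medium (UNIV :: nat set)"
  using infinite_\<Lambda> by (simp add: infinite_iff_card_of_nat)

lemma medium_atMost: "\<beta> \<in> K \<Longrightarrow> medium {..\<beta>}"
  using medium_Un[OF medium_finite[of "{\<beta>}"] K_segment[of \<beta>]] by (rule medium_mono) auto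

text \<open>Finite sets of data will index diagonal intersections and Fodor's lemma, which allow
  only \<lambda> many indices below each point.\<close>

lemma medium_Fpow:
  assumes "medium X"
  shows "medium (Fpow X)"
proof -
  have *: "medium {s. s \<subseteq> X \<and> finite s \<and> card s = n}" for n
  proof (induction n)
    case 0
    have "{s. s \<subseteq> X \<and> finite s \<and> card s = 0} = {{}}" by auto
    then show ?case by (simp add: medium_finite)
  next
    case (Suc n)
    have "{s. s \<subseteq> X \<and> finite s \<and> card s = Suc n}
        \<subseteq> (\<lambda>(x, s). insert x s) ` (X \<times> {s. s \<subseteq> X \<and> finite s \<and> card s = n})"
      by (auto simp: card_Suc_eq image_iff)
    then show ?case using medium_image[OF medium_Times[OF assms Suc]] medium_mono by blast
  qed
  have "Fpow X = (\<Union>n. {s. s \<subseteq> X \<and> finite s \<and> card s = n})" by (auto simp: Fpow_def)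
  then show ?thesis by (simp add: medium_UN[OF medium_nat *])
qed

lemma not_medium_K: "\<not> medium K"
  using K_bounded[of K] by blast

lemma K_above: "\<alpha> \<in> K \<Longrightarrow> \<exists>\<beta>\<in>K. \<alpha> < \<beta>"
  using K_bounded[of "{\<alpha>}", OF _ medium_finite] by auto

lemma \<Lambda>_above: "\<alpha> \<in> \<Lambda> \<Longrightarrow> \<exists>\<beta>\<in>\<Lambda>. \<alpha> < \<beta>"
  using \<Lambda>_bounded[of "{\<alpha>}", OF _ small_finite] by auto

definition unbounded :: "'k set \<Rightarrow> bool" where
  "unbounded X \<longleftrightarrow> X \<subseteq> K \<and> (\<forall>\<gamma>\<in>K. \<exists>\<alpha>\<in>X. \<gamma> < \<alpha>)"

lemma unbounded_iff: "X \<subseteq> K \<Longrightarrow> unbounded X \<longleftrightarrow> \<not> medium X"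
proof
  assume "X \<subseteq> K" "unbounded X"
  then show "\<not> medium X" using K_bounded[of X] unfolding unbounded_def by (meson order_less_asym)
next
  assume X: "X \<subseteq> K" "\<not> medium X"
  show "unbounded X" unfolding unbounded_def
  proof (intro conjI ballI X(1), rule ccontr)
    fix \<gamma> assume "\<gamma> \<in> K" "\<not> (\<exists>\<alpha>\<in>X. \<gamma> < \<alpha>)"
    then have "X \<subseteq> {..\<gamma>}" by (auto simp: not_less)
    then show False using X medium_mono[OF medium_atMost[OF \<open>\<gamma> \<in> K\<close>]] by blast
  qed
qed

subsection \<open>A locally small subadditive colouring\<close>

definition enum :: "'k \<Rightarrow> 'k \<Rightarrow> 'l" where
  "enum \<beta> = (SOME h. inj_on h {..<\<beta>} \<and> h ` {..<\<beta>} \<subseteq> \<Lambda>)"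

lemma enum: assumes "\<beta> \<in> K" shows "inj_on (enum \<beta>) {..<\<beta>}" "enum \<beta> ` {..<\<beta>} \<subseteq> \<Lambda>"
proof -
  have "\<exists>h. inj_on h {..<\<beta>} \<and> h ` {..<\<beta>} \<subseteq> \<Lambda>"
    using K_segment[OF assms] card_of_ordLeq by blast
  from someI_ex[OF this] show "inj_on (enum \<beta>) {..<\<beta>}" "enum \<beta> ` {..<\<beta>} \<subseteq> \<Lambda>"
    unfolding enum_def by auto
qed

lemma enum_in: "\<beta> \<in> K \<Longrightarrow> \<alpha> < \<beta> \<Longrightarrow> enum \<beta> \<alpha> \<in> \<Lambda>"
  using enum by blast

lemma enum_small: "\<beta> \<in> K \<Longrightarrow> i \<in> \<Lambda> \<Longrightarrow> small {\<alpha>. \<alpha> < \<beta> \<and> enum \<beta> \<alpha> \<le> i}"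
  by (rule small_inj[of "enum \<beta>"], rule small_mono[OF small_atMost[of i]])
     (auto intro: inj_on_subset[OF enum(1)])

text \<open>The points at which \<open>enum \<beta>\<close> is smaller than at every later point.
  Minimising \<open>enum \<beta>\<close> over a tail gives cofinality; as
  \<open>enum \<beta>\<close> increases along these points and is injective into \<Lambda>, proper
  initial segments are small.\<close>

definition ladder :: "'k \<Rightarrow> 'k set" where
  "ladder \<beta> = {\<eta>. \<eta> < \<beta> \<and> (\<forall>\<eta>'. \<eta> < \<eta>' \<longrightarrow> \<eta>' < \<beta> \<longrightarrow> enum \<beta> \<eta> < enum \<beta> \<eta>')}"

lemma ladder_less: "\<eta> \<in> ladder \<beta> \<Longrightarrow> \<eta> < \<beta>"
  by (simp add: ladder_def)

lemma ladder_cofinal: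
  assumes "\<beta> \<in> K" "\<zeta> < \<beta>"
  shows "\<exists>\<eta>\<in>ladder \<beta>. \<zeta> \<le> \<eta>"
proof -
  define P where "P i \<longleftrightarrow> (\<exists>\<eta>. \<zeta> \<le> \<eta> \<and> \<eta> < \<beta> \<and> enum \<beta> \<eta> = i)" for i
  have "P (enum \<beta> \<zeta>)" using assms(2) by (auto simp: P_def)
  then have "P (Least P)" by (rule LeastI)
  then obtain \<eta> where \<eta>: "\<zeta> \<le> \<eta>" "\<eta> < \<beta>" "enum \<beta> \<eta> = Least P" by (auto simp: P_def)
  have min: "enum \<beta> \<eta> \<le> enum \<beta> \<eta>'" if "\<zeta> \<le> \<eta>'" "\<eta>' < \<beta>" for \<eta>'
    unfolding \<eta>(3) using that by (intro Least_le) (auto simp: P_def)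
  have "\<eta> \<in> ladder \<beta>" unfolding ladder_def
  proof (intro CollectI conjI allI impI)
    fix \<eta>' assume "\<eta> < \<eta>'" "\<eta>' < \<beta>"
    then have "enum \<beta> \<eta> \<noteq> enum \<beta> \<eta>'" using enum(1)[OF assms(1)] \<eta>(2) by (auto simp: inj_on_def)
    moreover have "enum \<beta> \<eta> \<le> enum \<beta> \<eta>'"
      using min \<eta>(1) \<open>\<eta> < \<eta>'\<close> \<open>\<eta>' < \<beta>\<close> by (meson order_less_imp_le order_trans)
    ultimately show "enum \<beta> \<eta> < enum \<beta> \<eta>'" by (rule order.not_eq_order_implies_strict)
  qed (use \<eta> in auto)
  then show ?thesis using \<eta> by blast
qed

lemma ladder_small:
  assumes "\<beta> \<in> K" "\<zeta> < \<beta>"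
  shows "small {\<eta> \<in> ladder \<beta>. \<eta> < \<zeta>}"
proof -
  obtain \<eta> where \<eta>: "\<eta> \<in> ladder \<beta>" "\<zeta> \<le> \<eta>" using ladder_cofinal assms by blast
  have "enum \<beta> \<alpha> \<le> enum \<beta> \<eta>" if "\<alpha> \<in> ladder \<beta>" "\<alpha> < \<zeta>" for \<alpha>
    using that \<eta> by (simp add: ladder_def order_less_imp_le)
  then have "{\<eta> \<in> ladder \<beta>. \<eta> < \<zeta>} \<subseteq> {\<alpha>. \<alpha> < \<beta> \<and> enum \<beta> \<alpha> \<le> enum \<beta> \<eta>}"
    by (auto simp: ladder_less)
  then show ?thesis
    by (rule small_mono[OF enum_small[OF assms(1) enum_in[OF assms(1) ladder_less[OF \<eta>(1)]]]])
qed

text \<open>The set \<open>{\<alpha>. rho \<alpha> \<delta> \<le> i}\<close> is the union of the sets \<open>{\<eta>} \<union> {\<alpha>. rho \<alpha> \<eta> \<le> i}\<close> over fewer than \<open>\<lambda>\<close>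
  points \<open>\<eta>\<close> of the ladder of \<open>\<delta>\<close> that pairwise have colour at most \<open>i\<close>; hence it is a chain, closed
  downwards, of the tree order that \<open>rho \<le> i\<close> induces.\<close>

function rho :: "'k \<Rightarrow> 'k \<Rightarrow> 'l" where
  "rho \<alpha> \<delta> = (LEAST i. i \<in> \<Lambda> \<and> (\<exists>\<eta>\<in>ladder \<delta>. enum \<delta> \<eta> \<le> i \<and>
     (\<forall>\<eta>2\<in>ladder \<delta>. \<eta>2 \<le> \<eta> \<longrightarrow> (\<forall>\<eta>1\<in>ladder \<delta>. \<eta>1 < \<eta>2 \<longrightarrow> rho \<eta>1 \<eta>2 \<le> i)) \<and>
     (\<alpha> = \<eta> \<or> \<alpha> < \<eta> \<and> rho \<alpha> \<eta> \<le> i)))"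
  by pat_completeness auto
termination
  by (relation "inv_image {(x, y). x < y} snd") (auto simp: wf ladder_less)

declare rho.simps [simp del]

definition branch :: "'l \<Rightarrow> 'k \<Rightarrow> 'k set" where
  "branch i \<delta> = {\<eta>\<in>ladder \<delta>. enum \<delta> \<eta> \<le> i \<and>
     (\<forall>\<eta>2\<in>ladder \<delta>. \<eta>2 \<le> \<eta> \<longrightarrow> (\<forall>\<eta>1\<in>ladder \<delta>. \<eta>1 < \<eta>2 \<longrightarrow> rho \<eta>1 \<eta>2 \<le> i))}"

lemma rho_J: "rho \<alpha> \<delta> = (LEAST i. i \<in> \<Lambda> \<and> (\<exists>\<eta>\<in>branch i \<delta>. \<alpha> = \<eta> \<or> \<alpha> < \<eta> \<and> rho \<alpha> \<eta> \<le> i))"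
  by (subst rho.simps) (simp add: branch_def conj_assoc Bex_def)

lemma branch_less: "\<eta> \<in> branch i \<delta> \<Longrightarrow> \<eta> < \<delta>"
  by (simp add: branch_def ladder_less)

lemma branch_mono: "\<eta> \<in> branch i \<delta> \<Longrightarrow> i \<le> j \<Longrightarrow> \<eta> \<in> branch j \<delta>"
  unfolding branch_def by (blast intro: order_trans)

lemma branch_small: "\<delta> \<in> K \<Longrightarrow> i \<in> \<Lambda> \<Longrightarrow> small (branch i \<delta>)"
  by (rule small_mono[OF enum_small[of \<delta> i]]) (auto simp: branch_def ladder_less)

lemma branch_chain: "\<eta>1 \<in> branch i \<delta> \<Longrightarrow> \<eta>2 \<in> branch i \<delta> \<Longrightarrow> \<eta>1 < \<eta>2 \<Longrightarrow> rho \<eta>1 \<eta>2 \<le> i"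
  by (simp add: branch_def)

text \<open>The least i exists: up to a ladder point \<eta> not below \<alpha> the ladder has fewer
  than \<lambda> pairs, so by regularity one i bounds their colours together with
  \<open>enum \<delta> \<eta>\<close> and \<open>rho \<alpha> \<eta>\<close>.\<close>

lemma rho_in: "\<delta> \<in> K \<Longrightarrow> \<alpha> < \<delta> \<Longrightarrow> rho \<alpha> \<delta> \<in> \<Lambda> \<and> (\<exists>\<eta>\<in>branch (rho \<alpha> \<delta>) \<delta>. \<alpha> = \<eta> \<or> \<alpha> < \<eta> \<and> rho \<alpha> \<eta> \<le> rho \<alpha> \<delta>)"
proof (induction \<delta> arbitrary: \<alpha> rule: less_induct)
  case (less \<delta>)
  have in\<Lambda>: "rho \<eta>1 \<eta>2 \<in> \<Lambda>" if "\<eta>1 < \<eta>2" "\<eta>2 < \<delta>" for \<eta>1 \<eta>2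
    using less.IH[of \<eta>2 \<eta>1] that K_down[OF less.prems(1), of \<eta>2] by simp
  obtain \<eta> where \<eta>: "\<eta> \<in> ladder \<delta>" "\<alpha> \<le> \<eta>" using ladder_cofinal less.prems by blast
  define P where "P = (\<Union>\<eta>2\<in>{\<eta>2\<in>ladder \<delta>. \<eta>2 \<le> \<eta>}. (\<lambda>\<eta>1. rho \<eta>1 \<eta>2) ` {\<eta>1\<in>ladder \<delta>. \<eta>1 < \<eta>2})"
  have "small {\<eta>2\<in>ladder \<delta>. \<eta>2 \<le> \<eta>}"
    by (rule small_mono[OF small_Un[OF small_finite[of "{\<eta>}"] ladder_small[OF less.prems(1)]]])
       (use ladder_less[OF \<eta>(1)] in auto)
  then have "small P" unfolding P_def
    by (intro small_UN small_image ladder_small less.prems) (auto simp: ladder_less)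
  \<comment> \<open>If \<open>\<alpha> = \<eta>\<close>, the last entry just repeats
    \<open>enum \<delta> \<eta>\<close>, so that it is in \<Lambda>.\<close>
  then have "small (P \<union> {enum \<delta> \<eta>, if \<alpha> < \<eta> then rho \<alpha> \<eta> else enum \<delta> \<eta>})" (is "small ?Q")
    using small_Un small_finite by (metis finite.emptyI finite.insertI)
  moreover have "?Q \<subseteq> \<Lambda>"
    using in\<Lambda> \<eta> ladder_less enum_in less.prems by (auto simp: P_def)
  ultimately obtain i where i: "i \<in> \<Lambda>" "\<forall>x\<in>?Q. x < i" using \<Lambda>_bounded by blast
  have "\<eta> \<in> branch i \<delta>" unfolding branch_def using \<eta> i by (fastforce simp: P_def)
  moreover have "\<alpha> = \<eta> \<or> \<alpha> < \<eta> \<and> rho \<alpha> \<eta> \<le> i" using i \<eta> by (cases "\<alpha> < \<eta>") auto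
  ultimately have "i \<in> \<Lambda> \<and> (\<exists>\<eta>\<in>branch i \<delta>. \<alpha> = \<eta> \<or> \<alpha> < \<eta> \<and> rho \<alpha> \<eta> \<le> i)" using i by blast
  then show ?case unfolding rho_J[of \<alpha> \<delta>] by (rule LeastI)
qed

lemma rho_\<Lambda>: "\<delta> \<in> K \<Longrightarrow> \<alpha> < \<delta> \<Longrightarrow> rho \<alpha> \<delta> \<in> \<Lambda>"
  using rho_in by blast

lemma rho_le_iff:
  assumes "\<delta> \<in> K" "\<alpha> < \<delta>" "i \<in> \<Lambda>"
  shows "rho \<alpha> \<delta> \<le> i \<longleftrightarrow> (\<exists>\<eta>\<in>branch i \<delta>. \<alpha> = \<eta> \<or> \<alpha> < \<eta> \<and> rho \<alpha> \<eta> \<le> i)"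
proof
  assume "rho \<alpha> \<delta> \<le> i"
  then show "\<exists>\<eta>\<in>branch i \<delta>. \<alpha> = \<eta> \<or> \<alpha> < \<eta> \<and> rho \<alpha> \<eta> \<le> i"
    using rho_in[OF assms(1,2)] branch_mono by (meson order_trans)
next
  assume "\<exists>\<eta>\<in>branch i \<delta>. \<alpha> = \<eta> \<or> \<alpha> < \<eta> \<and> rho \<alpha> \<eta> \<le> i"
  then show "rho \<alpha> \<delta> \<le> i" using assms(3) by (subst rho_J) (intro Least_le, blast)
qed

text \<open>Both subadditivity inequalities at a fixed threshold; taking i to be the maximum on
  their right-hand side recovers them. The induction works because the witnesses for \<alpha> and
  \<beta> lie on one chain, so both points can be moved up to the larger witness, which is below
  \<gamma>.\<close>

lemma rho_trans_tree:
  assumes "\<gamma> \<in> K" "\<alpha> < \<beta>" "\<beta> < \<gamma>" "i \<in> \<Lambda>" "rho \<beta> \<gamma> \<le> i"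
  shows "(rho \<alpha> \<beta> \<le> i \<longrightarrow> rho \<alpha> \<gamma> \<le> i) \<and> (rho \<alpha> \<gamma> \<le> i \<longrightarrow> rho \<alpha> \<beta> \<le> i)"
  using assms
proof (induction \<gamma> arbitrary: \<alpha> \<beta> rule: less_induct)
  case (less \<gamma>)
  have IH: "rho \<beta> \<eta> \<le> i \<Longrightarrow> rho \<alpha> \<beta> \<le> i \<longleftrightarrow> rho \<alpha> \<eta> \<le> i" if "\<eta> \<in> branch i \<gamma>" "\<alpha> < \<beta>" "\<beta> < \<eta>" for \<alpha> \<beta> \<eta>
    using less.IH[of \<eta> \<alpha> \<beta>] branch_less[OF that(1)] K_down[OF less.prems(1), of \<eta>] that less.prems(4) by auto
  have a\<gamma>: "\<alpha> < \<gamma>" using less.prems by simp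
  obtain \<eta> where \<eta>: "\<eta> \<in> branch i \<gamma>" "\<beta> = \<eta> \<or> \<beta> < \<eta> \<and> rho \<beta> \<eta> \<le> i"
    using less.prems rho_le_iff[of \<gamma> \<beta> i] by blast
  show ?case
  proof (intro conjI impI)
    assume "rho \<alpha> \<beta> \<le> i"
    then have "\<alpha> < \<eta> \<and> rho \<alpha> \<eta> \<le> i" using \<eta> IH[of \<eta> \<alpha> \<beta>] less.prems by auto
    then show "rho \<alpha> \<gamma> \<le> i" using rho_le_iff[OF less.prems(1) a\<gamma> less.prems(4)] \<eta> by blast
  next
    assume "rho \<alpha> \<gamma> \<le> i"
    then obtain \<eta>' where \<eta>': "\<eta>' \<in> branch i \<gamma>" "\<alpha> = \<eta>' \<or> \<alpha> < \<eta>' \<and> rho \<alpha> \<eta>' \<le> i"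
      using rho_le_iff[OF less.prems(1) a\<gamma> less.prems(4)] by blast
    have up: "x = m \<or> x < m \<and> rho x m \<le> i"
      if "x = y \<or> x < y \<and> rho x y \<le> i" "y \<in> branch i \<gamma>" "m \<in> branch i \<gamma>" "y \<le> m" for x y m
      using that branch_chain[of y i \<gamma> m] IH[of m x y] by (cases "y = m") auto
    define m where "m = max \<eta> \<eta>'"
    have m: "m \<in> branch i \<gamma>" using \<eta> \<eta>' by (simp add: m_def max_def)
    have "\<beta> = m \<or> \<beta> < m \<and> rho \<beta> m \<le> i" "\<alpha> = m \<or> \<alpha> < m \<and> rho \<alpha> m \<le> i"
      using up[OF \<eta>(2,1) m] up[OF \<eta>'(2,1) m] by (auto simp: m_def)
    then show "rho \<alpha> \<beta> \<le> i" using IH[OF m, of \<alpha> \<beta>] less.prems by auto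
  qed
qed

lemma rho_max_in: "\<gamma> \<in> K \<Longrightarrow> \<alpha> < \<beta> \<Longrightarrow> \<beta> < \<gamma> \<Longrightarrow> rho \<alpha> \<beta> \<in> \<Lambda> \<and> rho \<beta> \<gamma> \<in> \<Lambda> \<and> rho \<alpha> \<gamma> \<in> \<Lambda>"
  using rho_\<Lambda> K_down[of \<gamma> \<beta>] by (meson order_less_imp_le order_less_trans)

lemma rho_subadditive:
  assumes "\<gamma> \<in> K" "\<alpha> < \<beta>" "\<beta> < \<gamma>"
  shows "rho \<alpha> \<gamma> \<le> max (rho \<alpha> \<beta>) (rho \<beta> \<gamma>)" "rho \<alpha> \<beta> \<le> max (rho \<alpha> \<gamma>) (rho \<beta> \<gamma>)"
  using rho_trans_tree[OF assms, of "max (rho \<alpha> \<beta>) (rho \<beta> \<gamma>)"] rho_trans_tree[OF assms, of "max (rho \<alpha> \<gamma>) (rho \<beta> \<gamma>)"]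
    rho_max_in[OF assms] by (auto simp: max_def split: if_splits)

lemma rho_small: "\<delta> \<in> K \<Longrightarrow> i \<in> \<Lambda> \<Longrightarrow> small {\<alpha>. \<alpha> < \<delta> \<and> rho \<alpha> \<delta> \<le> i}"
proof (induction \<delta> rule: less_induct)
  case (less \<delta>)
  have "small (\<Union>\<eta>\<in>branch i \<delta>. {\<eta>} \<union> {\<alpha>. \<alpha> < \<eta> \<and> rho \<alpha> \<eta> \<le> i})"
  proof (intro small_UN branch_small less.prems)
    fix \<eta> assume "\<eta> \<in> branch i \<delta>"
    then have "\<eta> < \<delta>" by (rule branch_less)
    with less.IH[OF this] K_down[OF less.prems(1), of \<eta>] less.prems(2)
    show "small ({\<eta>} \<union> {\<alpha>. \<alpha> < \<eta> \<and> rho \<alpha> \<eta> \<le> i})"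
      by (intro small_Un[OF small_finite]) auto
  qed
  then show ?case
    by (rule small_mono) (use rho_le_iff[OF less.prems(1) _ less.prems(2)] in blast)
qed

text \<open>As in an ultrametric triangle: if \<open>rho \<xi> \<beta>\<close> exceeds
  \<open>rho \<beta> \<gamma>\<close>, the two inequalities force \<open>rho \<xi> \<gamma>\<close>
  to equal it. The exceptional \<xi> are few by \<open>rho_small\<close>.\<close>

lemma rho_coherent:
  assumes "\<beta> \<in> K" "\<gamma> \<in> K" "\<delta> \<le> \<beta>" "\<delta> \<le> \<gamma>"
  shows "small {\<xi>. \<xi> < \<delta> \<and> rho \<xi> \<beta> \<noteq> rho \<xi> \<gamma>}"
proof -
  have *: "small {\<xi>. \<xi> < \<beta> \<and> rho \<xi> \<beta> \<noteq> rho \<xi> \<gamma>}" if "\<beta> < \<gamma>" "\<gamma> \<in> K" for \<beta> \<gamma>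
  proof -
    have "rho \<xi> \<beta> = rho \<xi> \<gamma>" if "\<xi> < \<beta>" "\<not> rho \<xi> \<beta> \<le> rho \<beta> \<gamma>" for \<xi>
      using rho_subadditive[OF \<open>\<gamma> \<in> K\<close> that(1) \<open>\<beta> < \<gamma>\<close>] that(2) by (auto simp: max_def split: if_splits)
    then have "{\<xi>. \<xi> < \<beta> \<and> rho \<xi> \<beta> \<noteq> rho \<xi> \<gamma>} \<subseteq> {\<xi>. \<xi> < \<beta> \<and> rho \<xi> \<beta> \<le> rho \<beta> \<gamma>}" by blast
    moreover have "\<beta> \<in> K" using that K_down[of \<gamma> \<beta>] by simp
    ultimately show ?thesis using small_mono[OF rho_small[OF _ rho_\<Lambda>[OF that(2,1)]]] by blast
  qed
  consider "\<beta> < \<gamma>" | "\<gamma> < \<beta>" | "\<beta> = \<gamma>" by (rule linorder_cases)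
  then show ?thesis
  proof cases
    case 1 show ?thesis by (rule small_mono[OF *[OF 1 assms(2)]]) (use assms in auto)
  next
    case 2 show ?thesis by (rule small_mono[OF *[OF 2 assms(1)]]) (use assms in auto)
  next
    case 3 then show ?thesis by (simp add: small_finite)
  qed
qed

subsection \<open>Closure points and stationary sets\<close>

text \<open>Clubs are handled through functions: for f from K to K this set is a club, and every
  club contains one, with f taking \<zeta> to the next element of the club. Demanding \<eta> above
  \<zeta> as well makes every member a limit.\<close>

definition closure_points :: "('k \<Rightarrow> 'k) \<Rightarrow> 'k set" where
  "closure_points f = {\<delta> \<in> K. (\<exists>\<zeta>. \<zeta> < \<delta>) \<and> (\<forall>\<zeta><\<delta>. \<exists>\<eta><\<delta>. \<zeta> < \<eta> \<and> f \<zeta> < \<eta>)}"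

text \<open>The points of cofinality at least \<open>\<lambda>\<close>.\<close>

definition cof_points :: "'k set" where
  "cof_points = {\<delta> \<in> K. \<forall>X. X \<subseteq> {..<\<delta>} \<longrightarrow> small X \<longrightarrow> (\<exists>\<zeta><\<delta>. \<forall>x\<in>X. x < \<zeta>)}"

definition stationary :: "'k set \<Rightarrow> bool" where
  "stationary S \<longleftrightarrow> (\<forall>f. f ` K \<subseteq> K \<longrightarrow> (\<exists>\<delta>\<in>S. \<delta> \<in> closure_points f))"

lemma stationaryD: "stationary S \<Longrightarrow> f ` K \<subseteq> K \<Longrightarrow> \<exists>\<delta>\<in>S. \<delta> \<in> closure_points f"
  by (simp add: stationary_def)

lemma closure_points_K: "\<delta> \<in> closure_points f \<Longrightarrow> \<delta> \<in> K"
  by (simp add: closure_points_def)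

lemma closure_points_limit: "\<delta> \<in> closure_points f \<Longrightarrow> \<zeta> < \<delta> \<Longrightarrow> \<exists>\<eta><\<delta>. \<zeta> < \<eta>"
  unfolding closure_points_def by blast

lemma closure_points_closed: "\<delta> \<in> closure_points f \<Longrightarrow> \<zeta> < \<delta> \<Longrightarrow> f \<zeta> < \<delta>"
  unfolding closure_points_def by (auto intro: order_less_trans)

lemma closure_points_nonempty: "\<delta> \<in> closure_points f \<Longrightarrow> \<exists>\<zeta>. \<zeta> < \<delta>"
  unfolding closure_points_def by blast

lemma closure_pointsI: "\<delta> \<in> K \<Longrightarrow> \<zeta>0 < \<delta> \<Longrightarrow> (\<And>\<zeta>. \<zeta> < \<delta> \<Longrightarrow> \<exists>\<eta><\<delta>. \<zeta> < \<eta>) \<Longrightarrow> (\<And>\<zeta>. \<zeta> < \<delta> \<Longrightarrow> f \<zeta> < \<delta>) \<Longrightarrow> \<delta> \<in> closure_points f"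
proof -
  assume a: "\<delta> \<in> K" "\<zeta>0 < \<delta>" "\<And>\<zeta>. \<zeta> < \<delta> \<Longrightarrow> \<exists>\<eta><\<delta>. \<zeta> < \<eta>" "\<And>\<zeta>. \<zeta> < \<delta> \<Longrightarrow> f \<zeta> < \<delta>"
  have "\<exists>\<eta><\<delta>. \<zeta> < \<eta> \<and> f \<zeta> < \<eta>" if "\<zeta> < \<delta>" for \<zeta>
    using a(3)[of "max \<zeta> (f \<zeta>)"] a(4)[OF that] that by auto
  then show "\<delta> \<in> closure_points f" using a(1,2) unfolding closure_points_def by blast
qed

lemma K_ex: "\<exists>\<alpha>. \<alpha> \<in> K"
  using not_medium_K medium_finite[of K] by (metis ex_in_conv finite.emptyI)

text \<open>Closing off takes \<lambda> many stages instead of countably many. A small set below the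
  supremum is dominated by fewer than \<lambda> stages, and these are bounded in \<Lambda> by
  regularity.\<close>

lemma closure_points_S0_unbounded:
  assumes f: "f ` K \<subseteq> K" and \<gamma>: "\<gamma> \<in> K"
  shows "\<exists>\<delta>\<in>closure_points f \<inter> cof_points. \<gamma> < \<delta>"
proof -
  have step: "\<exists>k\<in>K. \<gamma> < k \<and> (\<forall>y\<in>Y. y < k \<and> (\<forall>\<zeta>\<le>y. f \<zeta> < k))" if "Y \<subseteq> K" "medium Y" for Y
  proof -
    have A: "medium ({\<gamma>} \<union> Y \<union> (\<Union>y\<in>Y. f ` {..y}))"
      using that by (intro medium_Un[OF medium_Un[OF medium_finite]] medium_UN medium_image medium_atMost) auto
    have "f ` {..y} \<subseteq> K" if "y \<in> Y" for y
    proof (rule order_trans[OF image_mono f])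
      show "{..y} \<subseteq> K" using K_down[of y] \<open>Y \<subseteq> K\<close> that by auto
    qed
    then have B: "{\<gamma>} \<union> Y \<union> (\<Union>y\<in>Y. f ` {..y}) \<subseteq> K" using that(1) \<gamma> by (simp add: UN_subset_iff)
    obtain k where "k \<in> K" "\<forall>x\<in>{\<gamma>} \<union> Y \<union> (\<Union>y\<in>Y. f ` {..y}). x < k"
      using K_bounded[OF B A] by (elim bexE)
    then show ?thesis by (intro bexI[of _ k]) auto
  qed
  define G where "G Y = (SOME k. k \<in> K \<and> \<gamma> < k \<and> (\<forall>y\<in>Y. y < k \<and> (\<forall>\<zeta>\<le>y. f \<zeta> < k)))" for Y
  have G: "G Y \<in> K \<and> \<gamma> < G Y \<and> (\<forall>y\<in>Y. y < G Y \<and> (\<forall>\<zeta>\<le>y. f \<zeta> < G Y))" if "Y \<subseteq> K" "medium Y" for Y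
    unfolding G_def by (rule someI_ex[OF step[OF that, unfolded Bex_def]])
  \<comment> \<open>The recursion runs over the whole type; its values matter only at i in
    \<Lambda>, where few enough stages precede for \<open>G\<close> to meet its
    specification.\<close>
  define h where "h = wfrec {(x, y :: 'l). x < y} (\<lambda>h i. G (h ` {..<i}))"
  have h_rec: "h i = G (h ` {..<i})" for i
  proof -
    have "h i = G (cut h {(x, y :: 'l). x < y} i ` {..<i})"
      unfolding h_def by (subst wfrec) (simp_all add: wf)
    also have "cut h {(x, y :: 'l). x < y} i ` {..<i} = h ` {..<i}"
      by (intro image_cong) (auto simp: cut_def)
    finally show ?thesis .
  qed
  have seg: "medium (h ` {..<i})" if "i \<in> \<Lambda>" for i
    by (rule medium_image[OF ordLess_imp_ordLeq[OF \<Lambda>_segment[OF that]]])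
  have hK: "h i \<in> K" if "i \<in> \<Lambda>" for i
    using that
  proof (induction i rule: less_induct)
    case (less i)
    then have "h ` {..<i} \<subseteq> K" using \<Lambda>_down[OF less.prems] by (auto simp: order_less_imp_le)
    from G[OF this seg[OF less.prems]] show ?case by (subst h_rec) (rule conjunct1)
  qed
  have h: "h j < h i" "\<And>\<zeta>. \<zeta> \<le> h j \<Longrightarrow> f \<zeta> < h i" if "i \<in> \<Lambda>" "j < i" for i j
  proof -
    have "h ` {..<i} \<subseteq> K" using hK \<Lambda>_down[OF that(1)] by (auto simp: order_less_imp_le)
    from G[OF this seg[OF that(1)]] that show "h j < h i" "\<And>\<zeta>. \<zeta> \<le> h j \<Longrightarrow> f \<zeta> < h i"
      by (auto simp: h_rec[of i])
  qed
  have h\<gamma>: "\<gamma> < h i" if "i \<in> \<Lambda>" for i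
  proof -
    have "h ` {..<i} \<subseteq> K" using hK \<Lambda>_down[OF that(1)] by (auto simp: order_less_imp_le)
    from G[OF this seg[OF that(1)]] show ?thesis by (simp add: h_rec[of i])
  qed
  obtain k where k: "k \<in> K" "\<forall>x\<in>h ` \<Lambda>. x < k"
    using K_bounded[OF _ medium_image[OF medium_\<Lambda>]] hK by (metis image_subsetI)
  define \<delta> where "\<delta> = (LEAST x. \<forall>i\<in>\<Lambda>. h i < x)"
  have \<delta>: "h i < \<delta>" if "i \<in> \<Lambda>" for i
    unfolding \<delta>_def using LeastI[of "\<lambda>x. \<forall>i\<in>\<Lambda>. h i < x" k] k that by auto
  have \<delta>_least: "\<exists>i\<in>\<Lambda>. \<zeta> \<le> h i" if "\<zeta> < \<delta>" for \<zeta>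
    using not_less_Least[of \<zeta> "\<lambda>x. \<forall>i\<in>\<Lambda>. h i < x"] that unfolding \<delta>_def by (auto simp: not_less)
  have "\<delta> \<le> k" unfolding \<delta>_def using k by (intro Least_le) auto
  then have \<delta>K: "\<delta> \<in> K" using K_down k by blast
  obtain i0 where i0: "i0 \<in> \<Lambda>" using infinite_\<Lambda> by (metis finite.emptyI ex_in_conv)
  have cl: "\<exists>\<eta><\<delta>. \<zeta> < \<eta> \<and> f \<zeta> < \<eta>" if z: "\<zeta> < \<delta>" for \<zeta>
  proof -
    obtain i where i: "i \<in> \<Lambda>" "\<zeta> \<le> h i" using \<delta>_least[OF z] by blast
    obtain i' where "i' \<in> \<Lambda>" "i < i'" using \<Lambda>_above i by blast
    then show ?thesis using h[of i' i] i \<delta>[of i'] by (intro exI[of _ "h i'"]) auto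
  qed
  have "\<delta> \<in> closure_points f" unfolding closure_points_def using \<delta>K \<delta>[OF i0] cl by blast
  moreover have "\<delta> \<in> cof_points" unfolding cof_points_def
  proof (intro CollectI conjI \<delta>K allI impI)
    fix X assume X: "X \<subseteq> {..<\<delta>}" "small X"
    then have "\<forall>x\<in>X. \<exists>i. i \<in> \<Lambda> \<and> x \<le> h i" using \<delta>_least by blast
    then obtain i where i: "\<And>x. x \<in> X \<Longrightarrow> i x \<in> \<Lambda> \<and> x \<le> h (i x)" by metis
    obtain \<nu> where \<nu>: "\<nu> \<in> \<Lambda>" "\<forall>y\<in>i ` X. y < \<nu>"
      using \<Lambda>_bounded[OF _ small_image[OF X(2)], of i] i by blast
    have "x < h \<nu>" if "x \<in> X" for x
      using i[OF that] h(1)[of \<nu> "i x"] \<nu> that by auto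
    then show "\<exists>\<zeta><\<delta>. \<forall>x\<in>X. x < \<zeta>" using \<delta>[OF \<nu>(1)] by blast
  qed
  moreover have "\<gamma> < \<delta>" using h\<gamma>[OF i0] \<delta>[OF i0] by simp
  ultimately show ?thesis by blast
qed

lemma cof_points_stat: "stationary cof_points"
  unfolding stationary_def using closure_points_S0_unbounded K_ex by blast

section \<open>Diagonal intersections and Fodor's lemma\<close>

text \<open>The indices are arbitrary objects: x counts as lying below \<delta> when it belongs to
  \<open>F \<zeta>\<close> for some \<open>\<zeta> < \<delta>\<close>. This admits tuples and finite
  sets of data without coding them as ordinals.\<close>

lemma diagonal:
  assumes F: "\<And>\<zeta>. \<zeta> \<in> K \<Longrightarrow> medium (F \<zeta>)"
    and mono: "\<And>\<zeta> \<zeta>'. \<zeta> \<le> \<zeta>' \<Longrightarrow> F \<zeta> \<subseteq> F \<zeta>'"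
    and h: "\<And>x. h x ` K \<subseteq> K"
  shows "\<exists>f. f ` K \<subseteq> K \<and> (\<forall>\<delta>\<in>closure_points f. \<forall>\<zeta><\<delta>. \<forall>x\<in>F \<zeta>. \<delta> \<in> closure_points (h x))"
proof -
  have "\<exists>k\<in>K. \<forall>x\<in>F \<zeta>. \<forall>\<zeta>'\<le>\<zeta>. h x \<zeta>' < k" if "\<zeta> \<in> K" for \<zeta>
  proof -
    have A: "medium (\<Union>x\<in>F \<zeta>. h x ` {..\<zeta>})" by (intro medium_UN F medium_image medium_atMost that)
    have "h x ` {..\<zeta>} \<subseteq> K" for x
      by (rule order_trans[OF image_mono h]) (use K_down[OF that] in auto)
    then have B: "(\<Union>x\<in>F \<zeta>. h x ` {..\<zeta>}) \<subseteq> K" by (simp add: UN_subset_iff)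
    obtain k where "k \<in> K" "\<forall>x\<in>(\<Union>x\<in>F \<zeta>. h x ` {..\<zeta>}). x < k"
      using K_bounded[OF B A] by (elim bexE)
    then show ?thesis by (intro bexI[of _ k]) auto
  qed
  then obtain f where f: "\<And>\<zeta>. \<zeta> \<in> K \<Longrightarrow> f \<zeta> \<in> K \<and> (\<forall>x\<in>F \<zeta>. \<forall>\<zeta>'\<le>\<zeta>. h x \<zeta>' < f \<zeta>)" by metis
  have "\<delta> \<in> closure_points (h x)" if \<delta>: "\<delta> \<in> closure_points f" "\<zeta> < \<delta>" "x \<in> F \<zeta>" for \<delta> \<zeta> x
  proof (rule closure_pointsI[OF closure_points_K[OF \<delta>(1)] \<delta>(2) closure_points_limit[OF \<delta>(1)]])
    fix \<zeta>' assume z: "\<zeta>' < \<delta>"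
    \<comment> \<open>At the single stage m, monotonicity of F makes x available, and \<zeta>' is
      among the arguments dominated by \<open>f m\<close>.\<close>
    define m where "m = max \<zeta> \<zeta>'"
    have m: "m < \<delta>" "\<zeta> \<le> m" "\<zeta>' \<le> m" using z \<delta> by (auto simp: m_def)
    have "m \<in> K" using m closure_points_K[OF \<delta>(1)] K_down[of \<delta> m] by simp
    moreover have "x \<in> F m" using mono[OF m(2)] \<delta>(3) by blast
    ultimately have "h x \<zeta>' < f m" using f m(3) by blast
    then show "h x \<zeta>' < \<delta>" using closure_points_closed[OF \<delta>(1) m(1)] by simp
  qed
  moreover have "f ` K \<subseteq> K" using f by (intro image_subsetI) simp
  ultimately show ?thesis by (intro exI[of _ f]) simp
qed

lemma closure_points_family:
  assumes "medium I" "\<And>x. h x ` K \<subseteq> K"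
  shows "\<exists>f. f ` K \<subseteq> K \<and> (\<forall>\<delta>\<in>closure_points f. \<forall>x\<in>I. \<delta> \<in> closure_points (h x))"
proof -
  obtain f where f: "f ` K \<subseteq> K" "\<forall>\<delta>\<in>closure_points f. \<forall>\<zeta><\<delta>. \<forall>x\<in>I. \<delta> \<in> closure_points (h x)"
    using diagonal[of "\<lambda>_. I" h, OF assms(1) order_refl assms(2)] by (elim exE conjE)
  have "\<delta> \<in> closure_points (h x)" if "\<delta> \<in> closure_points f" "x \<in> I" for \<delta> x
    using f(2) closure_points_nonempty[OF that(1)] that by blast
  with f(1) show ?thesis by (intro exI[of _ f]) simp
qed

lemma closure_points_Int:
  assumes "f ` K \<subseteq> K" "g ` K \<subseteq> K"
  shows "\<exists>h. h ` K \<subseteq> K \<and> closure_points h \<subseteq> closure_points f \<inter> closure_points g"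
proof -
  have "(if b then f else g) ` K \<subseteq> K" for b using assms by simp
  from closure_points_family[OF medium_finite[of "UNIV :: bool set"], of "\<lambda>b. if b then f else g", OF _ this]
  obtain h where h: "h ` K \<subseteq> K" "\<forall>\<delta>\<in>closure_points h. \<forall>b. \<delta> \<in> closure_points (if b then f else g)" by auto
  have "\<delta> \<in> closure_points f \<inter> closure_points g" if "\<delta> \<in> closure_points h" for \<delta>
    using h(2)[rule_format, OF that, of True] h(2)[rule_format, OF that, of False] by simp
  then show ?thesis using h(1) by (intro exI[of _ h]) auto
qed

lemma stationary_Int_closure_points:
  assumes "stationary S" "f ` K \<subseteq> K"
  shows "stationary (S \<inter> closure_points f)"
  unfolding stationary_def
proof (intro allI impI)
  fix g :: "'k \<Rightarrow> 'k" assume "g ` K \<subseteq> K"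
  from closure_points_Int[OF assms(2) this] obtain h where h: "h ` K \<subseteq> K" "closure_points h \<subseteq> closure_points f \<inter> closure_points g" by blast
  with assms(1) obtain \<delta> where "\<delta> \<in> S" "\<delta> \<in> closure_points h" unfolding stationary_def by blast
  then show "\<exists>\<delta>\<in>S \<inter> closure_points f. \<delta> \<in> closure_points g" using h by blast
qed

lemma stationary_mono: "stationary S \<Longrightarrow> S \<subseteq> T \<Longrightarrow> stationary T"
  unfolding stationary_def by blast

lemma stationary_above:
  assumes "stationary S" "\<gamma> \<in> K"
  shows "\<exists>\<delta>\<in>S. \<delta> \<in> K \<and> \<gamma> < \<delta>"
proof -
  obtain k where k: "k \<in> K" "\<gamma> < k" using K_above assms(2) by blast
  then have "(\<lambda>_. k) ` K \<subseteq> K" by auto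
  then obtain \<delta> where \<delta>: "\<delta> \<in> S" "\<delta> \<in> closure_points (\<lambda>_. k)" using assms(1) unfolding stationary_def by blast
  then show ?thesis using closure_points_nonempty[OF \<delta>(2)] closure_points_closed[OF \<delta>(2)] closure_points_K[OF \<delta>(2)] k by fastforce
qed

lemma stationary_tail: "stationary S \<Longrightarrow> \<gamma> \<in> K \<Longrightarrow> stationary {\<delta>\<in>S. \<gamma> < \<delta>}"
proof -
  assume S: "stationary S" and \<gamma>: "\<gamma> \<in> K"
  obtain k where k: "k \<in> K" "\<gamma> < k" using K_above \<gamma> by blast
  then have "(\<lambda>_. k) ` K \<subseteq> K" by auto
  from stationary_Int_closure_points[OF S this] show ?thesis
  proof (rule stationary_mono, intro subsetI)
    fix \<delta> assume "\<delta> \<in> S \<inter> closure_points (\<lambda>_. k)"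
    then show "\<delta> \<in> {\<delta>\<in>S. \<gamma> < \<delta>}" using closure_points_nonempty closure_points_closed[of \<delta> "\<lambda>_. k"] k by fastforce
  qed
qed

text \<open>Closing under the choice of a next element of S does it. Applied twice, this gives three
  points of one stationary set, each as close to the next as desired.\<close>

lemma stationary_limits:
  assumes "stationary S"
  shows "stationary {\<delta>\<in>S. \<delta> \<in> K \<and> (\<forall>\<gamma><\<delta>. \<exists>\<delta>'\<in>S. \<gamma> < \<delta>' \<and> \<delta>' < \<delta>)}"
proof -
  obtain f where f: "\<And>\<gamma>. \<gamma> \<in> K \<Longrightarrow> f \<gamma> \<in> S \<and> f \<gamma> \<in> K \<and> \<gamma> < f \<gamma>"
    using stationary_above[OF assms] by metis
  then have "f ` K \<subseteq> K" by blast
  from stationary_Int_closure_points[OF assms this] show ?thesis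
  proof (rule stationary_mono, intro subsetI)
    fix \<delta> assume \<delta>: "\<delta> \<in> S \<inter> closure_points f"
    have "\<exists>\<delta>'\<in>S. \<gamma> < \<delta>' \<and> \<delta>' < \<delta>" if "\<gamma> < \<delta>" for \<gamma>
      using f[of \<gamma>] closure_points_closed[of \<delta> f \<gamma>] \<delta> that closure_points_K[of \<delta> f] K_down[of \<delta> \<gamma>] by auto
    then show "\<delta> \<in> {\<delta>\<in>S. \<delta> \<in> K \<and> (\<forall>\<gamma><\<delta>. \<exists>\<delta>'\<in>S. \<gamma> < \<delta>' \<and> \<delta>' < \<delta>)}"
      using \<delta> closure_points_K by blast
  qed
qed

lemma not_stationaryD: "\<not> stationary X \<Longrightarrow> \<exists>f. f ` K \<subseteq> K \<and> (\<forall>\<delta>\<in>X. \<delta> \<notin> closure_points f)"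
  by (auto simp: stationary_def)

text \<open>If every x failed, each would come with a club avoiding the \<delta> that satisfy
  \<open>P \<delta> x\<close>; but S meets the diagonal intersection of these clubs, at a point
  having some such x below it.\<close>

lemma fodor:
  assumes "stationary S"
    and F: "\<And>\<zeta>. \<zeta> \<in> K \<Longrightarrow> medium (F \<zeta>)"
    and mono: "\<And>\<zeta> \<zeta>'. \<zeta> \<le> \<zeta>' \<Longrightarrow> F \<zeta> \<subseteq> F \<zeta>'"
    and P: "\<And>\<delta>. \<delta> \<in> S \<Longrightarrow> \<delta> \<in> K \<Longrightarrow> \<exists>\<zeta><\<delta>. \<exists>x\<in>F \<zeta>. P \<delta> x"
  shows "\<exists>x. stationary {\<delta>\<in>S. P \<delta> x}"
proof (rule ccontr)
  assume "\<not> ?thesis"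
  then have "\<exists>f. f ` K \<subseteq> K \<and> (\<forall>\<delta>\<in>{\<delta>\<in>S. P \<delta> x}. \<delta> \<notin> closure_points f)" for x
    using not_stationaryD[of "{\<delta>\<in>S. P \<delta> x}"] by simp
  then have "\<forall>x. \<exists>f. f ` K \<subseteq> K \<and> (\<forall>\<delta>\<in>{\<delta>\<in>S. P \<delta> x}. \<delta> \<notin> closure_points f)" by (rule allI)
  then obtain h where "\<forall>x. h x ` K \<subseteq> K \<and> (\<forall>\<delta>\<in>{\<delta>\<in>S. P \<delta> x}. \<delta> \<notin> closure_points (h x))"
    unfolding choice_iff by (elim exE)
  then have h: "\<And>x. h x ` K \<subseteq> K" "\<And>x \<delta>. \<delta> \<in> S \<Longrightarrow> P \<delta> x \<Longrightarrow> \<delta> \<notin> closure_points (h x)" by auto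
  have "\<exists>f. f ` K \<subseteq> K \<and> (\<forall>\<delta>\<in>closure_points f. \<forall>\<zeta><\<delta>. \<forall>x\<in>F \<zeta>. \<delta> \<in> closure_points (h x))"
    by (rule diagonal) (erule F | erule mono | rule h(1))+
  then obtain f where f: "f ` K \<subseteq> K" "\<forall>\<delta>\<in>closure_points f. \<forall>\<zeta><\<delta>. \<forall>x\<in>F \<zeta>. \<delta> \<in> closure_points (h x)" by (elim exE conjE)
  obtain \<delta> where \<delta>: "\<delta> \<in> S" "\<delta> \<in> closure_points f" using stationaryD[OF assms(1) f(1)] by (elim bexE)
  obtain \<zeta> x where x: "\<zeta> < \<delta>" "x \<in> F \<zeta>" "P \<delta> x" using P[OF \<delta>(1) closure_points_K[OF \<delta>(2)]] by (elim exE bexE conjE)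
  show False using h(2)[OF \<delta>(1) x(3)] f(2) \<delta>(2) x(1,2) by simp
qed

lemma K_Times: "|K \<times> K| \<le>o |K|"
proof -
  have "infinite K" using not_medium_K medium_finite by blast
  then show ?thesis using card_of_Times_same_infinite ordIso_imp_ordLeq by blast
qed

text \<open>An Ulam matrix argument; the colour of \<open>\<delta>\<close> is read off from the preimage of a fixed value under
  \<^term>\<open>enum \<delta>\<close>.\<close>

lemma ulam: "\<exists>col. (\<forall>\<delta>. col \<delta> \<in> K \<times> K) \<and> (\<forall>z\<in>K \<times> K. stationary {\<delta>\<in>cof_points. col \<delta> = z})"
proof -
  have "\<exists>i. i \<in> \<Lambda> \<and> stationary {\<delta>\<in>cof_points. \<xi> < \<delta> \<and> enum \<delta> \<xi> = i}" if "\<xi> \<in> K" for \<xi>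
  proof -
    have "\<exists>i. stationary {\<delta>\<in>{\<delta>\<in>cof_points. \<xi> < \<delta>}. i \<in> \<Lambda> \<and> enum \<delta> \<xi> = i}"
      by (rule fodor[OF stationary_tail[OF cof_points_stat that], of "\<lambda>_. \<Lambda>"])
         (auto simp: medium_\<Lambda> intro: enum_in)
    then obtain i where i: "stationary {\<delta>\<in>{\<delta>\<in>cof_points. \<xi> < \<delta>}. i \<in> \<Lambda> \<and> enum \<delta> \<xi> = i}" by blast
    then have "i \<in> \<Lambda>" using stationary_above[OF i that] by auto
    then show ?thesis using i by (intro exI[of _ i]) (auto elim: stationary_mono)
  qed
  then obtain i where i: "\<And>\<xi>. \<xi> \<in> K \<Longrightarrow> i \<xi> \<in> \<Lambda> \<and> stationary {\<delta>\<in>cof_points. \<xi> < \<delta> \<and> enum \<delta> \<xi> = i \<xi>}" by metis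
  \<comment> \<open>K is not a union of \<lambda> many sets of size at most \<lambda>, so one value
    j serves for more than \<lambda> many \<xi>. Different \<xi> then give disjoint stationary sets,
    because \<open>enum \<delta>\<close> is injective.\<close>
  have "\<exists>j\<in>\<Lambda>. \<not> medium {\<xi>\<in>K. i \<xi> = j}"
  proof (rule ccontr)
    assume "\<not> ?thesis"
    then have "medium (\<Union>j\<in>\<Lambda>. {\<xi>\<in>K. i \<xi> = j})" by (intro medium_UN medium_\<Lambda>) blast
    moreover have "(\<Union>j\<in>\<Lambda>. {\<xi>\<in>K. i \<xi> = j}) = K" using i by blast
    ultimately show False using not_medium_K by simp
  qed
  then obtain j where j: "\<not> medium {\<xi>\<in>K. i \<xi> = j}" by blast
  define X where "X = {\<xi>\<in>K. i \<xi> = j}"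
  have "|K \<times> K| \<le>o |X|"
    by (rule ordLeq_transitive[OF K_Times K_least]) (use j in \<open>auto simp: X_def\<close>)
  then obtain p where p: "p ` X = K \<times> K" using card_of_ordLeq2[of "K \<times> K" X] K_ex by blast
  obtain k where k: "k \<in> K" using K_ex by blast
  define col where "col \<delta> = (if \<exists>\<xi>\<in>X. \<xi> < \<delta> \<and> enum \<delta> \<xi> = j
    then p (SOME \<xi>. \<xi> \<in> X \<and> \<xi> < \<delta> \<and> enum \<delta> \<xi> = j) else (k, k))" for \<delta>
  have "col \<delta> \<in> K \<times> K" for \<delta>
  proof (cases "\<exists>\<xi>\<in>X. \<xi> < \<delta> \<and> enum \<delta> \<xi> = j")
    case True
    then have "(SOME \<xi>. \<xi> \<in> X \<and> \<xi> < \<delta> \<and> enum \<delta> \<xi> = j) \<in> X"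
      using someI_ex[of "\<lambda>\<xi>. \<xi> \<in> X \<and> \<xi> < \<delta> \<and> enum \<delta> \<xi> = j"] by blast
    then have "p (SOME \<xi>. \<xi> \<in> X \<and> \<xi> < \<delta> \<and> enum \<delta> \<xi> = j) \<in> K \<times> K" unfolding p[symmetric] by (rule imageI)
    then show ?thesis using True unfolding col_def by (simp only: if_True)
  next
    case False
    then show ?thesis using k unfolding col_def by (simp only: if_False mem_Times_iff fst_conv snd_conv)
  qed
  moreover have "stationary {\<delta>\<in>cof_points. col \<delta> = z}" if z: "z \<in> K \<times> K" for z
  proof -
    obtain \<xi> where \<xi>: "\<xi> \<in> X" "p \<xi> = z" using z unfolding p[symmetric] by blast
    then have "stationary {\<delta>\<in>cof_points. \<xi> < \<delta> \<and> enum \<delta> \<xi> = j}" using i[of \<xi>] by (simp add: X_def)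
    then show ?thesis
    proof (rule stationary_mono, safe)
      fix \<delta> assume \<delta>: "\<delta> \<in> cof_points" "\<xi> < \<delta>" "j = enum \<delta> \<xi>"
      then have "inj_on (enum \<delta>) {..<\<delta>}" by (intro enum) (simp add: cof_points_def)
      then have "(SOME \<xi>'. \<xi>' \<in> X \<and> \<xi>' < \<delta> \<and> enum \<delta> \<xi>' = j) = \<xi>"
        using \<xi> \<delta> by (intro some_equality) (auto simp: inj_on_def)
      moreover have "\<exists>\<xi>\<in>X. \<xi> < \<delta> \<and> enum \<delta> \<xi> = j" using \<xi> \<delta> by blast
      ultimately show "col \<delta> = z" unfolding col_def using \<xi>(2) by (simp only: if_True)
    qed
  qed
  ultimately show ?thesis by (intro exI[of _ col]) blast
qed

lemma cof_points_K: "\<delta> \<in> cof_points \<Longrightarrow> \<delta> \<in> K"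
  by (simp add: cof_points_def)

lemma cof_points_small: "\<delta> \<in> cof_points \<Longrightarrow> X \<subseteq> {..<\<delta>} \<Longrightarrow> small X \<Longrightarrow> \<exists>\<zeta><\<delta>. \<forall>x\<in>X. x < \<zeta>"
  by (simp add: cof_points_def)

lemma cof_points_finite: "\<delta> \<in> cof_points \<Longrightarrow> finite X \<Longrightarrow> X \<subseteq> {..<\<delta>} \<Longrightarrow> \<exists>\<zeta><\<delta>. \<forall>x\<in>X. x < \<zeta>"
  by (rule cof_points_small[OF _ _ small_finite])

lemma cof_points_limit: "\<delta> \<in> cof_points \<Longrightarrow> \<zeta> < \<delta> \<Longrightarrow> \<exists>\<eta><\<delta>. \<zeta> < \<eta>"
  using cof_points_finite[of \<delta> "{\<zeta>}"] by auto

subsection \<open>Walks\<close>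

definition next_step :: "'k \<Rightarrow> 'k \<Rightarrow> 'k" where
  "next_step \<alpha> \<beta> = (LEAST \<eta>. \<eta> \<in> ladder \<beta> \<and> \<alpha> \<le> \<eta>)"

text \<open>Taking the strict supremum of \<open>ladder \<beta> \<inter> \<alpha>\<close> instead of its maximum makes closedness of ladders
  unnecessary.\<close>

definition lower :: "'k \<Rightarrow> 'k \<Rightarrow> 'k" where
  "lower \<alpha> \<beta> = (LEAST \<xi>. \<forall>\<eta>\<in>ladder \<beta>. \<eta> < \<alpha> \<longrightarrow> \<eta> < \<xi>)"

lemma next_step:
  assumes "\<beta> \<in> K" "\<alpha> < \<beta>"
  shows "next_step \<alpha> \<beta> \<in> ladder \<beta>" "\<alpha> \<le> next_step \<alpha> \<beta>" "next_step \<alpha> \<beta> < \<beta>" "next_step \<alpha> \<beta> \<in> K"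
proof -
  obtain \<eta> where "\<eta> \<in> ladder \<beta> \<and> \<alpha> \<le> \<eta>" using ladder_cofinal[OF assms] by blast
  then have "next_step \<alpha> \<beta> \<in> ladder \<beta> \<and> \<alpha> \<le> next_step \<alpha> \<beta>" unfolding next_step_def by (rule LeastI)
  then show "next_step \<alpha> \<beta> \<in> ladder \<beta>" "\<alpha> \<le> next_step \<alpha> \<beta>" "next_step \<alpha> \<beta> < \<beta>" "next_step \<alpha> \<beta> \<in> K"
    using ladder_less[of "next_step \<alpha> \<beta>" \<beta>] K_down[OF assms(1), of "next_step \<alpha> \<beta>"] by auto
qed

lemma lower_le: "lower \<alpha> \<beta> \<le> \<alpha>"
  unfolding lower_def by (rule Least_le) simp

lemma lower_greater: "\<eta> \<in> ladder \<beta> \<Longrightarrow> \<eta> < \<alpha> \<Longrightarrow> \<eta> < lower \<alpha> \<beta>"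
  unfolding lower_def using LeastI[of "\<lambda>\<xi>. \<forall>\<eta>\<in>ladder \<beta>. \<eta> < \<alpha> \<longrightarrow> \<eta> < \<xi>" \<alpha>] by blast

function walk :: "'k \<Rightarrow> 'k \<Rightarrow> 'k list" where
  "walk \<alpha> \<beta> = (if \<alpha> < \<beta> \<and> \<beta> \<in> K then \<beta> # walk \<alpha> (next_step \<alpha> \<beta>) else [])"
  by pat_completeness auto
termination
  by (relation "inv_image {(x, y). x < y} snd") (auto simp: wf next_step)

declare walk.simps [simp del]

lemma walk_step: "\<beta> \<in> K \<Longrightarrow> \<alpha> < \<beta> \<Longrightarrow> walk \<alpha> \<beta> = \<beta> # walk \<alpha> (next_step \<alpha> \<beta>)"
  by (simp add: walk.simps)

lemma walk_refl: "walk \<alpha> \<alpha> = []"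
  by (simp add: walk.simps)

text \<open>Each ladder met on the walk from \<beta> to \<delta> has a small part below \<delta>,
  hence one bounded below \<delta>. To these ladders an \<alpha> past the finitely many bounds looks
  like \<delta>, so the walk towards \<alpha> passes through \<delta>.\<close>

lemma walk_split:
  "\<beta> \<in> K \<Longrightarrow> \<delta> \<in> cof_points \<Longrightarrow> \<delta> < \<beta> \<Longrightarrow>
    \<exists>\<gamma><\<delta>. \<forall>\<alpha>. \<gamma> \<le> \<alpha> \<longrightarrow> \<alpha> < \<delta> \<longrightarrow> walk \<alpha> \<beta> = walk \<delta> \<beta> @ walk \<alpha> \<delta> \<and>
      (\<forall>b\<in>set (walk \<delta> \<beta>). lower \<alpha> b = lower \<delta> b \<and> lower \<delta> b \<le> \<gamma>)"
proof (induction \<beta> rule: less_induct)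
  case (less \<beta>)
  obtain \<gamma>0 where \<gamma>0: "\<gamma>0 < \<delta>" "\<forall>x\<in>{\<eta> \<in> ladder \<beta>. \<eta> < \<delta>}. x < \<gamma>0"
    using cof_points_small[OF less.prems(2) _ ladder_small[OF less.prems(1,3)]] by (metis (no_types, lifting) lessThan_iff mem_Collect_eq subsetI)
  have eq: "\<eta> < \<alpha> \<longleftrightarrow> \<eta> < \<delta>" if "\<eta> \<in> ladder \<beta>" "\<gamma>0 \<le> \<alpha>" "\<alpha> < \<delta>" for \<eta> \<alpha>
    using \<gamma>0(2) that by (auto dest: order_less_trans order_less_le_trans)
  have next_step_eq: "next_step \<alpha> \<beta> = next_step \<delta> \<beta>" if "\<gamma>0 \<le> \<alpha>" "\<alpha> < \<delta>" for \<alpha>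
  proof -
    have "(\<eta> \<in> ladder \<beta> \<and> \<alpha> \<le> \<eta>) = (\<eta> \<in> ladder \<beta> \<and> \<delta> \<le> \<eta>)" for \<eta>
      using eq[OF _ that, of \<eta>] by (auto simp: not_less[symmetric])
    then show ?thesis unfolding next_step_def by simp
  qed
  have lower_eq: "lower \<alpha> \<beta> = lower \<delta> \<beta>" if "\<gamma>0 \<le> \<alpha>" "\<alpha> < \<delta>" for \<alpha>
  proof -
    have "(\<forall>\<eta>\<in>ladder \<beta>. \<eta> < \<alpha> \<longrightarrow> \<eta> < \<xi>) = (\<forall>\<eta>\<in>ladder \<beta>. \<eta> < \<delta> \<longrightarrow> \<eta> < \<xi>)" for \<xi>
      using eq[OF _ that] by blast
    then show ?thesis unfolding lower_def by simp
  qed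
  have lb0: "lower \<delta> \<beta> \<le> \<gamma>0" unfolding lower_def by (rule Least_le) (use \<gamma>0 in auto)
  note n = next_step[OF less.prems(1,3)]
  have walk\<delta>: "walk \<delta> \<beta> = \<beta> # walk \<delta> (next_step \<delta> \<beta>)" using less.prems by (simp add: walk_step)
  have walk\<alpha>: "walk \<alpha> \<beta> = \<beta> # walk \<alpha> (next_step \<delta> \<beta>)" if "\<gamma>0 \<le> \<alpha>" "\<alpha> < \<delta>" for \<alpha>
    using walk_step[OF less.prems(1), of \<alpha>] less.prems(3) that next_step_eq[OF that] by simp
  show ?case
  proof (cases "next_step \<delta> \<beta> = \<delta>")
    case True
    show ?thesis
    proof (intro exI[of _ \<gamma>0] conjI \<gamma>0(1) allI impI)
      fix \<alpha> assume \<alpha>: "\<gamma>0 \<le> \<alpha>" "\<alpha> < \<delta>"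
      show "walk \<alpha> \<beta> = walk \<delta> \<beta> @ walk \<alpha> \<delta>" by (simp add: walk\<delta> walk\<alpha>[OF \<alpha>] True walk_refl)
      show "\<forall>b\<in>set (walk \<delta> \<beta>). lower \<alpha> b = lower \<delta> b \<and> lower \<delta> b \<le> \<gamma>0"
        by (simp add: walk\<delta> True walk_refl lower_eq[OF \<alpha>] lb0)
    qed
  next
    case False
    then have "\<delta> < next_step \<delta> \<beta>" using n(2) by simp
    from less.IH[OF n(3,4) less.prems(2) this] obtain \<gamma>1 where \<gamma>1: "\<gamma>1 < \<delta>"
      "\<forall>\<alpha>. \<gamma>1 \<le> \<alpha> \<longrightarrow> \<alpha> < \<delta> \<longrightarrow> walk \<alpha> (next_step \<delta> \<beta>) = walk \<delta> (next_step \<delta> \<beta>) @ walk \<alpha> \<delta> \<and>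
      (\<forall>b\<in>set (walk \<delta> (next_step \<delta> \<beta>)). lower \<alpha> b = lower \<delta> b \<and> lower \<delta> b \<le> \<gamma>1)" by (elim exE conjE)
    show ?thesis
    proof (intro exI[of _ "max \<gamma>0 \<gamma>1"] conjI allI impI)
      show "max \<gamma>0 \<gamma>1 < \<delta>" using \<gamma>0 \<gamma>1 by simp
      fix \<alpha> assume a: "max \<gamma>0 \<gamma>1 \<le> \<alpha>" "\<alpha> < \<delta>"
      then have a0: "\<gamma>0 \<le> \<alpha>" and a1: "\<gamma>1 \<le> \<alpha>" by auto
      note IH = \<gamma>1(2)[rule_format, OF a1 a(2)]
      show "walk \<alpha> \<beta> = walk \<delta> \<beta> @ walk \<alpha> \<delta>" using IH by (simp add: walk\<delta> walk\<alpha>[OF a0 a(2)])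
      show "\<forall>b\<in>set (walk \<delta> \<beta>). lower \<alpha> b = lower \<delta> b \<and> lower \<delta> b \<le> max \<gamma>0 \<gamma>1"
        using IH lb0 by (simp add: walk\<delta> lower_eq[OF a0 a(2)] le_max_iff_disj)
    qed
  qed
qed

section \<open>Traces: walk points paired with their lower trace\<close>

text \<open>Pairing with a running maximum instead of \<open>lower\<close> itself makes the second
  components nondecreasing, so a lower bound at the first step holds along the whole trace.\<close>

fun running_max :: "'k \<Rightarrow> 'k \<Rightarrow> 'k list \<Rightarrow> ('k \<times> 'k) list" where
  "running_max \<alpha> \<mu> [] = []"
| "running_max \<alpha> \<mu> (b # bs) = (b, max \<mu> (lower \<alpha> b)) # running_max \<alpha> (max \<mu> (lower \<alpha> b)) bs"

definition final_max :: "'k \<Rightarrow> 'k \<Rightarrow> 'k list \<Rightarrow> 'k" where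
  "final_max \<alpha> \<mu> bs = foldl (\<lambda>m b. max m (lower \<alpha> b)) \<mu> bs"

definition least_point :: 'k where
  "least_point = (LEAST x. True)"

definition trace :: "'k \<Rightarrow> 'k \<Rightarrow> ('k \<times> 'k) list" where
  "trace \<alpha> \<beta> = running_max \<alpha> least_point (walk \<alpha> \<beta>)"

lemma least_point_le: "least_point \<le> x"
  unfolding least_point_def by (rule Least_le) simp

lemma running_max_append: "running_max \<alpha> \<mu> (xs @ ys) = running_max \<alpha> \<mu> xs @ running_max \<alpha> (final_max \<alpha> \<mu> xs) ys"
  by (induction xs arbitrary: \<mu>) (simp_all add: final_max_def)

lemma running_max_cong: "(\<And>b. b \<in> set xs \<Longrightarrow> lower \<alpha> b = lower \<delta> b) \<Longrightarrow> running_max \<alpha> \<mu> xs = running_max \<delta> \<mu> xs"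
  by (induction xs arbitrary: \<mu>) simp_all

lemma final_max_le: "(\<And>b. b \<in> set xs \<Longrightarrow> lower \<alpha> b \<le> \<gamma>) \<Longrightarrow> \<mu> \<le> \<gamma> \<Longrightarrow> final_max \<alpha> \<mu> xs \<le> \<gamma>"
  by (induction xs arbitrary: \<mu>) (simp_all add: final_max_def)

lemma running_max_le: "(\<And>b. b \<in> set xs \<Longrightarrow> lower \<alpha> b \<le> \<gamma>) \<Longrightarrow> \<mu> \<le> \<gamma> \<Longrightarrow> bm \<in> set (running_max \<alpha> \<mu> xs) \<Longrightarrow> snd bm \<le> \<gamma>"
proof (induction xs arbitrary: \<mu>)
  case (Cons b xs)
  then have "max \<mu> (lower \<alpha> b) \<le> \<gamma>" by simp
  then show ?case using Cons.IH[of "max \<mu> (lower \<alpha> b)"] Cons.prems by auto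
qed simp

lemma running_max_ge: "bm \<in> set (running_max \<alpha> \<mu> xs) \<Longrightarrow> \<mu> \<le> snd bm"
proof (induction xs arbitrary: \<mu>)
  case (Cons b xs)
  then show ?case using Cons.IH[of "max \<mu> (lower \<alpha> b)"] by auto
qed simp

lemma trace_Cons:
  assumes "\<beta> \<in> K" "\<alpha> < \<beta>"
  shows "trace \<alpha> \<beta> = (\<beta>, lower \<alpha> \<beta>) # running_max \<alpha> (lower \<alpha> \<beta>) (walk \<alpha> (next_step \<alpha> \<beta>))"
  by (simp add: trace_def walk_step[OF assms] max_absorb2[OF least_point_le])

text \<open>An accumulated maximum is forgotten once the next value of \<open>lower\<close> reaches
  it; from there on the trace is that of a fresh walk.\<close>

lemma running_max_walk:
  assumes "\<beta> \<in> K" "\<alpha> < \<beta>" "\<mu> \<le> lower \<alpha> \<beta>"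
  shows "running_max \<alpha> \<mu> (walk \<alpha> \<beta>) = trace \<alpha> \<beta>"
  by (simp add: trace_Cons[OF assms(1,2)] walk_step[OF assms(1,2)] max_absorb2[OF assms(3)])

lemma trace_ge: "\<beta> \<in> K \<Longrightarrow> \<alpha> < \<beta> \<Longrightarrow> bm \<in> set (trace \<alpha> \<beta>) \<Longrightarrow> lower \<alpha> \<beta> \<le> snd bm"
  using running_max_ge[of bm \<alpha> "lower \<alpha> \<beta>"] by (auto simp: trace_Cons)

lemma trace_le: "bm \<in> set (trace \<alpha> \<beta>) \<Longrightarrow> snd bm \<le> \<alpha>"
  unfolding trace_def by (rule running_max_le[OF lower_le least_point_le])

lemma lower_high:
  assumes "\<delta> \<in> cof_points" "\<gamma> < \<delta>"
  shows "\<exists>\<gamma>'<\<delta>. \<forall>\<alpha>. \<gamma>' \<le> \<alpha> \<longrightarrow> \<alpha> < \<delta> \<longrightarrow> \<gamma> \<le> lower \<alpha> \<delta>"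
proof -
  obtain \<eta> where \<eta>: "\<eta> \<in> ladder \<delta>" "\<gamma> \<le> \<eta>" using ladder_cofinal[OF cof_points_K[OF assms(1)] assms(2)] by blast
  obtain \<gamma>' where \<gamma>': "\<gamma>' < \<delta>" "\<eta> < \<gamma>'" using cof_points_limit[OF assms(1) ladder_less[OF \<eta>(1)]] by blast
  have "\<gamma> \<le> lower \<alpha> \<delta>" if "\<gamma>' \<le> \<alpha>" "\<alpha> < \<delta>" for \<alpha>
    using lower_greater[OF \<eta>(1) order_less_le_trans[OF \<gamma>'(2) that(1)]] \<eta>(2) by simp
  then show ?thesis using \<gamma>'(1) by blast
qed

lemma trace_high:
  assumes "\<delta> \<in> cof_points" "\<gamma> < \<delta>"
  shows "\<exists>\<gamma>'<\<delta>. \<forall>\<alpha>. \<gamma>' \<le> \<alpha> \<longrightarrow> \<alpha> < \<delta> \<longrightarrow> (\<forall>bm\<in>set (trace \<alpha> \<delta>). \<gamma> \<le> snd bm)"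
proof -
  obtain \<gamma>' where \<gamma>': "\<gamma>' < \<delta>" "\<forall>\<alpha>. \<gamma>' \<le> \<alpha> \<longrightarrow> \<alpha> < \<delta> \<longrightarrow> \<gamma> \<le> lower \<alpha> \<delta>"
    using lower_high[OF assms] by blast
  have "\<gamma> \<le> snd bm" if "\<gamma>' \<le> \<alpha>" "\<alpha> < \<delta>" "bm \<in> set (trace \<alpha> \<delta>)" for \<alpha> bm
    using trace_ge[OF cof_points_K[OF assms(1)] that(2,3)] \<gamma>'(2) that by (meson order_trans)
  then show ?thesis using \<gamma>'(1) by blast
qed

text \<open>Besides splitting the walk, \<alpha> must be high enough for
  \<open>lower \<alpha> \<delta>\<close> to overtake the maximum collected above \<delta>; \<gamma>2
  ensures this.\<close>

lemma trace_split:
  assumes "\<beta> \<in> K" "\<delta> \<in> cof_points" "\<delta> < \<beta>"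
  shows "\<exists>\<gamma><\<delta>. \<forall>\<alpha>. \<gamma> \<le> \<alpha> \<longrightarrow> \<alpha> < \<delta> \<longrightarrow> trace \<alpha> \<beta> = trace \<delta> \<beta> @ trace \<alpha> \<delta>"
proof -
  obtain \<gamma>1 where \<gamma>1: "\<gamma>1 < \<delta>" "\<forall>\<alpha>. \<gamma>1 \<le> \<alpha> \<longrightarrow> \<alpha> < \<delta> \<longrightarrow> walk \<alpha> \<beta> = walk \<delta> \<beta> @ walk \<alpha> \<delta> \<and>
      (\<forall>b\<in>set (walk \<delta> \<beta>). lower \<alpha> b = lower \<delta> b \<and> lower \<delta> b \<le> \<gamma>1)"
    using walk_split[OF assms] by (elim exE conjE)
  obtain \<gamma>2 where \<gamma>2: "\<gamma>2 < \<delta>" "\<forall>\<alpha>. \<gamma>2 \<le> \<alpha> \<longrightarrow> \<alpha> < \<delta> \<longrightarrow> \<gamma>1 \<le> lower \<alpha> \<delta>"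
    using lower_high[OF assms(2) \<gamma>1(1)] by blast
  have "trace \<alpha> \<beta> = trace \<delta> \<beta> @ trace \<alpha> \<delta>" if a: "max \<gamma>1 \<gamma>2 \<le> \<alpha>" "\<alpha> < \<delta>" for \<alpha>
  proof -
    have a1: "\<gamma>1 \<le> \<alpha>" and a2: "\<gamma>2 \<le> \<alpha>" using a by auto
    note w = \<gamma>1(2)[rule_format, OF a1 a(2)]
    have "final_max \<alpha> least_point (walk \<delta> \<beta>) \<le> \<gamma>1" by (rule final_max_le[OF _ least_point_le]) (use w in simp)
    then have "final_max \<alpha> least_point (walk \<delta> \<beta>) \<le> lower \<alpha> \<delta>" using \<gamma>2(2) a2 a(2) by (meson order_trans)
    from running_max_walk[OF cof_points_K[OF assms(2)] a(2) this]
    have "trace \<alpha> \<beta> = running_max \<alpha> least_point (walk \<delta> \<beta>) @ trace \<alpha> \<delta>" using w by (simp add: trace_def running_max_append)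
    also have "running_max \<alpha> least_point (walk \<delta> \<beta>) = trace \<delta> \<beta>" unfolding trace_def by (rule running_max_cong) (use w in simp)
    finally show ?thesis .
  qed
  then show ?thesis using \<gamma>1(1) \<gamma>2(1) by (intro exI[of _ "max \<gamma>1 \<gamma>2"]) simp
qed

text \<open>In general only \<le> holds. The strict inequality comes from cofinality \<lambda> and
  allows the trace to be recorded in data lying below \<delta>.\<close>

lemma trace_low:
  assumes "\<beta> \<in> K" "\<delta> \<in> cof_points" "\<delta> < \<beta>" "bm \<in> set (trace \<delta> \<beta>)"
  shows "snd bm < \<delta>"
proof -
  obtain \<gamma> where \<gamma>: "\<gamma> < \<delta>" "\<forall>\<alpha>. \<gamma> \<le> \<alpha> \<longrightarrow> \<alpha> < \<delta> \<longrightarrow> walk \<alpha> \<beta> = walk \<delta> \<beta> @ walk \<alpha> \<delta> \<and>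
      (\<forall>b\<in>set (walk \<delta> \<beta>). lower \<alpha> b = lower \<delta> b \<and> lower \<delta> b \<le> \<gamma>)"
    using walk_split[OF assms(1-3)] by (elim exE conjE)
  have "snd bm \<le> \<gamma>"
    using assms(4) unfolding trace_def by (rule running_max_le[rotated 2]) (use \<gamma> least_point_le in auto)
  then show ?thesis using \<gamma>(1) by simp
qed

section \<open>Rises in words of bits\<close>

text \<open>The argument p is the bit preceding the list, so that the rises of a concatenation can
  be counted piece by piece.\<close>

fun rises :: "bool \<Rightarrow> ('k \<times> bool) list \<Rightarrow> 'k list" where
  "rises p [] = []"
| "rises p (x # xs) = (if snd x \<and> \<not> p then fst x # rises (snd x) xs else rises (snd x) xs)"

definition final_bit :: "bool \<Rightarrow> ('k \<times> bool) list \<Rightarrow> bool" where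
  "final_bit p xs = foldl (\<lambda>_ x. snd x) p xs"

lemma final_bit_append: "final_bit p (xs @ ys) = final_bit (final_bit p xs) ys"
  by (simp add: final_bit_def)

lemma rises_append: "rises p (xs @ ys) = rises p xs @ rises (final_bit p xs) ys"
  by (induction xs arbitrary: p) (auto simp: final_bit_def)

lemma rises_False: "(\<And>x. x \<in> set xs \<Longrightarrow> \<not> snd x) \<Longrightarrow> rises p xs = []"
  by (induction xs arbitrary: p) auto

lemma final_bit_False: "(\<And>x. x \<in> set xs \<Longrightarrow> \<not> snd x) \<Longrightarrow> xs \<noteq> [] \<Longrightarrow> \<not> final_bit p xs"
  by (induction xs rule: rev_induct) (auto simp: final_bit_def)

lemma rises_True: "(\<And>x. x \<in> set xs \<Longrightarrow> snd x) \<Longrightarrow> rises True xs = []"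
  by (induction xs) auto

lemma final_bit_True: "(\<And>x. x \<in> set xs \<Longrightarrow> snd x) \<Longrightarrow> xs \<noteq> [] \<Longrightarrow> final_bit p xs"
  by (induction xs rule: rev_induct) (auto simp: final_bit_def)

text \<open>The trace is an argument of its own since the bits on
  \<open>trace \<delta> \<beta>\<close> are also needed for an \<alpha> other than \<delta>.\<close>

definition word :: "'k \<Rightarrow> 'k \<Rightarrow> ('k \<times> 'k) list \<Rightarrow> ('k \<times> bool) list" where
  "word \<alpha> \<beta> tr = map (\<lambda>(b, m). (b, rho m \<beta> < rho m \<alpha>)) tr"

lemma word_append: "word \<alpha> \<beta> (xs @ ys) = word \<alpha> \<beta> xs @ word \<alpha> \<beta> ys"
  by (simp add: word_def)

lemma word_cong:
  "(\<And>bm. bm \<in> set tr \<Longrightarrow> rho (snd bm) \<alpha> = rho (snd bm) \<alpha>') \<Longrightarrow>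
   (\<And>bm. bm \<in> set tr \<Longrightarrow> rho (snd bm) \<beta> = rho (snd bm) \<beta>') \<Longrightarrow> word \<alpha> \<beta> tr = word \<alpha>' \<beta>' tr"
  by (auto simp: word_def)

subsection \<open>Adding rises one at a time\<close>

text \<open>A finite s prescribes values of \<open>rho\<close> towards \<alpha>; for given \<beta>
  this fixes all bits of a word whose trace points lie in the domain of s.\<close>

definition of_type :: "'k set \<Rightarrow> ('k \<times> 'l) set \<Rightarrow> 'k set" where
  "of_type A s = {\<alpha>\<in>A. \<forall>(\<xi>, \<nu>)\<in>s. \<xi> < \<alpha> \<and> rho \<xi> \<alpha> = \<nu>}"

lemma of_type_subset: "of_type A s \<subseteq> A"
  by (auto simp: of_type_def)

lemma of_typeD: "\<alpha> \<in> of_type A s \<Longrightarrow> (\<xi>, \<nu>) \<in> s \<Longrightarrow> rho \<xi> \<alpha> = \<nu>"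
  by (auto simp: of_type_def)

lemma of_type_mono: "s \<subseteq> s' \<Longrightarrow> of_type A s' \<subseteq> of_type A s"
  by (auto simp: of_type_def)

lemma of_type_extend: "\<alpha> \<in> of_type A s \<Longrightarrow> (\<And>\<xi>. \<xi> \<in> L \<Longrightarrow> \<xi> < \<alpha>) \<Longrightarrow> \<alpha> \<in> of_type A (s \<union> (\<lambda>\<xi>. (\<xi>, rho \<xi> \<alpha>)) ` L)"
  by (auto simp: of_type_def)

lemma unboundedD: "unbounded X \<Longrightarrow> \<gamma> \<in> K \<Longrightarrow> \<exists>\<alpha>\<in>X. \<gamma> < \<alpha>"
  by (simp add: unbounded_def)

lemma not_unboundedD: "X \<subseteq> K \<Longrightarrow> \<not> unbounded X \<Longrightarrow> \<exists>k\<in>K. \<forall>\<alpha>\<in>X. \<not> k < \<alpha>"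
  by (simp add: unbounded_def)

lemma unbounded_K: "unbounded X \<Longrightarrow> X \<subseteq> K"
  by (simp add: unbounded_def)

lemma stationary_unbounded: "stationary S \<Longrightarrow> unbounded (S \<inter> K)"
  unfolding unbounded_def using stationary_above by blast

text \<open>Values \<open>\<le> \<nu>\<close> in each of \<open>\<lambda>\<close> disjoint sets would contradict local smallness.\<close>

lemma rho_unbounded:
  assumes X: "unbounded X"
  shows "\<exists>\<gamma>\<in>K. \<forall>L \<nu>. finite L \<longrightarrow> L \<subseteq> K \<longrightarrow> (\<forall>\<xi>\<in>L. \<gamma> \<le> \<xi>) \<longrightarrow> \<nu> \<in> \<Lambda> \<longrightarrow>
    unbounded {\<alpha>\<in>X. \<forall>\<xi>\<in>L. \<xi> < \<alpha> \<and> \<nu> < rho \<xi> \<alpha>}"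
proof (rule ccontr)
  assume contra: "\<not> ?thesis"
  \<comment> \<open>A failure at \<gamma> gives a block L between \<gamma> and k in which every
    \<alpha> of X above k has a value at most \<nu>.\<close>
  have "\<exists>L \<nu> k. \<nu> \<in> \<Lambda> \<and> k \<in> K \<and> (\<forall>\<xi>\<in>L. \<gamma> \<le> \<xi> \<and> \<xi> < k) \<and> (\<forall>\<alpha>\<in>X. k < \<alpha> \<longrightarrow> (\<exists>\<xi>\<in>L. rho \<xi> \<alpha> \<le> \<nu>))"
    if "\<gamma> \<in> K" for \<gamma>
  proof -
    have "\<exists>L \<nu>. finite L \<and> L \<subseteq> K \<and> (\<forall>\<xi>\<in>L. \<gamma> \<le> \<xi>) \<and> \<nu> \<in> \<Lambda> \<and> \<not> unbounded {\<alpha>\<in>X. \<forall>\<xi>\<in>L. \<xi> < \<alpha> \<and> \<nu> < rho \<xi> \<alpha>}"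
      using contra that by simp
    then obtain L \<nu> where L: "finite L" "L \<subseteq> K" "\<forall>\<xi>\<in>L. \<gamma> \<le> \<xi>" "\<nu> \<in> \<Lambda>"
        "\<not> unbounded {\<alpha>\<in>X. \<forall>\<xi>\<in>L. \<xi> < \<alpha> \<and> \<nu> < rho \<xi> \<alpha>}" by (elim exE conjE)
    have "{\<alpha>\<in>X. \<forall>\<xi>\<in>L. \<xi> < \<alpha> \<and> \<nu> < rho \<xi> \<alpha>} \<subseteq> K" using unbounded_K[OF X] by auto
    from not_unboundedD[OF this L(5)]
    obtain k0 where k0: "k0 \<in> K" "\<forall>\<alpha>\<in>{\<alpha>\<in>X. \<forall>\<xi>\<in>L. \<xi> < \<alpha> \<and> \<nu> < rho \<xi> \<alpha>}. \<not> k0 < \<alpha>"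
      by (elim bexE)
    have "insert k0 L \<subseteq> K" using k0 L by simp
    from K_bounded[OF this medium_finite] L(1)
    obtain k where k: "k \<in> K" "k0 < k" "\<forall>\<xi>\<in>L. \<xi> < k" by auto
    have "\<exists>\<xi>\<in>L. rho \<xi> \<alpha> \<le> \<nu>" if "\<alpha> \<in> X" "k < \<alpha>" for \<alpha>
    proof (rule ccontr)
      assume c: "\<not> ?thesis"
      have "\<xi> < \<alpha> \<and> \<nu> < rho \<xi> \<alpha>" if "\<xi> \<in> L" for \<xi>
        using k(3) \<open>k < \<alpha>\<close> that c by (auto simp: not_le intro: order_less_trans)
      then have "\<not> k0 < \<alpha>" using k0(2) \<open>\<alpha> \<in> X\<close> by blast
      then show False using k(2) \<open>k < \<alpha>\<close> by simp
    qed
    then show ?thesis using k L by (intro exI[of _ L] exI[of _ \<nu>] exI[of _ k]) simp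
  qed
  then obtain Lf \<nu>f kf where *: "\<And>\<gamma>. \<gamma> \<in> K \<Longrightarrow> \<nu>f \<gamma> \<in> \<Lambda>" "\<And>\<gamma>. \<gamma> \<in> K \<Longrightarrow> kf \<gamma> \<in> K"
      "\<And>\<gamma> \<xi>. \<gamma> \<in> K \<Longrightarrow> \<xi> \<in> Lf \<gamma> \<Longrightarrow> \<gamma> \<le> \<xi> \<and> \<xi> < kf \<gamma>"
      "\<And>\<gamma> \<alpha>. \<gamma> \<in> K \<Longrightarrow> \<alpha> \<in> X \<Longrightarrow> kf \<gamma> < \<alpha> \<Longrightarrow> \<exists>\<xi>\<in>Lf \<gamma>. rho \<xi> \<alpha> \<le> \<nu>f \<gamma>"
    by metis
  \<comment> \<open>One bound \<nu> serves for stationarily many blocks.\<close>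
  have "\<exists>\<nu>. stationary {\<delta>\<in>cof_points. \<delta> \<in> K \<and> \<nu> \<in> \<Lambda> \<and> \<nu>f \<delta> = \<nu>}"
  proof (rule fodor[OF cof_points_stat, of "\<lambda>_. \<Lambda>"])
    fix \<delta> assume "\<delta> \<in> cof_points" "\<delta> \<in> K"
    then obtain \<zeta> where "\<zeta> < \<delta>" using cof_points_finite[of \<delta> "{}"] by auto
    then show "\<exists>\<zeta><\<delta>. \<exists>x\<in>\<Lambda>. \<delta> \<in> K \<and> x \<in> \<Lambda> \<and> \<nu>f \<delta> = x"
      using *(1) \<open>\<delta> \<in> K\<close> by (intro exI[of _ \<zeta>]) simp
  qed (simp_all add: medium_\<Lambda>)
  then obtain \<nu> where \<nu>: "stationary {\<delta>\<in>cof_points. \<delta> \<in> K \<and> \<nu> \<in> \<Lambda> \<and> \<nu>f \<delta> = \<nu>}" (is "stationary ?S") by blast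
  \<comment> \<open>Blocks starting from closure points of \<open>kf\<close> are disjoint: each ends
    below the next such point.\<close>
  have "kf ` K \<subseteq> K" using *(2) by auto
  from stationary_unbounded[OF stationary_Int_closure_points[OF \<nu> this]] have u: "unbounded (?S \<inter> closure_points kf \<inter> K)" .
  have "\<not> medium (?S \<inter> closure_points kf \<inter> K)" using u unbounded_iff[of "?S \<inter> closure_points kf \<inter> K"] by simp
  then have "\<not> small (?S \<inter> closure_points kf \<inter> K)" using ordLess_imp_ordLeq by blast
  then have "|\<Lambda>| \<le>o |?S \<inter> closure_points kf \<inter> K|" by (simp add: small_iff_not)
  then obtain g where g: "inj_on g \<Lambda>" "g ` \<Lambda> \<subseteq> ?S \<inter> closure_points kf \<inter> K"
    using card_of_ordLeq[of \<Lambda> "?S \<inter> closure_points kf \<inter> K"] by auto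
  define Y where "Y = g ` \<Lambda>"
  have Y: "\<gamma> \<in> K" "\<nu> \<in> \<Lambda>" "\<nu>f \<gamma> = \<nu>" "\<gamma> \<in> closure_points kf" if "\<gamma> \<in> Y" for \<gamma>
    using g(2) that by (auto simp: Y_def)
  have "medium (kf ` Y)" unfolding Y_def by (intro medium_image medium_\<Lambda>)
  then obtain k where k: "k \<in> K" "\<forall>x\<in>kf ` Y. x < k" using K_bounded[of "kf ` Y"] *(2) Y(1) by auto
  \<comment> \<open>This \<alpha> is above \<lambda> many blocks at once and has a value at most
    \<nu> in each.\<close>
  obtain \<alpha> where \<alpha>: "\<alpha> \<in> X" "k < \<alpha>" using unboundedD[OF X k(1)] by blast
  have "\<exists>\<xi>. \<xi> \<in> Lf \<gamma> \<and> rho \<xi> \<alpha> \<le> \<nu>" if "\<gamma> \<in> Y" for \<gamma>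
    using *(4)[OF Y(1)[OF that] \<alpha>(1)] Y(3)[OF that] k(2) \<alpha>(2) that by (auto intro: order_less_trans)
  then obtain x where x: "\<And>\<gamma>. \<gamma> \<in> Y \<Longrightarrow> x \<gamma> \<in> Lf \<gamma> \<and> rho (x \<gamma>) \<alpha> \<le> \<nu>" by metis
  have less: "x \<gamma> < x \<gamma>'" if "\<gamma> \<in> Y" "\<gamma>' \<in> Y" "\<gamma> < \<gamma>'" for \<gamma> \<gamma>'
  proof -
    have "x \<gamma> < kf \<gamma>" using *(3) x Y that by simp
    also have "kf \<gamma> < \<gamma>'" by (rule closure_points_closed[OF Y(4)[OF that(2)] that(3)])
    also have "\<gamma>' \<le> x \<gamma>'" using *(3) x Y that by simp
    finally show ?thesis .
  qed
  have inj: "inj_on x Y"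
  proof (rule inj_onI)
    fix \<gamma> \<gamma>' assume "\<gamma> \<in> Y" "\<gamma>' \<in> Y" "x \<gamma> = x \<gamma>'"
    then show "\<gamma> = \<gamma>'" using less[of \<gamma> \<gamma>'] less[of \<gamma>' \<gamma>] by (cases \<gamma> \<gamma>' rule: linorder_cases) auto
  qed
  have "x ` Y \<subseteq> {\<xi>. \<xi> < \<alpha> \<and> rho \<xi> \<alpha> \<le> \<nu>}"
  proof (rule image_subsetI)
    fix \<gamma> assume \<gamma>: "\<gamma> \<in> Y"
    have "x \<gamma> < kf \<gamma>" using *(3) x Y \<gamma> by simp
    also have "kf \<gamma> < k" using k \<gamma> by simp
    also note \<alpha>(2)
    finally show "x \<gamma> \<in> {\<xi>. \<xi> < \<alpha> \<and> rho \<xi> \<alpha> \<le> \<nu>}" using x[OF \<gamma>] by simp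
  qed
  moreover have "Y \<noteq> {}" using infinite_\<Lambda> by (auto simp: Y_def)
  then have "\<nu> \<in> \<Lambda>" using Y(2) by blast
  ultimately have "small (x ` Y)"
    using small_mono[OF rho_small[of \<alpha> \<nu>]] \<alpha>(1) unbounded_K[OF X] by blast
  then have "small Y" by (rule small_inj[OF _ inj])
  then have "small \<Lambda>" unfolding Y_def by (rule small_inj[OF _ g(1)])
  then show False by (simp add: small_iff_not medium_\<Lambda>)
qed

lemma Fpow_limit:
  assumes "\<delta> \<in> cof_points" "s \<in> Fpow ({..<\<delta>} \<times> \<Lambda>)"
  shows "\<exists>\<zeta><\<delta>. s \<in> Fpow ({..<\<zeta>} \<times> \<Lambda>)"
proof -
  have s: "finite s" "s \<subseteq> {..<\<delta>} \<times> \<Lambda>" using assms(2) by (auto simp: Fpow_def)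
  then have "finite (fst ` s)" "fst ` s \<subseteq> {..<\<delta>}" by auto
  from cof_points_finite[OF assms(1) this] obtain \<zeta> where "\<zeta> < \<delta>" "\<forall>x\<in>fst ` s. x < \<zeta>" by blast
  then show ?thesis using s by (intro exI[of _ \<zeta>]) (force simp: Fpow_def)
qed

lemma medium_Fpow_types: "\<zeta> \<in> K \<Longrightarrow> medium (Fpow ({..<\<zeta>} \<times> \<Lambda>))"
  by (intro medium_Fpow medium_Times K_segment medium_\<Lambda>)

lemma Fpow_types_mono: "(\<zeta> :: 'k) \<le> \<zeta>' \<Longrightarrow> Fpow ({..<\<zeta>} \<times> \<Lambda>) \<subseteq> Fpow ({..<\<zeta>'} \<times> \<Lambda>)"
  by (rule Fpow_mono) (auto intro: order_less_le_trans)

section \<open>Reflection of types\<close>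

text \<open>Stands in for an elementary submodel that contains X and meets K in \<delta>: X is
  unbounded once it reaches \<delta>, and an unbounded X has its witnesses below \<delta>.\<close>

definition reflects :: "'k set \<Rightarrow> 'k \<Rightarrow> bool" where
  "reflects X \<delta> \<longleftrightarrow> ((\<exists>\<alpha>\<in>X. \<delta> \<le> \<alpha>) \<longrightarrow> unbounded X) \<and>
     (unbounded X \<longrightarrow> (\<forall>\<gamma><\<delta>. \<exists>\<alpha>\<in>X. \<gamma> \<le> \<alpha> \<and> \<alpha> < \<delta>) \<and>
       (\<exists>\<gamma><\<delta>. \<forall>L \<nu>. finite L \<longrightarrow> L \<subseteq> K \<longrightarrow> (\<forall>\<xi>\<in>L. \<gamma> \<le> \<xi>) \<longrightarrow> \<nu> \<in> \<Lambda> \<longrightarrow>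
          unbounded {\<alpha>\<in>X. \<forall>\<xi>\<in>L. \<xi> < \<alpha> \<and> \<nu> < rho \<xi> \<alpha>}))"

lemma reflects_closure_points:
  assumes "X \<subseteq> K"
  shows "\<exists>h. h ` K \<subseteq> K \<and> (\<forall>\<delta>\<in>closure_points h. reflects X \<delta>)"
proof (cases "unbounded X")
  case True
  obtain \<gamma> where \<gamma>: "\<gamma> \<in> K" "\<forall>L \<nu>. finite L \<longrightarrow> L \<subseteq> K \<longrightarrow> (\<forall>\<xi>\<in>L. \<gamma> \<le> \<xi>) \<longrightarrow> \<nu> \<in> \<Lambda> \<longrightarrow>
          unbounded {\<alpha>\<in>X. \<forall>\<xi>\<in>L. \<xi> < \<alpha> \<and> \<nu> < rho \<xi> \<alpha>}" using rho_unbounded[OF True] by (elim bexE)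
  have "\<exists>\<alpha>\<in>X. \<zeta> < \<alpha>" if "\<zeta> \<in> K" for \<zeta> using unboundedD[OF True that] .
  then obtain g where g: "\<And>\<zeta>. \<zeta> \<in> K \<Longrightarrow> g \<zeta> \<in> X \<and> \<zeta> < g \<zeta>" by metis
  define h where "h \<zeta> = max \<gamma> (g \<zeta>)" for \<zeta>
  have "h ` K \<subseteq> K" using g assms \<gamma>(1) by (auto simp: h_def max_def)
  moreover have "reflects X \<delta>" if \<delta>: "\<delta> \<in> closure_points h" for \<delta>
  proof -
    have "\<exists>\<alpha>\<in>X. \<zeta> \<le> \<alpha> \<and> \<alpha> < \<delta>" if "\<zeta> < \<delta>" for \<zeta>
    proof -
      have "\<zeta> \<in> K" using K_down[OF closure_points_K[OF \<delta>], of \<zeta>] that by simp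
      then show ?thesis using g[of \<zeta>] closure_points_closed[OF \<delta> that] by (intro bexI[of _ "g \<zeta>"]) (auto simp: h_def)
    qed
    moreover obtain \<zeta> where "\<zeta> < \<delta>" using closure_points_nonempty[OF \<delta>] by blast
    then have "\<gamma> < \<delta>" using closure_points_closed[OF \<delta>, of \<zeta>] by (simp add: h_def)
    ultimately show ?thesis unfolding reflects_def using True \<gamma>(2) by blast
  qed
  ultimately show ?thesis by (intro exI[of _ h]) simp
next
  case False
  then obtain b where b: "b \<in> K" "\<And>\<alpha>. \<alpha> \<in> X \<Longrightarrow> \<not> b < \<alpha>" using assms unfolding unbounded_def by auto
  \<comment> \<open>Closure points of a constant function lie beyond its value, where both premises
    in \<open>reflects\<close> fail.\<close>
  have "reflects X \<delta>" if \<delta>: "\<delta> \<in> closure_points (\<lambda>_. b)" for \<delta>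
  proof -
    obtain \<zeta> where "\<zeta> < \<delta>" using closure_points_nonempty[OF \<delta>] by blast
    then have "b < \<delta>" using closure_points_closed[OF \<delta>, of \<zeta>] by simp
    then have "\<not> (\<exists>\<alpha>\<in>X. \<delta> \<le> \<alpha>)" using b(2) by (auto dest: order_less_le_trans)
    then show ?thesis unfolding reflects_def using False by blast
  qed
  then show ?thesis using b(1) by (intro exI[of _ "\<lambda>_. b"]) auto
qed

text \<open>Only \<lambda> many types live below any one point, so a diagonal intersection handles
  all of them.\<close>

lemma reflects_types:
  assumes "A \<subseteq> K"
  shows "\<exists>f. f ` K \<subseteq> K \<and> (\<forall>\<delta>\<in>closure_points f \<inter> cof_points. \<forall>s\<in>Fpow ({..<\<delta>} \<times> \<Lambda>). reflects (of_type A s) \<delta>)"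
proof -
  have "\<exists>h. h ` K \<subseteq> K \<and> (\<forall>\<delta>\<in>closure_points h. reflects (of_type A s) \<delta>)" for s
    by (rule reflects_closure_points[OF order_trans[OF of_type_subset assms]])
  then have "\<forall>s. \<exists>h. h ` K \<subseteq> K \<and> (\<forall>\<delta>\<in>closure_points h. reflects (of_type A s) \<delta>)" by (rule allI)
  then obtain h where h: "\<forall>s. h s ` K \<subseteq> K \<and> (\<forall>\<delta>\<in>closure_points (h s). reflects (of_type A s) \<delta>)"
    unfolding choice_iff by (elim exE)
  have hK: "h s ` K \<subseteq> K" for s using h by simp
  have "\<exists>f. f ` K \<subseteq> K \<and> (\<forall>\<delta>\<in>closure_points f. \<forall>\<zeta><\<delta>. \<forall>s\<in>Fpow ({..<\<zeta>} \<times> \<Lambda>). \<delta> \<in> closure_points (h s))"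
    by (rule diagonal) (erule medium_Fpow_types | erule Fpow_types_mono | rule hK)+
  then obtain f where f: "f ` K \<subseteq> K" "\<forall>\<delta>\<in>closure_points f. \<forall>\<zeta><\<delta>. \<forall>s\<in>Fpow ({..<\<zeta>} \<times> \<Lambda>). \<delta> \<in> closure_points (h s)" by (elim exE conjE)
  have "reflects (of_type A s) \<delta>" if \<delta>: "\<delta> \<in> closure_points f" "\<delta> \<in> cof_points" "s \<in> Fpow ({..<\<delta>} \<times> \<Lambda>)" for \<delta> s
  proof -
    obtain \<zeta> where "\<zeta> < \<delta>" "s \<in> Fpow ({..<\<zeta>} \<times> \<Lambda>)" using Fpow_limit[OF \<delta>(2,3)] by blast
    then have "\<delta> \<in> closure_points (h s)" using f(2) \<delta>(1) by simp
    then show ?thesis using h by simp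
  qed
  then show ?thesis using f(1) by (intro exI[of _ f]) simp
qed

lemma reflects_unbounded: "reflects X \<delta> \<Longrightarrow> \<alpha> \<in> X \<Longrightarrow> \<delta> < \<alpha> \<Longrightarrow> unbounded X"
  unfolding reflects_def using order_less_imp_le[of \<delta> \<alpha>] by blast

lemma reflects_below: "reflects X \<delta> \<Longrightarrow> unbounded X \<Longrightarrow> \<gamma> < \<delta> \<Longrightarrow> \<exists>\<alpha>\<in>X. \<gamma> \<le> \<alpha> \<and> \<alpha> < \<delta>"
  by (simp add: reflects_def)

lemma reflects_rho_unbounded:
  "reflects X \<delta> \<Longrightarrow> unbounded X \<Longrightarrow>
    \<exists>\<gamma><\<delta>. \<forall>L \<nu>. finite L \<longrightarrow> L \<subseteq> K \<longrightarrow> (\<forall>\<xi>\<in>L. \<gamma> \<le> \<xi>) \<longrightarrow> \<nu> \<in> \<Lambda> \<longrightarrow>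
      unbounded {\<alpha>\<in>X. \<forall>\<xi>\<in>L. \<xi> < \<alpha> \<and> \<nu> < rho \<xi> \<alpha>}"
  by (simp add: reflects_def)

lemma rho_eventually_eq:
  assumes "\<delta> \<in> cof_points" "\<beta> \<in> K" "\<beta>' \<in> K" "\<delta> \<le> \<beta>" "\<delta> \<le> \<beta>'"
  shows "\<exists>\<gamma><\<delta>. \<forall>\<xi>. \<gamma> \<le> \<xi> \<longrightarrow> \<xi> < \<delta> \<longrightarrow> rho \<xi> \<beta> = rho \<xi> \<beta>'"
proof -
  obtain \<gamma> where \<gamma>: "\<gamma> < \<delta>" "\<forall>\<xi>\<in>{\<xi>. \<xi> < \<delta> \<and> rho \<xi> \<beta> \<noteq> rho \<xi> \<beta>'}. \<xi> < \<gamma>"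
    using cof_points_small[OF assms(1) _ rho_coherent[OF assms(2-5)]] by auto
  have "rho \<xi> \<beta> = rho \<xi> \<beta>'" if "\<gamma> \<le> \<xi>" "\<xi> < \<delta>" for \<xi>
  proof (rule ccontr)
    assume "rho \<xi> \<beta> \<noteq> rho \<xi> \<beta>'"
    then have "\<xi> < \<gamma>" using \<gamma>(2) that(2) by simp
    then show False using that(1) by simp
  qed
  then show ?thesis using \<gamma>(1) by (intro exI[of _ \<gamma>]) simp
qed

lemma word_snd: "x \<in> set (word \<alpha> \<beta> tr) \<Longrightarrow> \<exists>\<xi>\<in>snd ` set tr. snd x = (rho \<xi> \<beta> < rho \<xi> \<alpha>)"
  by (force simp: word_def)

section \<open>Configurations\<close>

text \<open>Here r counts the rises of an initial word that is not under control; the j rises added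
  later have indices from r on, counted from 0, and the first of them must have colour z. For
  \<open>j = 0\<close> there is no rise of index r. Ending in True makes the effect of any
  continuation independent of j.\<close>

definition good_word :: "('k \<Rightarrow> 'k \<times> 'k) \<Rightarrow> 'k \<times> 'k \<Rightarrow> nat \<Rightarrow> 'k \<Rightarrow> 'k \<Rightarrow> 'k \<Rightarrow> nat \<Rightarrow> bool" where
  "good_word col z r \<delta> \<beta> \<alpha> j \<longleftrightarrow> (let w = word \<alpha> \<beta> (trace \<delta> \<beta>) in
     length (rises False w) = r + j \<and> (0 < j \<longrightarrow> final_bit False w \<and> col (rises False w ! r) = z))"

text \<open>All \<open>\<beta> j\<close> share \<delta> and the type s, so a single \<alpha> of this
  type sees every count from r to \<open>r + m\<close>.\<close>

definition configuration :: "'k set \<Rightarrow> 'k set \<Rightarrow> ('k \<Rightarrow> 'k \<times> 'k) \<Rightarrow> 'k \<times> 'k \<Rightarrow> nat \<Rightarrow> nat \<Rightarrow> ('k \<times> 'l) set \<Rightarrow> 'k \<Rightarrow> bool" where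
  "configuration A B col z r m s \<delta> \<longleftrightarrow> s \<in> Fpow ({..<\<delta>} \<times> \<Lambda>) \<and> unbounded (of_type A s) \<and>
     (\<exists>\<beta>. \<forall>j\<le>m. \<beta> j \<in> B \<and> \<delta> < \<beta> j \<and> (\<forall>\<alpha>\<in>of_type A s. good_word col z r \<delta> (\<beta> j) \<alpha> j))"

text \<open>Take any \<alpha> and \<beta> above \<delta>. Recording the values towards \<alpha> on
  the finite trace from \<beta> to \<delta> as the type s makes the word the same for all members of
  the type; Fodor's lemma then fixes r and s.\<close>

lemma configuration_0:
  assumes A: "unbounded A" and B: "unbounded B" and T: "stationary T" "T \<subseteq> cof_points"
  shows "\<exists>r s. stationary {\<delta>\<in>T. configuration A B col z r 0 s \<delta>}"
proof -
  obtain f where f: "f ` K \<subseteq> K" "\<forall>\<delta>\<in>closure_points f \<inter> cof_points. \<forall>s\<in>Fpow ({..<\<delta>} \<times> \<Lambda>). reflects (of_type A s) \<delta>"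
    using reflects_types[OF unbounded_K[OF A]] by (elim exE conjE)
  have "\<exists>x. stationary {\<delta>\<in>T \<inter> closure_points f. configuration A B col z (fst x) 0 (snd x) \<delta>}"
  proof (rule fodor[OF stationary_Int_closure_points[OF T(1) f(1)], of "\<lambda>\<zeta>. UNIV \<times> Fpow ({..<\<zeta>} \<times> \<Lambda>)"])
    show "medium (UNIV \<times> Fpow ({..<\<zeta>} \<times> \<Lambda>) :: (nat \<times> _) set)" if "\<zeta> \<in> K" for \<zeta>
      by (rule medium_Times[OF medium_nat medium_Fpow_types[OF that]])
    show "(UNIV :: nat set) \<times> Fpow ({..<\<zeta>} \<times> \<Lambda>) \<subseteq> UNIV \<times> Fpow ({..<\<zeta>'} \<times> \<Lambda>)" if "\<zeta> \<le> \<zeta>'" for \<zeta> \<zeta>' :: 'k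
      using Fpow_types_mono[OF that] by blast
    fix \<delta> assume d: "\<delta> \<in> T \<inter> closure_points f" "\<delta> \<in> K"
    then have \<delta>: "\<delta> \<in> cof_points" "\<delta> \<in> closure_points f" using T(2) by auto
    obtain \<alpha> where \<alpha>: "\<alpha> \<in> A" "\<delta> < \<alpha>" using unboundedD[OF A d(2)] by blast
    obtain \<beta> where \<beta>: "\<beta> \<in> B" "\<delta> < \<beta>" using unboundedD[OF B d(2)] by blast
    have K: "\<alpha> \<in> K" "\<beta> \<in> K" using \<alpha> \<beta> unbounded_K[OF A] unbounded_K[OF B] by auto
    define L where "L = snd ` set (trace \<delta> \<beta>)"
    have L: "\<xi> < \<delta>" if "\<xi> \<in> L" for \<xi> using that trace_low[OF K(2) \<delta>(1) \<beta>(2)] by (auto simp: L_def)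
    define s where "s = (\<lambda>\<xi>. (\<xi>, rho \<xi> \<alpha>)) ` L"
    have "\<alpha> \<in> of_type A ({} \<union> (\<lambda>\<xi>. (\<xi>, rho \<xi> \<alpha>)) ` L)"
      by (rule of_type_extend) (use \<alpha> L in \<open>auto simp: of_type_def dest: order_less_trans\<close>)
    then have \<alpha>s: "\<alpha> \<in> of_type A s" by (simp add: s_def)
    have "rho \<xi> \<alpha> \<in> \<Lambda>" if "\<xi> \<in> L" for \<xi> using rho_\<Lambda>[OF K(1), of \<xi>] L[OF that] \<alpha>(2) by simp
    then have s: "s \<in> Fpow ({..<\<delta>} \<times> \<Lambda>)" using L by (auto simp: s_def Fpow_def L_def)
    then have "reflects (of_type A s) \<delta>" using f(2) \<delta> by blast
    then have unbounded: "unbounded (of_type A s)" using \<alpha>s \<alpha>(2) by (rule reflects_unbounded)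
    define r where "r = length (rises False (word \<alpha> \<beta> (trace \<delta> \<beta>)))"
    have "good_word col z r \<delta> \<beta> \<alpha>' 0" if "\<alpha>' \<in> of_type A s" for \<alpha>'
    proof -
      have "word \<alpha>' \<beta> (trace \<delta> \<beta>) = word \<alpha> \<beta> (trace \<delta> \<beta>)"
        by (rule word_cong[OF of_typeD[OF that]]) (auto simp: s_def L_def)
      then show ?thesis by (simp add: good_word_def r_def)
    qed
    then have "configuration A B col z r 0 s \<delta>" unfolding configuration_def using s unbounded \<beta> by (intro conjI exI[of _ "\<lambda>_. \<beta>"]) auto
    then show "\<exists>\<zeta><\<delta>. \<exists>x\<in>UNIV \<times> Fpow ({..<\<zeta>} \<times> \<Lambda>). configuration A B col z (fst x) 0 (snd x) \<delta>"
      using Fpow_limit[OF \<delta>(1) s] by fastforce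
  qed
  then obtain x where x: "stationary {\<delta>\<in>T \<inter> closure_points f. configuration A B col z (fst x) 0 (snd x) \<delta>}" by blast
  have "stationary {\<delta>\<in>T. configuration A B col z (fst x) 0 (snd x) \<delta>}" by (rule stationary_mono[OF x]) auto
  then show ?thesis by blast
qed

text \<open>Three points \<open>\<delta>\<^sub>0 < \<delta>\<^sub>1 < \<delta>\<^sub>2\<close> carrying the same data add one rise to the word: on the trace from
  \<open>\<delta>\<^sub>2\<close> to \<open>\<delta>\<^sub>1\<close> coherence makes \<open>rho(\<sqdot>, \<alpha>)\<close> and \<open>rho(\<sqdot>, \<beta>)\<close> equal, while on the trace from \<open>\<delta>\<^sub>1\<close> to
  \<open>\<delta>\<^sub>0\<close> the values of \<open>rho(\<sqdot>, \<alpha>)\<close> are chosen large.\<close>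

lemma configuration_Suc:
  assumes A: "unbounded A" and B: "B \<subseteq> K" and T: "T \<subseteq> cof_points" "\<And>\<delta>. \<delta> \<in> T \<Longrightarrow> col \<delta> = z"
    and S: "stationary {\<delta>\<in>T. configuration A B col z r m s \<delta>}"
  shows "\<exists>s'. stationary {\<delta>\<in>T. configuration A B col z r (Suc m) s' \<delta>}"
proof -
  obtain f where f: "f ` K \<subseteq> K" "\<forall>\<delta>\<in>closure_points f \<inter> cof_points. \<forall>s\<in>Fpow ({..<\<delta>} \<times> \<Lambda>). reflects (of_type A s) \<delta>"
    using reflects_types[OF unbounded_K[OF A]] by (elim exE conjE)
  \<comment> \<open>The new type may at first depend on the point; Fodor's lemma makes it constant
    at the end.\<close>
  have "stationary {\<delta>\<in>T. \<exists>s'. configuration A B col z r (Suc m) s' \<delta>}"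
    unfolding stationary_def
  proof (intro allI impI)
    fix g :: "'k \<Rightarrow> 'k" assume g: "g ` K \<subseteq> K"
    define S1 where "S1 = {\<delta>\<in>T. configuration A B col z r m s \<delta>} \<inter> closure_points f \<inter> closure_points g"
    define lim where "lim X = {\<delta>\<in>X. \<delta> \<in> K \<and> (\<forall>\<gamma><\<delta>. \<exists>\<delta>'\<in>X. \<gamma> < \<delta>' \<and> \<delta>' < \<delta>)}" for X :: "'k set"
    have S1: "stationary S1" unfolding S1_def by (intro stationary_Int_closure_points S f g)
    have "stationary (lim (lim S1))" unfolding lim_def by (intro stationary_limits S1)
    then obtain \<delta>2 where \<delta>2: "\<delta>2 \<in> lim (lim S1)" using stationary_above K_ex by blast
    have in_S1: "\<delta> \<in> T" "configuration A B col z r m s \<delta>" "\<delta> \<in> cof_points" "\<delta> \<in> K" "\<delta> \<in> closure_points g"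
        "\<And>s'. s' \<in> Fpow ({..<\<delta>} \<times> \<Lambda>) \<Longrightarrow> reflects (of_type A s') \<delta>" if "\<delta> \<in> S1" for \<delta>
      using that T(1) cof_points_K f(2) by (auto simp: S1_def)
    have \<delta>2S: "\<delta>2 \<in> S1" using \<delta>2 by (simp add: lim_def)
    note d2 = in_S1[OF \<delta>2S]
    \<comment> \<open>Only the last \<beta> of the configuration at \<delta>2 gains a rise; it
      becomes number \<open>Suc m\<close> at \<delta>0.\<close>
    obtain \<beta> where \<beta>: "\<beta> \<in> B" "\<delta>2 < \<beta>" "\<And>\<alpha>. \<alpha> \<in> of_type A s \<Longrightarrow> good_word col z r \<delta>2 \<beta> \<alpha> m"
      using d2(2) unfolding configuration_def by blast
    have unb_s: "unbounded (of_type A s)" using d2(2) by (simp add: configuration_def)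
    have \<beta>K: "\<beta> \<in> K" using \<beta>(1) B by blast
    obtain \<alpha>2 where \<alpha>2: "\<alpha>2 \<in> of_type A s" "\<delta>2 < \<alpha>2" using unboundedD[OF unb_s d2(4)] by blast
    have AK: "\<alpha> \<in> K" if "\<alpha> \<in> of_type A s'" for \<alpha> s' using that of_type_subset unbounded_K[OF A] by blast

    obtain \<gamma>a where \<gamma>a: "\<gamma>a < \<delta>2" "\<forall>\<alpha>. \<gamma>a \<le> \<alpha> \<longrightarrow> \<alpha> < \<delta>2 \<longrightarrow> trace \<alpha> \<beta> = trace \<delta>2 \<beta> @ trace \<alpha> \<delta>2"
      using trace_split[OF \<beta>K d2(3) \<beta>(2)] by (elim exE conjE)
    obtain \<gamma>b where \<gamma>b: "\<gamma>b < \<delta>2" "\<forall>\<xi>. \<gamma>b \<le> \<xi> \<longrightarrow> \<xi> < \<delta>2 \<longrightarrow> rho \<xi> \<alpha>2 = rho \<xi> \<beta>"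
      using rho_eventually_eq[OF d2(3) AK[OF \<alpha>2(1)] \<beta>K order_less_imp_le[OF \<alpha>2(2)] order_less_imp_le[OF \<beta>(2)]]
      by (elim exE conjE)
    obtain \<gamma>c where \<gamma>c: "\<gamma>c < \<delta>2" "\<forall>\<alpha>. \<gamma>c \<le> \<alpha> \<longrightarrow> \<alpha> < \<delta>2 \<longrightarrow> (\<forall>bm\<in>set (trace \<alpha> \<delta>2). \<gamma>b \<le> snd bm)"
      using trace_high[OF d2(3) \<gamma>b(1)] by (elim exE conjE)
    have "max \<gamma>a \<gamma>c < \<delta>2" using \<gamma>a(1) \<gamma>c(1) by simp
    then obtain \<delta>1 where \<delta>1: "\<delta>1 \<in> lim S1" "max \<gamma>a \<gamma>c < \<delta>1" "\<delta>1 < \<delta>2"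
      using \<delta>2 unfolding lim_def[of "lim S1"] by blast
    have \<delta>1S: "\<delta>1 \<in> S1" using \<delta>1(1) by (simp add: lim_def)
    note d1 = in_S1[OF \<delta>1S]
    have \<delta>1_ge: "\<gamma>a \<le> \<delta>1" "\<gamma>c \<le> \<delta>1" using \<delta>1(2) by (simp_all add: order_less_imp_le)
    have tr1: "trace \<delta>1 \<beta> = trace \<delta>2 \<beta> @ trace \<delta>1 \<delta>2"
      using \<gamma>a(2)[rule_format, OF \<delta>1_ge(1) \<delta>1(3)] .
    define L1 where "L1 = snd ` set (trace \<delta>1 \<delta>2)"
    have finL1: "finite L1" by (simp add: L1_def)
    have L1: "\<xi> < \<delta>1" "rho \<xi> \<alpha>2 = rho \<xi> \<beta>" if "\<xi> \<in> L1" for \<xi>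
    proof -
      show less: "\<xi> < \<delta>1" using trace_low[OF d2(4) d1(3) \<delta>1(3)] that by (auto simp: L1_def)
      have "\<gamma>b \<le> \<xi>" using \<gamma>c(2)[rule_format, OF \<delta>1_ge(2) \<delta>1(3)] that by (auto simp: L1_def)
      moreover have "\<xi> < \<delta>2" using less \<delta>1(3) by (rule order_less_trans)
      ultimately show "rho \<xi> \<alpha>2 = rho \<xi> \<beta>" using \<gamma>b(2) by simp
    qed
    \<comment> \<open>On L1 the recorded values of \<alpha>2 equal those of \<beta>, so every
      \<alpha> of type s1 has bits False there.\<close>
    define s1 where "s1 = s \<union> (\<lambda>\<xi>. (\<xi>, rho \<xi> \<alpha>2)) ` L1"
    have \<alpha>2s1: "\<alpha>2 \<in> of_type A s1" unfolding s1_def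
      by (rule of_type_extend[OF \<alpha>2(1)]) (use L1(1) \<delta>1(3) \<alpha>2(2) in \<open>auto dest: order_less_trans\<close>)
    have "rho \<xi> \<alpha>2 \<in> \<Lambda>" if "\<xi> \<in> L1" for \<xi>
      using rho_\<Lambda>[OF AK[OF \<alpha>2(1)], of \<xi>] L1(1)[OF that] \<delta>1(3) \<alpha>2(2) by simp
    then have s1: "s1 \<in> Fpow ({..<\<delta>1} \<times> \<Lambda>)"
      using d1(2) L1(1) finL1 by (auto simp: s1_def configuration_def Fpow_def)
    have unb1: "unbounded (of_type A s1)"
      by (rule reflects_unbounded[OF d1(6)[OF s1] \<alpha>2s1 order_less_trans[OF \<delta>1(3) \<alpha>2(2)]])
    obtain \<gamma>1 where \<gamma>1: "\<gamma>1 < \<delta>1" "\<forall>L \<nu>. finite L \<longrightarrow> L \<subseteq> K \<longrightarrow> (\<forall>\<xi>\<in>L. \<gamma>1 \<le> \<xi>) \<longrightarrow> \<nu> \<in> \<Lambda> \<longrightarrow>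
          unbounded {\<alpha>\<in>of_type A s1. \<forall>\<xi>\<in>L. \<xi> < \<alpha> \<and> \<nu> < rho \<xi> \<alpha>}"
      using reflects_rho_unbounded[OF d1(6)[OF s1] unb1] by (elim exE conjE)

    obtain \<gamma>d where \<gamma>d: "\<gamma>d < \<delta>1" "\<forall>\<alpha>. \<gamma>d \<le> \<alpha> \<longrightarrow> \<alpha> < \<delta>1 \<longrightarrow> trace \<alpha> \<beta> = trace \<delta>1 \<beta> @ trace \<alpha> \<delta>1"
      using trace_split[OF \<beta>K d1(3) order_less_trans[OF \<delta>1(3) \<beta>(2)]] by (elim exE conjE)
    obtain \<gamma>rho where \<gamma>rho: "\<gamma>rho < \<delta>1" "\<forall>\<alpha>. \<gamma>rho \<le> \<alpha> \<longrightarrow> \<alpha> < \<delta>1 \<longrightarrow> (\<forall>bm\<in>set (trace \<alpha> \<delta>1). \<gamma>1 \<le> snd bm)"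
      using trace_high[OF d1(3) \<gamma>1(1)] by (elim exE conjE)
    \<comment> \<open>Once \<delta>0 is above L1, the pairs added to s in s1 lie below
      \<delta>0.\<close>
    obtain \<gamma>f where \<gamma>f: "\<gamma>f < \<delta>1" "\<forall>\<xi>\<in>L1. \<xi> < \<gamma>f"
      using cof_points_finite[OF d1(3) finL1] L1(1) by auto
    have "max \<gamma>d (max \<gamma>rho \<gamma>f) < \<delta>1" using \<gamma>d(1) \<gamma>rho(1) \<gamma>f(1) by simp
    then obtain \<delta>0 where \<delta>0: "\<delta>0 \<in> S1" "max \<gamma>d (max \<gamma>rho \<gamma>f) < \<delta>0" "\<delta>0 < \<delta>1"
      using \<delta>1(1) unfolding lim_def by blast
    note d0 = in_S1[OF \<delta>0(1)]
    have \<delta>0_ge: "\<gamma>d \<le> \<delta>0" "\<gamma>rho \<le> \<delta>0" "\<gamma>f \<le> \<delta>0" using \<delta>0(2) by (simp_all add: order_less_imp_le)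
    have tr0: "trace \<delta>0 \<beta> = trace \<delta>2 \<beta> @ trace \<delta>1 \<delta>2 @ trace \<delta>0 \<delta>1"
      using \<gamma>d(2)[rule_format, OF \<delta>0_ge(1) \<delta>0(3)] by (simp add: tr1)
    define L0 where "L0 = snd ` set (trace \<delta>0 \<delta>1)"
    have finL0: "finite L0" by (simp add: L0_def)
    have L0: "\<xi> < \<delta>0" "\<gamma>1 \<le> \<xi>" if "\<xi> \<in> L0" for \<xi>
      using trace_low[OF d1(4) d0(3) \<delta>0(3)] \<gamma>rho(2)[rule_format, OF \<delta>0_ge(2) \<delta>0(3)] that by (auto simp: L0_def)
    have L0_less: "\<xi> < \<delta>1" "\<xi> < \<beta>" "\<xi> \<in> K" if "\<xi> \<in> L0" for \<xi>
      using L0(1)[OF that] \<delta>0(3) \<delta>1(3) \<beta>(2) K_down[OF d0(4), of \<xi>] by auto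
    have rho\<Lambda>: "rho \<xi> \<beta> \<in> \<Lambda>" if "\<xi> \<in> L0" for \<xi> using rho_\<Lambda>[OF \<beta>K] L0_less(2)[OF that] by blast
    have "small ((\<lambda>\<xi>. rho \<xi> \<beta>) ` L0)" by (rule small_finite[OF finite_imageI[OF finL0]])
    moreover have "(\<lambda>\<xi>. rho \<xi> \<beta>) ` L0 \<subseteq> \<Lambda>" using rho\<Lambda> by (rule image_subsetI)
    ultimately obtain \<nu> where \<nu>: "\<nu> \<in> \<Lambda>" "\<forall>y\<in>(\<lambda>\<xi>. rho \<xi> \<beta>) ` L0. y < \<nu>"
      using \<Lambda>_bounded[of "(\<lambda>\<xi>. rho \<xi> \<beta>) ` L0"] by (elim meta_impE bexE)
    have "unbounded {\<alpha>\<in>of_type A s1. \<forall>\<xi>\<in>L0. \<xi> < \<alpha> \<and> \<nu> < rho \<xi> \<alpha>}"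
      by (rule \<gamma>1(2)[rule_format, OF finL0]) (use L0_less(3) L0(2) \<nu>(1) in auto)
    \<comment> \<open>With \<alpha>0 above \<delta>1, reflection at \<delta>1 will show that the
      type s0 has unboundedly many members.\<close>
    from unboundedD[OF this d1(4)] obtain \<alpha>0 where
      \<alpha>0: "\<alpha>0 \<in> of_type A s1" "\<delta>1 < \<alpha>0" "\<And>\<xi>. \<xi> \<in> L0 \<Longrightarrow> \<xi> < \<alpha>0 \<and> \<nu> < rho \<xi> \<alpha>0" by blast
    define s0 where "s0 = s1 \<union> (\<lambda>\<xi>. (\<xi>, rho \<xi> \<alpha>0)) ` L0"
    have \<alpha>0s0: "\<alpha>0 \<in> of_type A s0" unfolding s0_def
      by (rule of_type_extend[OF \<alpha>0(1)]) (use \<alpha>0(3) in blast)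
    have "rho \<xi> \<alpha>0 \<in> \<Lambda>" if "\<xi> \<in> L0" for \<xi> using rho_\<Lambda>[OF AK[OF \<alpha>0(1)]] \<alpha>0(3)[OF that] by blast
    moreover have "s1 \<in> Fpow ({..<\<delta>0} \<times> \<Lambda>)"
      using s1 d0(2) \<gamma>f(2) order_less_le_trans[OF _ \<delta>0_ge(3)] by (auto simp: s1_def configuration_def Fpow_def)
    ultimately have s0: "s0 \<in> Fpow ({..<\<delta>0} \<times> \<Lambda>)"
      using L0(1) finL0 by (auto simp: s0_def Fpow_def)
    then have "s0 \<in> Fpow ({..<\<delta>1} \<times> \<Lambda>)" using Fpow_types_mono[OF order_less_imp_le[OF \<delta>0(3)]] by blast
    from d1(6)[OF this] have unb0: "unbounded (of_type A s0)" using \<alpha>0s0 \<alpha>0(2) by (rule reflects_unbounded)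
    have sub: "of_type A s0 \<subseteq> of_type A s" by (rule of_type_mono) (auto simp: s0_def s1_def)

    have new: "good_word col z r \<delta>0 \<beta> \<alpha> (Suc m)" if \<alpha>: "\<alpha> \<in> of_type A s0" for \<alpha>
    proof -
      define w2 where "w2 = word \<alpha> \<beta> (trace \<delta>2 \<beta>)"
      define w1 where "w1 = word \<alpha> \<beta> (trace \<delta>1 \<delta>2)"
      define w0 where "w0 = word \<alpha> \<beta> (trace \<delta>0 \<delta>1)"
      have w: "word \<alpha> \<beta> (trace \<delta>0 \<beta>) = w2 @ w1 @ w0"
        by (simp add: tr0 word_append w2_def w1_def w0_def)
      have "rho \<xi> \<alpha> = rho \<xi> \<beta>" if "\<xi> \<in> L1" for \<xi>
      proof -
        have "(\<xi>, rho \<xi> \<alpha>2) \<in> s0" using that by (auto simp: s0_def s1_def)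
        then show ?thesis using of_typeD[OF \<alpha>] L1(2)[OF that] by simp
      qed
      then have w1_False: "\<not> snd x" if "x \<in> set w1" for x
        using word_snd[OF that[unfolded w1_def]] unfolding L1_def[symmetric] by auto
      have "rho \<xi> \<beta> < rho \<xi> \<alpha>" if "\<xi> \<in> L0" for \<xi>
      proof -
        have "(\<xi>, rho \<xi> \<alpha>0) \<in> s0" using that by (auto simp: s0_def)
        then have "rho \<xi> \<alpha> = rho \<xi> \<alpha>0" using of_typeD[OF \<alpha>] by simp
        moreover have "rho \<xi> \<beta> < \<nu>" using \<nu>(2) that by simp
        ultimately show ?thesis using \<alpha>0(3)[OF that] by (simp add: order_less_trans)
      qed
      then have w0_True: "snd x" if "x \<in> set w0" for x
        using word_snd[OF that[unfolded w0_def]] unfolding L0_def[symmetric] by auto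
      \<comment> \<open>The middle piece resets the bit to False whatever w2 ended in; being
        nonempty, it makes the first bit of w0, which sits at the walk point \<delta>1, a
        rise.\<close>
      have w1_ne: "w1 \<noteq> []" by (simp add: w1_def word_def trace_Cons[OF d2(4) \<delta>1(3)])
      obtain t w0' where w0: "w0 = (\<delta>1, t) # w0'" by (simp add: w0_def word_def trace_Cons[OF d1(4) \<delta>0(3)])
      have t: "t" using w0_True[of "(\<delta>1, t)"] w0 by simp
      have r1: "rises p w1 = []" "\<not> final_bit p w1" for p
        using rises_False[of w1] final_bit_False[OF _ w1_ne] w1_False by auto
      have r0: "rises False w0 = [\<delta>1]" "final_bit False w0"
        using rises_True[of w0'] final_bit_True[of w0] w0_True t by (auto simp: w0)
      have g: "length (rises False w2) = r + m" "0 < m \<Longrightarrow> final_bit False w2 \<and> col (rises False w2 ! r) = z"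
        using \<beta>(3) \<alpha> sub by (auto simp: good_word_def w2_def Let_def)
      have "rises False (w2 @ w1 @ w0) = rises False w2 @ [\<delta>1]" "final_bit False (w2 @ w1 @ w0)"
        using r1 r0 by (simp_all add: rises_append final_bit_append)
      \<comment> \<open>For \<open>m = 0\<close> the new rise \<delta>1 itself has index r, and its
        colour is z since it lies in T; for larger m the index r already falls into w2.\<close>
      moreover have "col ((rises False w2 @ [\<delta>1]) ! r) = z"
        using g T(2)[OF d1(1)] by (cases "m = 0") (auto simp: nth_append)
      ultimately show ?thesis using g(1) by (simp add: good_word_def w)
    qed
    \<comment> \<open>The smaller counts come from the configuration at \<delta>0 and survive
      because s0 extends s.\<close>
    obtain \<beta>' where \<beta>': "\<forall>j\<le>m. \<beta>' j \<in> B \<and> \<delta>0 < \<beta>' j \<and> (\<forall>\<alpha>\<in>of_type A s. good_word col z r \<delta>0 (\<beta>' j) \<alpha> j)"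
      using d0(2) by (auto simp: configuration_def)
    have "\<delta>0 < \<beta>" using \<delta>0(3) \<delta>1(3) \<beta>(2) by simp
    then have "(if j \<le> m then \<beta>' j else \<beta>) \<in> B \<and> \<delta>0 < (if j \<le> m then \<beta>' j else \<beta>) \<and>
        (\<forall>\<alpha>\<in>of_type A s0. good_word col z r \<delta>0 (if j \<le> m then \<beta>' j else \<beta>) \<alpha> j)" if "j \<le> Suc m" for j
      using \<beta>' \<beta>(1) new sub that by (cases "j \<le> m") (auto simp: le_Suc_eq)
    then have "configuration A B col z r (Suc m) s0 \<delta>0"
      unfolding configuration_def using s0 unb0 by (intro conjI exI[of _ "\<lambda>j. if j \<le> m then \<beta>' j else \<beta>"]) simp_all
    then show "\<exists>\<delta>\<in>{\<delta>\<in>T. \<exists>s'. configuration A B col z r (Suc m) s' \<delta>}. \<delta> \<in> closure_points g"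
      using d0(1,5) by blast
  qed
  then have "\<exists>s'. stationary {\<delta>\<in>{\<delta>\<in>T. \<exists>s'. configuration A B col z r (Suc m) s' \<delta>}. configuration A B col z r (Suc m) s' \<delta>}"
  proof (rule fodor[of _ "\<lambda>\<zeta>. Fpow ({..<\<zeta>} \<times> \<Lambda>)"])
    fix \<delta> assume "\<delta> \<in> {\<delta>\<in>T. \<exists>s'. configuration A B col z r (Suc m) s' \<delta>}"
    then obtain s' where s': "\<delta> \<in> cof_points" "configuration A B col z r (Suc m) s' \<delta>" using T(1) by blast
    then have "s' \<in> Fpow ({..<\<delta>} \<times> \<Lambda>)" by (simp add: configuration_def)
    from Fpow_limit[OF s'(1) this] s'(2)
    show "\<exists>\<zeta><\<delta>. \<exists>s'\<in>Fpow ({..<\<zeta>} \<times> \<Lambda>). configuration A B col z r (Suc m) s' \<delta>" by blast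
  qed (erule medium_Fpow_types | erule Fpow_types_mono)+
  then obtain s' where s': "stationary {\<delta>\<in>{\<delta>\<in>T. \<exists>s'. configuration A B col z r (Suc m) s' \<delta>}. configuration A B col z r (Suc m) s' \<delta>}" by blast
  have "stationary {\<delta>\<in>T. configuration A B col z r (Suc m) s' \<delta>}" by (rule stationary_mono[OF s']) auto
  then show ?thesis by blast
qed

section \<open>The colouring on rectangles\<close>

text \<open>Out of range, \<open>!\<close> yields an unspecified point; this is harmless because the
  \<open>col\<close> obtained from \<open>ulam\<close> maps every point into
  \<open>K \<times> K\<close>.\<close>

definition colour :: "('k \<Rightarrow> 'k \<times> 'k) \<Rightarrow> 'k \<Rightarrow> 'k \<Rightarrow> 'k \<times> 'k" where
  "colour col \<alpha> \<beta> = (let R = rises False (word \<alpha> \<beta> (trace \<alpha> \<beta>)) in col (R ! valuation (length R)))"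

text \<open>The last part of the words, below \<open>\<delta>\<close>, cannot be controlled, but by coherence it is the same for all
  \<open>\<beta>\<^sub>j\<close>. So the numbers of rises are consecutive, and one of them has valuation \<open>r\<close>; rise number \<open>r\<close>
  (counted from 0) occurs at a point of colour \<open>z\<close>.\<close>

lemma rectangular:
  assumes A: "unbounded A" and B: "unbounded B" and T: "stationary {\<delta>\<in>cof_points. col \<delta> = z}"
  shows "\<exists>\<alpha>\<in>A. \<exists>\<beta>\<in>B. \<alpha> < \<beta> \<and> colour col \<alpha> \<beta> = z"
proof -
  let ?T = "{\<delta>\<in>cof_points. col \<delta> = z}"
  obtain r s0 where base: "stationary {\<delta>\<in>?T. configuration A B col z r 0 s0 \<delta>}"
    using configuration_0[OF A B T Collect_restrict, of col z] by (elim exE)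
  \<comment> \<open>M serves for every offset, so the number of \<beta> is fixed before the \<alpha>
    that determines the offset.\<close>
  obtain M where M: "\<forall>T. \<exists>j. 1 \<le> j \<and> j \<le> M \<and> valuation (T + j) = r" using valuation[of r] by blast
  have "\<exists>s. stationary {\<delta>\<in>?T. configuration A B col z r m s \<delta>}" for m
  proof (induction m)
    case (Suc m)
    then obtain s where "stationary {\<delta>\<in>?T. configuration A B col z r m s \<delta>}" by (elim exE)
    then show ?case by (rule configuration_Suc[where T = ?T, OF A unbounded_K[OF B], rotated 2]) simp_all
  next
    case 0
    show ?case by (rule exI[of _ s0]) (rule base)
  qed
  from this[of M] obtain s where s: "stationary {\<delta>\<in>?T. configuration A B col z r M s \<delta>}" by (elim exE)
  obtain f where f: "f ` K \<subseteq> K" "\<forall>\<delta>\<in>closure_points f \<inter> cof_points. \<forall>s\<in>Fpow ({..<\<delta>} \<times> \<Lambda>). reflects (of_type A s) \<delta>"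
    using reflects_types[OF unbounded_K[OF A]] by (elim exE conjE)
  obtain \<delta> where \<delta>: "\<delta> \<in> cof_points" "configuration A B col z r M s \<delta>" "\<delta> \<in> closure_points f" using stationaryD[OF s f(1)] by blast
  obtain \<beta> where \<beta>: "\<And>j. j \<le> M \<Longrightarrow> \<beta> j \<in> B" "\<And>j. j \<le> M \<Longrightarrow> \<delta> < \<beta> j"
      "\<And>j \<alpha>. j \<le> M \<Longrightarrow> \<alpha> \<in> of_type A s \<Longrightarrow> good_word col z r \<delta> (\<beta> j) \<alpha> j"
    using \<delta>(2) unfolding configuration_def by blast
  have \<beta>K: "\<beta> j \<in> K" if "j \<le> M" for j using \<beta>(1)[OF that] unbounded_K[OF B] by blast
  have "\<exists>\<gamma><\<delta>. (\<forall>\<alpha>. \<gamma> \<le> \<alpha> \<longrightarrow> \<alpha> < \<delta> \<longrightarrow> trace \<alpha> (\<beta> j) = trace \<delta> (\<beta> j) @ trace \<alpha> \<delta>) \<and>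
      (\<forall>\<xi>. \<gamma> \<le> \<xi> \<longrightarrow> \<xi> < \<delta> \<longrightarrow> rho \<xi> (\<beta> j) = rho \<xi> (\<beta> 0))" if j: "j \<le> M" for j
  proof -
    obtain \<gamma>1 where \<gamma>1: "\<gamma>1 < \<delta>" "\<forall>\<alpha>. \<gamma>1 \<le> \<alpha> \<longrightarrow> \<alpha> < \<delta> \<longrightarrow> trace \<alpha> (\<beta> j) = trace \<delta> (\<beta> j) @ trace \<alpha> \<delta>"
      using trace_split[OF \<beta>K[OF j] \<delta>(1) \<beta>(2)[OF j]] by (elim exE conjE)
    obtain \<gamma>2 where \<gamma>2: "\<gamma>2 < \<delta>" "\<forall>\<xi>. \<gamma>2 \<le> \<xi> \<longrightarrow> \<xi> < \<delta> \<longrightarrow> rho \<xi> (\<beta> j) = rho \<xi> (\<beta> 0)"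
      using rho_eventually_eq[OF \<delta>(1) \<beta>K[OF j] \<beta>K[of 0] order_less_imp_le[OF \<beta>(2)[OF j]] order_less_imp_le[OF \<beta>(2)[of 0]]]
      by (auto simp del: not_le)
    show ?thesis using \<gamma>1 \<gamma>2 by (intro exI[of _ "max \<gamma>1 \<gamma>2"]) simp
  qed
  then obtain \<gamma> where \<gamma>: "\<And>j. j \<le> M \<Longrightarrow> \<gamma> j < \<delta>"
      "\<And>j \<alpha>. j \<le> M \<Longrightarrow> \<gamma> j \<le> \<alpha> \<Longrightarrow> \<alpha> < \<delta> \<Longrightarrow> trace \<alpha> (\<beta> j) = trace \<delta> (\<beta> j) @ trace \<alpha> \<delta>"
      "\<And>j \<xi>. j \<le> M \<Longrightarrow> \<gamma> j \<le> \<xi> \<Longrightarrow> \<xi> < \<delta> \<Longrightarrow> rho \<xi> (\<beta> j) = rho \<xi> (\<beta> 0)"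
    by metis
  have "finite (\<gamma> ` {..M})" "\<gamma> ` {..M} \<subseteq> {..<\<delta>}" using \<gamma>(1) by auto
  from cof_points_finite[OF \<delta>(1) this] obtain \<gamma>m where \<gamma>m: "\<gamma>m < \<delta>" "\<And>j. j \<le> M \<Longrightarrow> \<gamma> j < \<gamma>m" by auto
  obtain \<gamma>h where \<gamma>h: "\<gamma>h < \<delta>" "\<forall>\<alpha>. \<gamma>h \<le> \<alpha> \<longrightarrow> \<alpha> < \<delta> \<longrightarrow> (\<forall>bm\<in>set (trace \<alpha> \<delta>). \<gamma>m \<le> snd bm)"
    using trace_high[OF \<delta>(1) \<gamma>m(1)] by (elim exE conjE)
  have "s \<in> Fpow ({..<\<delta>} \<times> \<Lambda>)" "unbounded (of_type A s)" using \<delta>(2) by (simp_all add: configuration_def)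
  moreover have "max \<gamma>m \<gamma>h < \<delta>" using \<gamma>m \<gamma>h by simp
  moreover have "\<delta> \<in> closure_points f \<inter> cof_points" using \<delta>(1,3) by simp
  ultimately obtain \<alpha> where \<alpha>: "\<alpha> \<in> of_type A s" "max \<gamma>m \<gamma>h \<le> \<alpha>" "\<alpha> < \<delta>"
    using reflects_below[OF f(2)[rule_format, of \<delta> s]] by blast
  have \<alpha>_ge: "\<gamma>m \<le> \<alpha>" "\<gamma>h \<le> \<alpha>" using \<alpha>(2) by simp_all
  define x where "x = word \<alpha> (\<beta> 0) (trace \<alpha> \<delta>)"
  have words: "word \<alpha> (\<beta> j) (trace \<alpha> (\<beta> j)) = word \<alpha> (\<beta> j) (trace \<delta> (\<beta> j)) @ x" if j: "j \<le> M" for j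
  proof -
    have "\<gamma> j \<le> \<alpha>" using \<gamma>m(2)[OF j] \<alpha>_ge(1) by order
    then have "trace \<alpha> (\<beta> j) = trace \<delta> (\<beta> j) @ trace \<alpha> \<delta>" using \<gamma>(2)[OF j] \<alpha>(3) by simp
    moreover have "word \<alpha> (\<beta> j) (trace \<alpha> \<delta>) = x" unfolding x_def
    proof (rule word_cong[OF refl])
      fix bm assume bm: "bm \<in> set (trace \<alpha> \<delta>)"
      have "snd bm < \<delta>" using trace_le[OF bm] \<alpha>(3) by simp
      moreover have "\<gamma>m \<le> snd bm" using \<gamma>h(2) \<alpha>_ge(2) \<alpha>(3) bm by simp
      then have "\<gamma> j \<le> snd bm" using \<gamma>m(2)[OF j] by order
      ultimately show "rho (snd bm) (\<beta> j) = rho (snd bm) (\<beta> 0)" using \<gamma>(3)[OF j] by simp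
    qed
    ultimately show ?thesis by (simp add: word_append)
  qed
  \<comment> \<open>As j is at least 1, the word above \<delta> ends in True, hence
    \<open>rises True x\<close> in the offset; moreover \<open>r < r + j\<close>, so the rise of
    index r belongs to the part above \<delta>.\<close>
  obtain j where j: "1 \<le> j" "j \<le> M" "valuation (r + length (rises True x) + j) = r"
    using M[rule_format, of "r + length (rises True x)"] by (elim exE conjE)
  define w where "w = word \<alpha> (\<beta> j) (trace \<delta> (\<beta> j))"
  have w: "length (rises False w) = r + j" "final_bit False w" "col (rises False w ! r) = z"
    using \<beta>(3)[OF j(2) \<alpha>(1)] j(1) by (auto simp: good_word_def Let_def w_def)
  have "rises False (word \<alpha> (\<beta> j) (trace \<alpha> (\<beta> j))) = rises False w @ rises True x"
    using w(2) by (simp add: words[OF j(2)] w_def[symmetric] rises_append)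
  then have "colour col \<alpha> (\<beta> j) = col ((rises False w @ rises True x) ! valuation (r + length (rises True x) + j))"
    using w(1) by (simp add: colour_def add_ac)
  also have "\<dots> = z" using w j by (simp add: nth_append)
  finally have "colour col \<alpha> (\<beta> j) = z" .
  moreover have "\<alpha> < \<beta> j" using \<alpha>(3) \<beta>(2)[OF j(2)] by simp
  moreover have "\<alpha> \<in> A" using \<alpha>(1) of_type_subset by blast
  ultimately show ?thesis using \<beta>(1)[OF j(2)] by blast
qed

section \<open>From rectangles to clubs\<close>

lemma unbounded_tail: "unbounded A \<Longrightarrow> \<gamma> \<in> K \<Longrightarrow> unbounded {\<alpha>\<in>A. \<gamma> < \<alpha>}"
  unfolding unbounded_def
proof (elim conjE, intro conjI ballI)
  fix \<zeta> assume A: "A \<subseteq> K" "\<forall>\<gamma>\<in>K. \<exists>\<alpha>\<in>A. \<gamma> < \<alpha>" and "\<gamma> \<in> K" "\<zeta> \<in> K"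
  then have "max \<gamma> \<zeta> \<in> K" by (simp add: max_def)
  then show "\<exists>\<alpha>\<in>{\<alpha>\<in>A. \<gamma> < \<alpha>}. \<zeta> < \<alpha>" using A(2) by (metis (no_types, lifting) max_less_iff_conj mem_Collect_eq)
qed auto

text \<open>If \<open>\<beta>\<^sub>\<delta>\<close> is a counterexample for \<open>\<delta>\<close>, thin out \<open>A\<close> so that it misses every interval
  \<open>[\<delta>, \<beta>\<^sub>\<delta>]\<close> for \<open>\<delta>\<close> in a club; then no element of \<open>A\<close> below \<open>\<beta>\<^sub>\<delta>\<close> has the colour \<open>z\<close> with \<open>\<beta>\<^sub>\<delta>\<close>.\<close>

lemma colour_below:
  assumes A: "unbounded A" and T: "stationary {\<delta>\<in>cof_points. col \<delta> = z}"
  shows "\<exists>\<delta>\<in>K. \<forall>\<beta>\<in>K. \<delta> \<le> \<beta> \<longrightarrow> (\<exists>\<alpha>\<in>A. \<alpha> < \<delta> \<and> colour col \<alpha> \<beta> = z)"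
proof (rule ccontr)
  assume "\<not> ?thesis"
  then have "\<forall>\<delta>\<in>K. \<exists>\<beta>. \<beta> \<in> K \<and> \<delta> \<le> \<beta> \<and> (\<forall>\<alpha>\<in>A. \<alpha> < \<delta> \<longrightarrow> colour col \<alpha> \<beta> \<noteq> z)" by blast
  then obtain b where b: "\<And>\<delta>. \<delta> \<in> K \<Longrightarrow> b \<delta> \<in> K" "\<And>\<delta>. \<delta> \<in> K \<Longrightarrow> \<delta> \<le> b \<delta>"
      "\<And>\<delta> \<alpha>. \<delta> \<in> K \<Longrightarrow> \<alpha> \<in> A \<Longrightarrow> \<alpha> < \<delta> \<Longrightarrow> colour col \<alpha> (b \<delta>) \<noteq> z" by metis
  have "\<exists>\<alpha>. \<alpha> \<in> A \<and> b \<delta> < \<alpha>" if "\<delta> \<in> K" for \<delta> using unboundedD[OF A b(1)[OF that]] by blast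
  then obtain a where a: "\<And>\<delta>. \<delta> \<in> K \<Longrightarrow> a \<delta> \<in> A" "\<And>\<delta>. \<delta> \<in> K \<Longrightarrow> b \<delta> < a \<delta>" by metis
  have aK: "a ` K \<subseteq> K" using a(1) unbounded_K[OF A] by auto
  \<comment> \<open>For closure points \<delta> of \<open>a\<close>, the intervals from \<delta> to
    \<open>a \<delta>\<close> contain \<open>b \<delta>\<close> and are pairwise disjoint.\<close>
  have closure_points_ex: "\<exists>\<delta>\<in>closure_points a. \<gamma> < \<delta>" if "\<gamma> \<in> K" for \<gamma> using closure_points_S0_unbounded[OF aK that] by blast
  have unb_a: "unbounded (a ` closure_points a)" and unb_b: "unbounded (b ` closure_points a)"
    unfolding unbounded_def
  proof (safe)
    fix \<gamma> assume "\<gamma> \<in> K"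
    then obtain \<delta> where \<delta>: "\<delta> \<in> closure_points a" "\<gamma> < \<delta>" using closure_points_ex by blast
    note dK = closure_points_K[OF \<delta>(1)]
    have "\<gamma> < b \<delta>" "\<gamma> < a \<delta>" using \<delta>(2) b(2)[OF dK] a(2)[OF dK] by order+
    then show "\<exists>\<alpha>\<in>a ` closure_points a. \<gamma> < \<alpha>" "\<exists>\<alpha>\<in>b ` closure_points a. \<gamma> < \<alpha>" using \<delta>(1) by blast+
  qed (use aK b(1) closure_points_K in auto)
  obtain \<delta> \<delta>' where d: "\<delta> \<in> closure_points a" "\<delta>' \<in> closure_points a" "a \<delta> < b \<delta>'" "colour col (a \<delta>) (b \<delta>') = z"
    using rectangular[OF unb_a unb_b T] by blast
  note dK = closure_points_K[OF d(1)] closure_points_K[OF d(2)]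
  have "\<not> \<delta> < \<delta>'" using closure_points_closed[OF d(2)] b(3)[OF dK(2) a(1)[OF dK(1)]] d(4) by blast
  moreover have "\<not> \<delta>' < \<delta>"
  proof
    assume "\<delta>' < \<delta>"
    then have "a \<delta>' < \<delta>" by (rule closure_points_closed[OF d(1)])
    then show False using d(3) a(2)[OF dK(1)] a(2)[OF dK(2)] b(2)[OF dK(1)] by order
  qed
  moreover have "\<delta> \<noteq> \<delta>'" using d(3) a(2)[OF dK(1)] by auto
  ultimately show False by order
qed

text \<open>At a suitable \<delta> of cofinality \<lambda> the \<alpha> of colour z are cofinal in
  \<delta>, hence not few, whereas those with \<open>rho \<alpha> \<beta> \<le> \<nu>\<close> form a
  small set.\<close>

lemma colour_rho_below:
  assumes A: "unbounded A" and T: "stationary {\<delta>\<in>cof_points. col \<delta> = z}"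
  shows "\<exists>\<delta>\<in>K. \<forall>\<beta>\<in>K. \<delta> \<le> \<beta> \<longrightarrow> (\<forall>\<nu>\<in>\<Lambda>. \<exists>\<alpha>\<in>A. \<alpha> < \<delta> \<and> colour col \<alpha> \<beta> = z \<and> \<nu> < rho \<alpha> \<beta>)"
proof -
  have "\<exists>\<delta>. \<delta> \<in> K \<and> (\<forall>\<beta>\<in>K. \<delta> \<le> \<beta> \<longrightarrow> (\<exists>\<alpha>\<in>{\<alpha>\<in>A. \<zeta> < \<alpha>}. \<alpha> < \<delta> \<and> colour col \<alpha> \<beta> = z))" if "\<zeta> \<in> K" for \<zeta>
    using colour_below[OF unbounded_tail[OF A that] T] unfolding Bex_def .
  then have "\<forall>\<zeta>\<in>K. \<exists>\<delta>. \<delta> \<in> K \<and> (\<forall>\<beta>\<in>K. \<delta> \<le> \<beta> \<longrightarrow> (\<exists>\<alpha>\<in>{\<alpha>\<in>A. \<zeta> < \<alpha>}. \<alpha> < \<delta> \<and> colour col \<alpha> \<beta> = z))"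
    by (rule ballI)
  from bchoice[OF this] obtain f where
    f: "\<forall>\<zeta>\<in>K. f \<zeta> \<in> K \<and> (\<forall>\<beta>\<in>K. f \<zeta> \<le> \<beta> \<longrightarrow> (\<exists>\<alpha>\<in>{\<alpha>\<in>A. \<zeta> < \<alpha>}. \<alpha> < f \<zeta> \<and> colour col \<alpha> \<beta> = z))"
    by (elim exE)
  have "f ` K \<subseteq> K" using f by (intro image_subsetI) simp
  then obtain \<delta> where \<delta>: "\<delta> \<in> closure_points f" "\<delta> \<in> cof_points" using closure_points_S0_unbounded K_ex by blast
  have "\<exists>\<alpha>\<in>A. \<alpha> < \<delta> \<and> colour col \<alpha> \<beta> = z \<and> \<nu> < rho \<alpha> \<beta>" if \<beta>: "\<beta> \<in> K" "\<delta> \<le> \<beta>" and \<nu>: "\<nu> \<in> \<Lambda>" for \<beta> \<nu>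
  proof (rule ccontr)
    define X where "X = {\<alpha>\<in>A. \<alpha> < \<delta> \<and> colour col \<alpha> \<beta> = z}"
    assume "\<not> ?thesis"
    then have "X \<subseteq> {\<alpha>. \<alpha> < \<beta> \<and> rho \<alpha> \<beta> \<le> \<nu>}" using \<beta>(2) by (auto simp: X_def not_less)
    then have "small X" by (rule small_mono[OF rho_small[OF \<beta>(1) \<nu>]])
    then obtain \<zeta> where \<zeta>: "\<zeta> < \<delta>" "\<forall>x\<in>X. x < \<zeta>" using cof_points_small[OF \<delta>(2), of X] by (auto simp: X_def)
    have \<zeta>K: "\<zeta> \<in> K" using K_down[OF closure_points_K[OF \<delta>(1)], of \<zeta>] \<zeta>(1) by simp
    have f\<delta>: "f \<zeta> < \<delta>" by (rule closure_points_closed[OF \<delta>(1) \<zeta>(1)])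
    then have "f \<zeta> \<le> \<beta>" using \<beta>(2) by order
    then obtain \<alpha> where \<alpha>: "\<alpha> \<in> A" "\<zeta> < \<alpha>" "\<alpha> < f \<zeta>" "colour col \<alpha> \<beta> = z"
      using bspec[OF f \<zeta>K] \<beta>(1) by auto
    then have "\<alpha> \<in> X" using f\<delta> by (auto simp: X_def)
    then show False using \<zeta>(2) \<alpha>(2) by auto
  qed
  then show ?thesis using closure_points_K[OF \<delta>(1)] by blast
qed

text \<open>For each tail of A and each colour, \<open>colour_rho_below\<close> gives one point. A
  \<delta> closed under these choices inherits the property whatever its cofinality: the \<alpha>
  found below the chosen point is below \<delta>, and every \<beta> from \<delta> on is past the
  chosen point.\<close>

lemma strong_colouring:
  "\<exists>c. (\<forall>\<alpha> \<beta>. c \<alpha> \<beta> \<in> K \<times> K) \<and>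
    (\<forall>A. unbounded A \<longrightarrow> (\<exists>f. f ` K \<subseteq> K \<and> (\<forall>\<delta>\<in>closure_points f. \<forall>\<beta>\<in>K. \<delta> \<le> \<beta> \<longrightarrow> (\<forall>\<xi>0<\<delta>. \<forall>\<xi>1<\<delta>. \<forall>\<nu>\<in>\<Lambda>. \<forall>\<gamma><\<delta>.
       \<exists>\<alpha>\<in>A. \<gamma> \<le> \<alpha> \<and> \<alpha> < \<delta> \<and> c \<alpha> \<beta> = (\<xi>0, \<xi>1) \<and> \<nu> < rho \<alpha> \<beta>))))"
proof -
  obtain col where col: "\<And>\<delta>. col \<delta> \<in> K \<times> K" "\<And>z. z \<in> K \<times> K \<Longrightarrow> stationary {\<delta>\<in>cof_points. col \<delta> = z}"
    using ulam by blast
  show ?thesis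
  proof (intro exI[of _ "colour col"] conjI allI impI)
    show "colour col \<alpha> \<beta> \<in> K \<times> K" for \<alpha> \<beta> using col(1) by (simp add: colour_def Let_def)
    fix A assume A: "unbounded A"
    define P where "P \<gamma> z \<delta> \<longleftrightarrow> \<delta> \<in> K \<and> (\<forall>\<beta>\<in>K. \<delta> \<le> \<beta> \<longrightarrow>
      (\<forall>\<nu>\<in>\<Lambda>. \<exists>\<alpha>\<in>{\<alpha>\<in>A. \<gamma> < \<alpha>}. \<alpha> < \<delta> \<and> colour col \<alpha> \<beta> = z \<and> \<nu> < rho \<alpha> \<beta>))" for \<gamma> z \<delta>
    obtain k where k: "k \<in> K" using K_ex by blast
    have P_ex: "\<exists>\<delta>. P \<gamma> z \<delta>" if "\<gamma> \<in> K" "z \<in> K \<times> K" for \<gamma> z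
      using colour_rho_below[OF unbounded_tail[OF A that(1)] col(2)[OF that(2)]] unfolding P_def Bex_def[of K] .
    have "\<exists>\<delta>. \<delta> \<in> K \<and> (fst x \<in> K \<longrightarrow> snd x \<in> K \<times> K \<longrightarrow> P (fst x) (snd x) \<delta>)" for x
    proof (cases "fst x \<in> K \<and> snd x \<in> K \<times> K")
      case True
      obtain \<delta> where "P (fst x) (snd x) \<delta>"
        using P_ex[OF conjunct1[OF True] conjunct2[OF True]] by (elim exE)
      moreover from this have "\<delta> \<in> K" by (simp add: P_def)
      ultimately show ?thesis by (intro exI[of _ \<delta>]) simp
    next
      case False
      show ?thesis by (rule exI[of _ k]) (use k False in simp)
    qed
    then have "\<forall>x. \<exists>\<delta>. \<delta> \<in> K \<and> (fst x \<in> K \<longrightarrow> snd x \<in> K \<times> K \<longrightarrow> P (fst x) (snd x) \<delta>)"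
      by (rule allI)
    then obtain d where d0: "\<forall>x. d x \<in> K \<and> (fst x \<in> K \<longrightarrow> snd x \<in> K \<times> K \<longrightarrow> P (fst x) (snd x) (d x))"
      unfolding choice_iff by (elim exE)
    have dK: "(\<lambda>_. d x) ` K \<subseteq> K" for x using spec[OF d0, of x] by (intro image_subsetI) (elim conjE)
    have d: "P \<gamma> z (d (\<gamma>, z))" if "\<gamma> \<in> K" "z \<in> K \<times> K" for \<gamma> z
      using spec[OF d0, of "(\<gamma>, z)"] that by (simp only: fst_conv snd_conv simp_thms)
    \<comment> \<open>Indices are triples: a lower bound for \<alpha> and the two entries of the
      colour. A closure point of the constant function with value \<open>d x\<close> is just a limit
      above \<open>d x\<close>.\<close>
    define F where "F \<zeta> = {..<\<zeta>} \<times> {..<\<zeta>} \<times> {..<\<zeta>}" for \<zeta> :: 'k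
    have F: "medium (F \<zeta>)" if "\<zeta> \<in> K" for \<zeta> unfolding F_def by (intro medium_Times K_segment that)
    have F_mono: "F \<zeta> \<subseteq> F \<zeta>'" if "\<zeta> \<le> \<zeta>'" for \<zeta> \<zeta>' using that by (auto simp: F_def intro: order_less_le_trans)
    have "\<exists>f. f ` K \<subseteq> K \<and> (\<forall>\<delta>\<in>closure_points f. \<forall>\<zeta><\<delta>. \<forall>x\<in>F \<zeta>. \<delta> \<in> closure_points (\<lambda>_. d x))"
      by (rule diagonal) (erule F | erule F_mono | rule dK)+
    then obtain f where f: "f ` K \<subseteq> K" "\<forall>\<delta>\<in>closure_points f. \<forall>\<zeta><\<delta>. \<forall>x\<in>F \<zeta>. \<delta> \<in> closure_points (\<lambda>_. d x)" by (elim exE conjE)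
    show "\<exists>f. f ` K \<subseteq> K \<and> (\<forall>\<delta>\<in>closure_points f. \<forall>\<beta>\<in>K. \<delta> \<le> \<beta> \<longrightarrow> (\<forall>\<xi>0<\<delta>. \<forall>\<xi>1<\<delta>. \<forall>\<nu>\<in>\<Lambda>. \<forall>\<gamma><\<delta>.
       \<exists>\<alpha>\<in>A. \<gamma> \<le> \<alpha> \<and> \<alpha> < \<delta> \<and> colour col \<alpha> \<beta> = (\<xi>0, \<xi>1) \<and> \<nu> < rho \<alpha> \<beta>))"
    proof (intro exI[of _ f] conjI f(1) ballI allI impI)
      fix \<delta> \<beta> \<xi>0 \<xi>1 \<nu> \<gamma>
      assume \<delta>: "\<delta> \<in> closure_points f" and \<beta>: "\<beta> \<in> K" "\<delta> \<le> \<beta>" and less: "\<xi>0 < \<delta>" "\<xi>1 < \<delta>" "\<gamma> < \<delta>" and \<nu>: "\<nu> \<in> \<Lambda>"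
      define m where "m = max \<gamma> (max \<xi>0 \<xi>1)"
      have "m < \<delta>" using less by (simp add: m_def)
      then obtain \<zeta> where \<zeta>: "m < \<zeta>" "\<zeta> < \<delta>" using closure_points_limit[OF \<delta>] by blast
      then have "(\<gamma>, \<xi>0, \<xi>1) \<in> F \<zeta>" by (auto simp: F_def m_def)
      then have cl: "\<delta> \<in> closure_points (\<lambda>_. d (\<gamma>, \<xi>0, \<xi>1))" using f(2) \<delta> \<zeta>(2) by blast
      have d\<delta>: "d (\<gamma>, \<xi>0, \<xi>1) < \<delta>" by (rule closure_points_closed[OF cl less(3)])
      have "\<gamma> \<in> K" "\<xi>0 \<in> K" "\<xi>1 \<in> K" using less K_down[OF closure_points_K[OF \<delta>]] by (auto simp: order_less_imp_le)
      then have "P \<gamma> (\<xi>0, \<xi>1) (d (\<gamma>, \<xi>0, \<xi>1))" using d by simp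
      moreover have "d (\<gamma>, \<xi>0, \<xi>1) \<le> \<beta>" using d\<delta> \<beta>(2) by order
      ultimately obtain \<alpha> where \<alpha>: "\<alpha> \<in> A" "\<gamma> < \<alpha>" "\<alpha> < d (\<gamma>, \<xi>0, \<xi>1)"
          "colour col \<alpha> \<beta> = (\<xi>0, \<xi>1)" "\<nu> < rho \<alpha> \<beta>"
        unfolding P_def using \<beta>(1) \<nu> by auto
      have "\<gamma> \<le> \<alpha>" "\<alpha> < \<delta>" using \<alpha>(2,3) d\<delta> by order+
      then show "\<exists>\<alpha>\<in>A. \<gamma> \<le> \<alpha> \<and> \<alpha> < \<delta> \<and> colour col \<alpha> \<beta> = (\<xi>0, \<xi>1) \<and> \<nu> < rho \<alpha> \<beta>"
        using \<alpha> by blast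
    qed
  qed
qed

lemma closure_points_unbounded: "f ` K \<subseteq> K \<Longrightarrow> \<gamma> \<in> K \<Longrightarrow> \<exists>\<delta>\<in>closure_points f. \<gamma> < \<delta>"
  using closure_points_S0_unbounded by blast

lemma closure_points_limit_closed:
  assumes "\<delta> \<in> K" "\<exists>\<zeta>. \<zeta> < \<delta>" "\<And>\<alpha>. \<alpha> < \<delta> \<Longrightarrow> \<exists>\<beta>\<in>closure_points f. \<alpha> < \<beta> \<and> \<beta> < \<delta>"
  shows "\<delta> \<in> closure_points f"
proof -
  obtain \<zeta> where \<zeta>: "\<zeta> < \<delta>" using assms(2) by blast
  show ?thesis
  proof (rule closure_pointsI[OF assms(1) \<zeta>])
    fix \<alpha> assume "\<alpha> < \<delta>"
    then obtain \<beta> where \<beta>: "\<beta> \<in> closure_points f" "\<alpha> < \<beta>" "\<beta> < \<delta>" using assms(3) by blast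
    then show "\<exists>\<eta><\<delta>. \<alpha> < \<eta>" by blast
    have "f \<alpha> < \<beta>" by (rule closure_points_closed[OF \<beta>(1,2)])
    then show "f \<alpha> < \<delta>" using \<beta>(3) by order
  qed
qed

end

subsection \<open>Transfer to arbitrary cardinals\<close>

text \<open>A copy of the type can carry the well-order \<open>|UNIV|\<close> as a class instance,
  which gives access to \<open><\<close>, \<open>LEAST\<close> and induction; as a cardinal order it
  is long enough for every \<open>Card_order\<close> on the type.\<close>

typedef 'a wo = "UNIV :: 'a set"
  morphisms of_wo to_wo ..

instantiation wo :: (type) wellorder
begin

definition less_eq_wo :: "'a wo \<Rightarrow> 'a wo \<Rightarrow> bool" where
  "x \<le> y \<longleftrightarrow> (of_wo x, of_wo y) \<in> |UNIV|"

definition less_wo :: "'a wo \<Rightarrow> 'a wo \<Rightarrow> bool" where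
  "x < y \<longleftrightarrow> x \<le> y \<and> x \<noteq> (y :: 'a wo)"

instance
proof
  have wo: "Well_order |UNIV :: 'a set|" by (rule card_of_Well_order)
  then have lin: "refl_on UNIV |UNIV :: 'a set|" "trans |UNIV :: 'a set|" "antisym |UNIV :: 'a set|"
      "total_on UNIV |UNIV :: 'a set|" and wf: "wf ( |UNIV :: 'a set| - Id)"
    by (simp_all add: well_order_on_def linear_order_on_def partial_order_on_def preorder_on_def Field_card_of)
  fix x y z :: "'a wo"
  show refl: "x \<le> x" for x :: "'a wo" using lin(1) by (simp add: less_eq_wo_def refl_on_def)
  show "x \<le> y \<Longrightarrow> y \<le> z \<Longrightarrow> x \<le> z" using lin(2) unfolding less_eq_wo_def by (rule transD)
  show anti: "x \<le> y \<Longrightarrow> y \<le> x \<Longrightarrow> x = y"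
    using lin(3) unfolding less_eq_wo_def by (metis antisymD of_wo_inject)
  show "(x < y) = (x \<le> y \<and> \<not> y \<le> x)"
    unfolding less_wo_def using anti refl by blast
  show "x \<le> y \<or> y \<le> x" using lin(1,4) unfolding less_eq_wo_def total_on_def refl_on_def by (metis UNIV_I)
  fix P :: "'a wo \<Rightarrow> bool" and a
  assume step: "\<And>x. (\<And>y. y < x \<Longrightarrow> P y) \<Longrightarrow> P x"
  have "{(x, y). x < (y :: 'a wo)} \<subseteq> inv_image ( |UNIV| - Id) of_wo"
    by (auto simp: less_wo_def less_eq_wo_def of_wo_inject)
  then have "wf {(x, y). x < (y :: 'a wo)}" using wf_inv_image[OF wf] wf_subset by blast
  then show "P a" by (induction a rule: wf_induct_rule) (use step in simp)
qed

end

text \<open>A \<open>Card_order\<close> has the least length for its field, so it is no longer than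
  \<open>|UNIV|\<close> and embeds onto an initial segment; an arbitrary well-order of the field
  could be too long.\<close>

lemma wo_embedding:
  fixes r :: "'a rel"
  assumes r: "Card_order r"
  shows "\<exists>f :: 'a \<Rightarrow> 'a wo. inj_on f (Field r) \<and>
    (\<forall>x\<in>Field r. \<forall>y\<in>Field r. (x, y) \<in> r \<longleftrightarrow> f x \<le> f y) \<and>
    (\<forall>x\<in>Field r. \<forall>y\<le>f x. y \<in> f ` Field r)"
proof -
  have "r =o |Field r|" using card_of_Field_ordIso[OF r] by (rule ordIso_symmetric)
  moreover have "|Field r| \<le>o |UNIV :: 'a set|" by (rule card_of_mono1) simp
  ultimately have "r \<le>o |UNIV :: 'a set|" by (rule ordIso_ordLeq_trans)
  then obtain h where h: "embed r |UNIV :: 'a set| h" and wo: "Well_order r" "Well_order |UNIV :: 'a set|"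
    unfolding ordLeq_def by auto
  have comp: "compat r |UNIV| h" and inj: "inj_on h (Field r)" and ofi: "wo_rel.ofilter |UNIV| (h ` Field r)"
    using h embed_iff_compat_inj_on_ofilter[OF wo] by auto
  define f where "f x = to_wo (h x)" for x
  have of_f: "of_wo (f x) = h x" for x by (simp add: f_def to_wo_inverse)
  have inj_f: "inj_on f (Field r)" using inj by (auto simp: inj_on_def f_def to_wo_inject)
  have le: "f x \<le> f y" if "(x, y) \<in> r" for x y
    using comp that by (auto simp: less_eq_wo_def of_f compat_def)
  moreover have "(x, y) \<in> r" if "x \<in> Field r" "y \<in> Field r" "f x \<le> f y" for x y
  proof (rule ccontr)
    assume not: "(x, y) \<notin> r"
    then have "(y, x) \<in> r" using wo(1) that(1,2) by (metis wo_rel.intro wo_rel.TOTALS)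
    then have "f x = f y" using le that(3) by (meson order_antisym)
    then have "x = y" using inj_f that by (auto simp: inj_on_def)
    then show False using not \<open>(y, x) \<in> r\<close> by simp
  qed
  moreover have "y \<in> f ` Field r" if "x \<in> Field r" "y \<le> f x" for x y
  proof -
    have "of_wo y \<in> under |UNIV| (h x)" using that(2) by (simp add: less_eq_wo_def of_f under_def)
    then have "of_wo y \<in> h ` Field r"
      using ofi that(1) wo(2) by (auto simp: wo_rel.ofilter_def wo_rel_def)
    then obtain x' where "x' \<in> Field r" "of_wo y = h x'" by blast
    then have "f x' = y" by (metis of_f of_wo_inject)
    then show ?thesis using \<open>x' \<in> Field r\<close> by blast
  qed
  ultimately show ?thesis using inj_f by (intro exI[of _ f]) blast
qed

locale coded_card =
  fixes r :: "'a rel" and f :: "'a \<Rightarrow> 'b :: wellorder"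
  assumes card: "Card_order r" and inj: "inj_on f (Field r)"
    and iff: "x \<in> Field r \<Longrightarrow> y \<in> Field r \<Longrightarrow> (x, y) \<in> r \<longleftrightarrow> f x \<le> f y"
    and down: "x \<in> Field r \<Longrightarrow> z \<le> f x \<Longrightarrow> z \<in> f ` Field r"
begin

lemma eq_iff: "x \<in> Field r \<Longrightarrow> y \<in> Field r \<Longrightarrow> f x = f y \<longleftrightarrow> x = y"
  using inj by (auto simp: inj_on_def)

lemma underS_iff: "y \<in> Field r \<Longrightarrow> x \<in> underS r y \<longleftrightarrow> x \<in> Field r \<and> f x < f y"
  using iff[of x y] eq_iff[of x y] by (auto simp: underS_def less_le FieldI1)

lemma image_card: "|f ` X| =o |X|" if "X \<subseteq> Field r"
  by (rule ordIso_symmetric[OF card_of_ordIsoI[OF inj_on_imp_bij_betw[OF inj_on_subset[OF inj that]]]])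

lemma Field_card: "|f ` Field r| =o r"
  by (rule ordIso_transitive[OF image_card card_of_Field_ordIso[OF card]]) simp

lemma down_image: "x \<in> f ` Field r \<Longrightarrow> y \<le> x \<Longrightarrow> y \<in> f ` Field r"
  using down by blast

lemma segment: "x \<in> f ` Field r \<Longrightarrow> |{..<x}| <o r"
proof -
  assume "x \<in> f ` Field r"
  then obtain y where y: "y \<in> Field r" "x = f y" by blast
  have "{..<x} \<subseteq> f ` underS r y"
  proof
    fix z assume z: "z \<in> {..<x}"
    then have "z \<in> f ` Field r" using down[OF y(1), of z] y(2) by simp
    then obtain y' where "y' \<in> Field r" "z = f y'" by blast
    then show "z \<in> f ` underS r y" using z y underS_iff[OF y(1), of y'] by auto
  qed
  then have "|{..<x}| \<le>o |f ` underS r y|" by (rule card_of_mono1)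
  also have "|f ` underS r y| \<le>o |underS r y|" by (rule card_of_image)
  also have "|underS r y| <o r" by (rule card_of_underS[OF card y(1)])
  finally show ?thesis .
qed

text \<open>\<open>regularCard\<close> speaks of cofinal sets: if X had no strict upper bound, its
  preimage Y would be cofinal and hence as large as r. Cofinality asks for strictly larger elements,
  so the argument first moves from a to some b above it.\<close>

lemma bounded:
  assumes "regularCard r" "infinite (Field r)" "X \<subseteq> f ` Field r" "|X| <o r"
  shows "\<exists>\<beta>\<in>f ` Field r. \<forall>x\<in>X. x < \<beta>"
proof (rule ccontr)
  assume contra: "\<not> ?thesis"
  obtain Y where Y: "Y \<subseteq> Field r" "X = f ` Y" using assms(3) by (auto simp: subset_image_iff)
  have "\<exists>b\<in>Y. a \<noteq> b \<and> (a, b) \<in> r" if a: "a \<in> Field r" for a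
  proof -
    obtain b where b: "b \<in> Field r" "a \<noteq> b" "(a, b) \<in> r"
      using infinite_Card_order_limit[OF card assms(2) a] by blast
    then have ab: "f a < f b" using iff[OF a b(1)] eq_iff[OF a b(1)] by (simp add: less_le)
    have "\<not> (\<forall>x\<in>X. x < f b)" using contra b(1) by blast
    then obtain c where c: "c \<in> Y" "f b \<le> f c" using Y(2) by (auto simp: not_less)
    then have cF: "c \<in> Field r" and ac: "f a < f c" using Y(1) ab by (blast, order)
    have "(a, c) \<in> r" using iff[OF a cF] ac by simp
    moreover have "a \<noteq> c" using ac by blast
    ultimately show ?thesis using c(1) by blast
  qed
  then have "cofinal Y r" by (simp add: cofinal_def)
  then have "|Y| =o r" using assms(1) Y(1) by (simp add: regularCard_def)
  then have "|X| =o r" using image_card[OF Y(1)] ordIso_transitive unfolding Y(2) by blast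
  then show False using assms(4) not_ordLess_ordIso by blast
qed

end

lemma coded_card_ex:
  fixes r :: "'a rel"
  assumes "Card_order r"
  shows "\<exists>f :: 'a \<Rightarrow> 'a wo. coded_card r f"
proof -
  obtain f :: "'a \<Rightarrow> 'a wo" where f: "inj_on f (Field r)"
    "\<forall>x\<in>Field r. \<forall>y\<in>Field r. (x, y) \<in> r \<longleftrightarrow> f x \<le> f y"
    "\<forall>x\<in>Field r. \<forall>y\<le>f x. y \<in> f ` Field r"
    using wo_embedding[OF assms] by (elim exE conjE)
  then have "coded_card r f" using assms by (intro coded_card.intro) simp_all
  then show ?thesis by blast
qed

lemma ordLess_cardSuc_iff:
  assumes "Card_order \<kappa>" "|L| =o \<kappa>"
  shows "|X| <o cardSuc \<kappa> \<longleftrightarrow> |X| \<le>o |L|"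
  using cardSuc_ordLeq_ordLess[OF assms(1) card_of_Card_order, of X]
    ordLeq_ordIso_trans[OF _ assms(2), of "|X|"] ordLeq_ordIso_trans[OF _ ordIso_symmetric[OF assms(2)], of "|X|"]
  by blast

lemma succ_regular_coded:
  assumes \<kappa>: "Card_order \<kappa>" "infinite (Field \<kappa>)" "regularCard \<kappa>"
    and f: "coded_card (cardSuc \<kappa>) f" and g: "coded_card \<kappa> g"
  shows "succ_regular (f ` Field (cardSuc \<kappa>)) (g ` Field \<kappa>)"
proof -
  interpret f: coded_card "cardSuc \<kappa>" f by (rule f)
  interpret g: coded_card \<kappa> g by (rule g)
  let ?K = "f ` Field (cardSuc \<kappa>)" and ?L = "g ` Field \<kappa>"
  have L: "|?L| =o \<kappa>" by (rule g.Field_card)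
  have L': "\<kappa> =o |?L|" by (rule ordIso_symmetric[OF L])
  have inf: "infinite (Field (cardSuc \<kappa>))" using \<kappa> by (simp add: cardSuc_finite)
  have reg: "regularCard (cardSuc \<kappa>)" by (rule infinite_cardSuc_regularCard[OF \<kappa>(2,1)])
  note below = ordLess_cardSuc_iff[OF \<kappa>(1) L]
  show ?thesis
  proof
    show "infinite ?L" using \<kappa>(2) g.inj by (simp add: finite_image_iff)
    show "\<mu> \<in> ?L" if "\<nu> \<in> ?L" "\<mu> \<le> \<nu>" for \<mu> \<nu> using that by (rule g.down_image)
    show "|{..<\<nu>}| <o |?L|" if "\<nu> \<in> ?L" for \<nu> by (rule ordLess_ordIso_trans[OF g.segment[OF that] L'])
    show "\<exists>\<nu>\<in>?L. \<forall>y\<in>Y. y < \<nu>" if "Y \<subseteq> ?L" "|Y| <o |?L|" for Y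
      by (rule g.bounded[OF \<kappa>(3,2) that(1) ordLess_ordIso_trans[OF that(2) L]])
    show "\<alpha> \<in> ?K" if "\<beta> \<in> ?K" "\<alpha> \<le> \<beta>" for \<alpha> \<beta> using that by (rule f.down_image)
    show "|{..<\<beta>}| \<le>o |?L|" if "\<beta> \<in> ?K" for \<beta> using f.segment[OF that] unfolding below .
    show "\<exists>\<beta>\<in>?K. \<forall>x\<in>X. x < \<beta>" if "X \<subseteq> ?K" "|X| \<le>o |?L|" for X
      by (rule f.bounded[OF reg inf that(1)]) (use that(2) in \<open>unfold below\<close>)
    show "|?K| \<le>o |X|" if "X \<subseteq> ?K" "\<not> |X| \<le>o |?L|" for X
    proof -
      have "\<not> |X| <o cardSuc \<kappa>" using that(2) unfolding below .
      then have "cardSuc \<kappa> \<le>o |X|"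
        using not_ordLess_iff_ordLeq[OF cardSuc_Well_order[OF \<kappa>(1)] card_of_Well_order, of X] by simp
      then show ?thesis by (rule ordIso_ordLeq_trans[OF f.Field_card])
    qed
  qed
qed

theorem theorem4p3:
  fixes \<kappa> :: "'a rel"
  assumes "Card_order \<kappa>" and "infinite (Field \<kappa>)" and "regularCard \<kappa>"
  shows "\<exists>c e.
    c \<in> [Field (cardSuc \<kappa>)]\<^bsup>2\<^esup> \<rightarrow> Field (cardSuc \<kappa>) \<times> Field (cardSuc \<kappa>) \<and>
    e \<in> [Field (cardSuc \<kappa>)]\<^bsup>2\<^esup> \<rightarrow> Field \<kappa> \<and>
    subadditive (cardSuc \<kappa>) \<kappa> e \<and>
    (\<forall>A. A \<subseteq> Field (cardSuc \<kappa>) \<and> |A| =o cardSuc \<kappa> \<longrightarrow>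
      (\<exists>D. club_in (cardSuc \<kappa>) D \<and>
        (\<forall>\<delta>\<in>D.
         \<forall>\<beta>\<in>Field (cardSuc \<kappa>) - underS (cardSuc \<kappa>) \<delta>.
         \<forall>(\<xi>\<^sub>0, \<xi>\<^sub>1)\<in>underS (cardSuc \<kappa>) \<delta> \<times> underS (cardSuc \<kappa>) \<delta>.
         \<forall>i\<in>Field \<kappa>.
           cofinally_many_below (cardSuc \<kappa>) \<delta>
             (\<lambda>\<alpha>. \<alpha> \<in> A \<and> c {\<alpha>, \<beta>} = (\<xi>\<^sub>0, \<xi>\<^sub>1) \<and> i \<in> underS \<kappa> (e {\<alpha>, \<beta>})))))"
proof -
  let ?R = "cardSuc \<kappa>"
  obtain f :: "'a set \<Rightarrow> 'a set wo" where f: "coded_card ?R f"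
    using coded_card_ex[OF cardSuc_Card_order[OF assms(1)]] by blast
  obtain g :: "'a \<Rightarrow> 'a wo" where g: "coded_card \<kappa> g" using coded_card_ex[OF assms(1)] by blast
  interpret f: coded_card ?R f by (rule f)
  interpret g: coded_card \<kappa> g by (rule g)
  define K where "K = f ` Field ?R"
  define L where "L = g ` Field \<kappa>"
  interpret succ_regular K L unfolding K_def L_def by (rule succ_regular_coded[OF assms f g])
  obtain col where "\<forall>\<alpha> \<beta>. col \<alpha> \<beta> \<in> K \<times> K"
    and col_club: "\<forall>A. unbounded A \<longrightarrow> (\<exists>h. h ` K \<subseteq> K \<and> (\<forall>\<delta>\<in>closure_points h. \<forall>\<beta>\<in>K. \<delta> \<le> \<beta> \<longrightarrow> (\<forall>\<xi>0<\<delta>. \<forall>\<xi>1<\<delta>. \<forall>\<nu>\<in>L. \<forall>\<gamma><\<delta>.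
       \<exists>\<alpha>\<in>A. \<gamma> \<le> \<alpha> \<and> \<alpha> < \<delta> \<and> col \<alpha> \<beta> = (\<xi>0, \<xi>1) \<and> \<nu> < rho \<alpha> \<beta>)))"
    using strong_colouring by (elim exE conjE)
  then have col: "col \<alpha> \<beta> \<in> K \<times> K" for \<alpha> \<beta> by simp
  define f' where "f' = inv_into (Field ?R) f"
  define g' where "g' = inv_into (Field \<kappa>) g"
  have fK: "f x \<in> K" if "x \<in> Field ?R" for x using that by (simp add: K_def)
  have f': "f' x \<in> Field ?R" "f (f' x) = x" if "x \<in> K" for x
    using that by (simp_all add: f'_def K_def inv_into_into f_inv_into_f)
  have g': "g' x \<in> Field \<kappa>" "g (g' x) = x" if "x \<in> L" for x
    using that by (simp_all add: g'_def L_def inv_into_into f_inv_into_f)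
  have f'f: "f' (f x) = x" if "x \<in> Field ?R" for x
    using that f.inj by (simp add: f'_def inv_into_f_f)
  \<comment> \<open>On a two-element set, \<open>Min\<close> and \<open>Max\<close> of the image
    recover the pair in increasing order.\<close>
  define c where "c s = map_prod f' f' (col (Min (f ` s)) (Max (f ` s)))" for s
  define d where "d s = g' (rho (Min (f ` s)) (Max (f ` s)))" for s
  have c: "c {x, y} = map_prod f' f' (col (f x) (f y))" and d: "d {x, y} = g' (rho (f x) (f y))"
    if "f x < f y" for x y using that by (simp_all add: c_def d_def min_def max_def order_less_imp_le)
  have d_Field: "d {x, y} \<in> Field \<kappa>" and g_d: "g (d {x, y}) = rho (f x) (f y)"
    if "f x < f y" "y \<in> Field ?R" for x y
    using g'[OF rho_\<Lambda>[OF fK[OF that(2)] that(1)]] d[OF that(1)] by simp_all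
  have pairs: "\<exists>x y. s = {x, y} \<and> f x < f y \<and> x \<in> Field ?R \<and> y \<in> Field ?R"
    if s: "s \<in> [Field ?R]\<^bsup>2\<^esup>" for s
  proof -
    obtain x y where xy: "s = {x, y}" "x \<noteq> y" "x \<in> Field ?R" "y \<in> Field ?R"
      using s by (auto simp: nsets_def card_2_iff)
    then have "f x \<noteq> f y" using f.eq_iff by simp
    then consider "f x < f y" | "f y < f x" by (meson linorder_neqE)
    then show ?thesis using xy by cases (auto simp: insert_commute)
  qed
  have c_in: "c \<in> [Field ?R]\<^bsup>2\<^esup> \<rightarrow> Field ?R \<times> Field ?R"
  proof
    fix s
    show "c s \<in> Field ?R \<times> Field ?R"
      using col[of "Min (f ` s)" "Max (f ` s)"] f'(1) by (simp add: c_def mem_Times_iff)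
  qed
  have d_in: "d \<in> [Field ?R]\<^bsup>2\<^esup> \<rightarrow> Field \<kappa>"
  proof
    fix s assume "s \<in> [Field ?R]\<^bsup>2\<^esup>"
    from pairs[OF this] show "d s \<in> Field \<kappa>" using d_Field by blast
  qed
  have max2: "(x, wo_rel.max2 \<kappa> y z) \<in> \<kappa>"
    if "x \<in> Field \<kappa>" "y \<in> Field \<kappa>" "z \<in> Field \<kappa>" "g x \<le> max (g y) (g z)" for x y z
  proof -
    have "wo_rel \<kappa>" using assms(1) by (simp add: wo_rel_def card_order_on_well_order_on)
    then have "wo_rel.max2 \<kappa> y z = (if (y, z) \<in> \<kappa> then z else y)" by (simp add: wo_rel.max2_def)
    then show ?thesis using that g.iff[of y z] g.iff[of x y] g.iff[of x z] by (auto simp: max_def)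
  qed
  have sub: "subadditive ?R \<kappa> d"
    unfolding subadditive_def
  proof (intro ballI)
    fix \<gamma> \<beta> \<alpha> assume \<gamma>: "\<gamma> \<in> Field ?R" and "\<beta> \<in> underS ?R \<gamma>" "\<alpha> \<in> underS ?R \<beta>"
    then have \<beta>: "\<beta> \<in> Field ?R" "f \<beta> < f \<gamma>" and \<alpha>: "\<alpha> \<in> Field ?R" "f \<alpha> < f \<beta>"
      using f.underS_iff by auto
    have \<alpha>\<gamma>: "f \<alpha> < f \<gamma>" using \<alpha> \<beta> by order
    show "(d {\<alpha>, \<gamma>}, wo_rel.max2 \<kappa> (d {\<alpha>, \<beta>}) (d {\<beta>, \<gamma>})) \<in> \<kappa> \<and>
        (d {\<alpha>, \<beta>}, wo_rel.max2 \<kappa> (d {\<alpha>, \<gamma>}) (d {\<beta>, \<gamma>})) \<in> \<kappa>"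
      using rho_subadditive[OF fK[OF \<gamma>] \<alpha>(2) \<beta>(2)]
      by (intro conjI max2) (simp_all add: d_Field g_d \<alpha> \<beta> \<gamma> \<alpha>\<gamma>)
  qed
  have club: "\<exists>D. club_in ?R D \<and> (\<forall>\<delta>\<in>D. \<forall>\<beta>\<in>Field ?R - underS ?R \<delta>.
         \<forall>(\<xi>0, \<xi>1)\<in>underS ?R \<delta> \<times> underS ?R \<delta>. \<forall>i\<in>Field \<kappa>.
           cofinally_many_below ?R \<delta> (\<lambda>\<alpha>. \<alpha> \<in> A \<and> c {\<alpha>, \<beta>} = (\<xi>0, \<xi>1) \<and> i \<in> underS \<kappa> (d {\<alpha>, \<beta>})))"
    if A: "A \<subseteq> Field ?R" "|A| =o ?R" for A
  proof -
    have "f ` A \<subseteq> K" using A(1) by (auto simp: K_def)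
    moreover have "\<not> |f ` A| \<le>o |L|"
    proof
      assume "|f ` A| \<le>o |L|"
      then have "|f ` A| \<le>o \<kappa>" unfolding L_def using g.Field_card by (rule ordLeq_ordIso_trans)
      moreover have "?R =o |f ` A|"
        by (rule ordIso_symmetric[OF ordIso_transitive[OF f.image_card[OF A(1)] A(2)]])
      ultimately have "?R \<le>o \<kappa>" by (rule ordIso_ordLeq_trans[rotated])
      then show False using cardSuc_greater[OF assms(1)] not_ordLess_ordLeq by blast
    qed
    ultimately have "unbounded (f ` A)" by (simp add: unbounded_iff)
    from mp[OF spec[OF col_club] this] obtain h where h: "h ` K \<subseteq> K" and
      hit: "\<forall>\<delta>\<in>closure_points h. \<forall>\<beta>\<in>K. \<delta> \<le> \<beta> \<longrightarrow> (\<forall>\<xi>0<\<delta>. \<forall>\<xi>1<\<delta>. \<forall>\<nu>\<in>L. \<forall>\<gamma><\<delta>.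
       \<exists>\<alpha>\<in>f ` A. \<gamma> \<le> \<alpha> \<and> \<alpha> < \<delta> \<and> col \<alpha> \<beta> = (\<xi>0, \<xi>1) \<and> \<nu> < rho \<alpha> \<beta>)"
      by (elim exE conjE)
    define D where "D = {\<delta>\<in>Field ?R. f \<delta> \<in> closure_points h}"
    have "club_in ?R D" unfolding club_in_def
    proof (intro conjI ballI impI)
      show "D \<subseteq> Field ?R" by (auto simp: D_def)
      fix \<alpha> assume \<alpha>: "\<alpha> \<in> Field ?R"
      obtain \<delta> where \<delta>: "\<delta> \<in> closure_points h" "f \<alpha> < \<delta>" using closure_points_unbounded[OF h fK[OF \<alpha>]] by blast
      have "f' \<delta> \<in> D" using f'[OF closure_points_K[OF \<delta>(1)]] \<delta>(1) by (simp add: D_def)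
      moreover have "(\<alpha>, f' \<delta>) \<in> ?R" using f.iff[OF \<alpha>, of "f' \<delta>"] f'[OF closure_points_K[OF \<delta>(1)]] \<delta>(2) by simp
      ultimately show "\<exists>\<delta>\<in>D. (\<alpha>, \<delta>) \<in> ?R" by blast
    next
      fix \<delta> assume \<delta>: "\<delta> \<in> Field ?R"
        and lim: "underS ?R \<delta> \<noteq> {} \<and> (\<forall>\<alpha>\<in>underS ?R \<delta>. \<exists>\<beta>\<in>D \<inter> underS ?R \<delta>. \<alpha> \<in> underS ?R \<beta>)"
      have "f \<delta> \<in> closure_points h"
      proof (rule closure_points_limit_closed[OF fK[OF \<delta>]])
        show "\<exists>\<zeta>. \<zeta> < f \<delta>" using lim f.underS_iff[OF \<delta>] by blast
        fix \<alpha> assume \<alpha>: "\<alpha> < f \<delta>"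
        then have "\<alpha> \<in> K" using K_down[OF fK[OF \<delta>], of \<alpha>] by simp
        then have "f' \<alpha> \<in> underS ?R \<delta>" using f.underS_iff[OF \<delta>, of "f' \<alpha>"] f'[of \<alpha>] \<alpha> by simp
        then obtain \<beta> where \<beta>: "\<beta> \<in> D" "\<beta> \<in> underS ?R \<delta>" "f' \<alpha> \<in> underS ?R \<beta>" using lim by blast
        then have "f (f' \<alpha>) < f \<beta>" "f \<beta> < f \<delta>" "f \<beta> \<in> closure_points h"
          using f.underS_iff[of \<beta> "f' \<alpha>"] f.underS_iff[OF \<delta>, of \<beta>] by (auto simp: D_def)
        then show "\<exists>\<beta>\<in>closure_points h. \<alpha> < \<beta> \<and> \<beta> < f \<delta>" using f'(2)[OF \<open>\<alpha> \<in> K\<close>] by auto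
      qed
      then show "\<delta> \<in> D" using \<delta> by (simp add: D_def)
    qed
    moreover have "cofinally_many_below ?R \<delta> (\<lambda>\<alpha>. \<alpha> \<in> A \<and> c {\<alpha>, \<beta>} = (\<xi>0, \<xi>1) \<and> i \<in> underS \<kappa> (d {\<alpha>, \<beta>}))"
      if \<delta>D: "\<delta> \<in> D" and \<beta>: "\<beta> \<in> Field ?R" "\<beta> \<notin> underS ?R \<delta>"
        and \<xi>: "\<xi>0 \<in> underS ?R \<delta>" "\<xi>1 \<in> underS ?R \<delta>" and i: "i \<in> Field \<kappa>" for \<delta> \<beta> \<xi>0 \<xi>1 i
      unfolding cofinally_many_below_def
    proof
      have \<delta>: "\<delta> \<in> Field ?R" "f \<delta> \<in> closure_points h" using \<delta>D by (auto simp: D_def)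
      fix \<gamma> assume "\<gamma> \<in> underS ?R \<delta>"
      then have \<gamma>: "\<gamma> \<in> Field ?R" "f \<gamma> < f \<delta>" using f.underS_iff[OF \<delta>(1)] by auto
      have \<xi>': "\<xi>0 \<in> Field ?R" "f \<xi>0 < f \<delta>" "\<xi>1 \<in> Field ?R" "f \<xi>1 < f \<delta>"
        using \<xi> f.underS_iff[OF \<delta>(1)] by auto
      have \<delta>\<beta>: "f \<delta> \<le> f \<beta>" using \<beta> f.underS_iff[OF \<delta>(1), of \<beta>] by simp
      have "g i \<in> L" using i by (simp add: L_def)
      from hit[rule_format, OF \<delta>(2) fK[OF \<beta>(1)] \<delta>\<beta> \<xi>'(2,4) this \<gamma>(2)]
      obtain \<alpha> where \<alpha>: "\<alpha> \<in> A" "f \<gamma> \<le> f \<alpha>" "f \<alpha> < f \<delta>" "col (f \<alpha>) (f \<beta>) = (f \<xi>0, f \<xi>1)"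
        "g i < rho (f \<alpha>) (f \<beta>)" by blast
      have \<alpha>F: "\<alpha> \<in> Field ?R" using \<alpha>(1) A(1) by blast
      have \<alpha>\<beta>: "f \<alpha> < f \<beta>" using \<alpha>(3) \<delta>\<beta> by order
      have "\<alpha> \<in> underS ?R \<delta>" using f.underS_iff[OF \<delta>(1)] \<alpha>F \<alpha>(3) by simp
      moreover have "(\<gamma>, \<alpha>) \<in> ?R" using f.iff[OF \<gamma>(1) \<alpha>F] \<alpha>(2) by simp
      moreover have "c {\<alpha>, \<beta>} = (\<xi>0, \<xi>1)" using c[OF \<alpha>\<beta>] \<alpha>(4) f'f \<xi>' by simp
      moreover have "i \<in> underS \<kappa> (d {\<alpha>, \<beta>})"
        using g.underS_iff[OF d_Field[OF \<alpha>\<beta> \<beta>(1)]] i g_d[OF \<alpha>\<beta> \<beta>(1)] \<alpha>(5) by simp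
      ultimately show "\<exists>\<alpha>\<in>underS ?R \<delta>. (\<gamma>, \<alpha>) \<in> ?R \<and> \<alpha> \<in> A \<and> c {\<alpha>, \<beta>} = (\<xi>0, \<xi>1) \<and> i \<in> underS \<kappa> (d {\<alpha>, \<beta>})"
        using \<alpha>(1) by blast
    qed
    ultimately show ?thesis by (intro exI[of _ D]) auto
  qed
  show ?thesis by (intro exI[of _ c] exI[of _ d] conjI c_in d_in sub allI impI) (elim conjE, rule club)
qed

end
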